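(* Let $d\ge 1$ and let $\Gamma$ be a finite graph. Either all generic frameworks in $C^d(\Gamma)$ are globally rigid in $\mathbb{E}^d$, or none of them are.
   Context: A graph $\Gamma$ has a finite vertex set $\mathcal V$ of size $v$ and an edge set $\mathcal E$ of size $e$ consisting of two-element subsets of $\mathcal V$. A framework $\rho$ of $\Gamma$ in Euclidean space $\mathbb{E}^d$ is a map $\mathcal V\to\mathbb{E}^d$; $C^d(\Gamma)\cong\mathbb{R}^{vd}$ is the space of all of them. The length-squared map $\ell:C^d(\Gamma)\to\mathbb{R}^e$ has component $|\rho(u)-\rho(w)|^2$ at the edge $\{u,w\}$. Two frameworks are congruent if they differ by a rigid motion (element of the group generated by rotations, reflections, translations) of $\mathbb{E}^d$. $\rho\in C^d(\Gamma)$ is globally rigid if every $\sigma\in C^d(\Gamma)$ with $\ell(\sigma)=\ell(\rho)$ is congruent to $\rho$. $\rho$ is generic if its $vd$ coordinates satisfy no non-trivial polynomial equation with rational coefficients. *)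

theory Defs
  imports "HOL-Analysis.Analysis" "HOL-Library.Poly_Mapping"
begin

definition finite_graph :: "'v set \<Rightarrow> 'v set set \<Rightarrow> bool" where
  "finite_graph V E \<longleftrightarrow> finite V \<and> (\<forall>e\<in>E. e \<subseteq> V \<and> card e = 2)"

text \<open>
  The dimension \<open>d \<ge> 1\<close> is \<open>CARD('d)\<close>. Frameworks are maps out of \<open>V\<close>, so as functions on the
  type \<open>'v\<close> they are taken to be \<open>undefined\<close> outside \<open>V\<close>.
\<close>

definition frameworks :: "'v set \<Rightarrow> ('v \<Rightarrow> real ^ 'd) set" where
  "frameworks V = V \<rightarrow>\<^sub>E UNIV"

text \<open>The space \<open>\<real>\<^sup>e\<close> is represented by the extensional functions on the edge set.\<close>

definition length_squared :: "'v set set \<Rightarrow> ('v \<Rightarrow> real ^ 'd) \<Rightarrow> 'v set \<Rightarrow> real" where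
  "length_squared E \<rho> =
     (\<lambda>e\<in>E. THE r. \<exists>u w. e = {u, w} \<and> r = (norm (\<rho> u - \<rho> w))\<^sup>2)"

lemma length_squared_edge:
  assumes "{u, w} \<in> E"
  shows "length_squared E \<rho> {u, w} = (norm (\<rho> u - \<rho> w))\<^sup>2"
proof -
  have "(THE r. \<exists>u' w'. {u, w} = {u', w'} \<and> r = (norm (\<rho> u' - \<rho> w'))\<^sup>2)
        = (norm (\<rho> u - \<rho> w))\<^sup>2"
    by (rule the_equality) (auto simp: doubleton_eq_iff norm_minus_commute)
  with assms show ?thesis
    by (simp add: length_squared_def)
qed

inductive rigid_motion :: "(real ^ 'd \<Rightarrow> real ^ 'd) \<Rightarrow> bool" where
  translation: "rigid_motion (\<lambda>x. a + x)"
| rotation: "rotation_matrix A \<Longrightarrow> rigid_motion (\<lambda>x. c + A *v (x - c))"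
| reflection: "n \<noteq> 0 \<Longrightarrow> rigid_motion (\<lambda>x. x - (2 * ((x - c) \<bullet> n) / (n \<bullet> n)) *\<^sub>R n)"
| composition: "rigid_motion S \<Longrightarrow> rigid_motion T \<Longrightarrow> rigid_motion (S \<circ> T)"
| inverse: "rigid_motion T \<Longrightarrow> rigid_motion (inv T)"

text \<open>The generated group is the full isometry group.\<close>

lemma dist_reflection: fixes n :: "real^'d" assumes "n \<noteq> 0"
  shows "dist (x - (2 * ((x - c) \<bullet> n) / (n \<bullet> n)) *\<^sub>R n) (y - (2 * ((y - c) \<bullet> n) / (n \<bullet> n)) *\<^sub>R n) = dist x y"
proof -
  define z where "z = x - y"
  have nn: "n \<bullet> n \<noteq> 0" using assms by simp
  have "2 * ((x - c) \<bullet> n) / (n \<bullet> n) - 2 * ((y - c) \<bullet> n) / (n \<bullet> n) = 2 * (z \<bullet> n) / (n \<bullet> n)"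
    by (simp add: z_def inner_diff_left flip: diff_divide_distrib)
  moreover have "(x - a *\<^sub>R n) - (y - b *\<^sub>R n) = z - (a - b) *\<^sub>R n" for a b
    by (simp add: z_def scaleR_diff_left)
  moreover have "norm (z - (2 * (z \<bullet> n) / (n \<bullet> n)) *\<^sub>R n) = norm z"
  proof -
    define k where "k = 2 * (z \<bullet> n) / (n \<bullet> n)"
    have k: "k * (n \<bullet> n) = 2 * (z \<bullet> n)" using nn by (simp add: k_def)
    have "(z - k *\<^sub>R n) \<bullet> (z - k *\<^sub>R n) = z \<bullet> z - 2 * k * (z \<bullet> n) + k * (k * (n \<bullet> n))"
      by (simp add: inner_diff_left inner_diff_right inner_commute[of n z] algebra_simps)
    then show ?thesis unfolding norm_eq k_def[symmetric] by (simp add: k)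
  qed
  ultimately show ?thesis by (simp only: dist_norm z_def)
qed

lemma rigid_motion_iff_isometry:
  "rigid_motion (T::real^'d \<Rightarrow> _) \<longleftrightarrow> (\<forall>x y. dist (T x) (T y) = dist x y)"
proof
  assume "rigid_motion T"
  then have "surj T \<and> (\<forall>x y. dist (T x) (T y) = dist x y)"
  proof induction
    case (translation a) then show ?case by (auto intro!: surjI[of _ "\<lambda>x. x - a"])
  next
    case (rotation A c)
    then have A: "orthogonal_matrix A" by (simp add: rotation_matrix_def)
    then have o: "orthogonal_transformation ((*v) A)" by (simp add: orthogonal_transformation_matrix)
    have "A *v (transpose A *v (x - c)) = x - c" for x
      using A by (simp add: matrix_vector_mul_assoc orthogonal_matrix_def del: transpose_matrix_vector)
    then have "surj (\<lambda>x. c + A *v (x - c))"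
      by (intro surjI[of _ "\<lambda>x. c + transpose A *v (x - c)"]) (simp del: transpose_matrix_vector)
    moreover have "dist (A *v (x - c)) (A *v (y - c)) = dist x y" for x y
      by (metis o orthogonal_transformation_isometry dist_add_cancel2 diff_add_cancel)
    ultimately show ?case by simp
  next
    case (reflection n c)
    have "n \<bullet> n \<noteq> 0" using reflection by simp
    let ?f = "\<lambda>x. x - (2 * ((x - c) \<bullet> n) / (n \<bullet> n)) *\<^sub>R n"
    have "?f (?f x) = x" for x
    proof -
      define k where "k = 2 * ((x - c) \<bullet> n) / (n \<bullet> n)"
      have "(x - k *\<^sub>R n - c) \<bullet> n = - ((x - c) \<bullet> n)"
        using \<open>n \<bullet> n \<noteq> 0\<close> by (simp add: k_def inner_diff_left)
      then have "2 * ((x - k *\<^sub>R n - c) \<bullet> n) / (n \<bullet> n) = - k" by (simp add: k_def)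
      then show ?thesis unfolding k_def[symmetric] by simp
    qed
    then have "surj ?f" by (rule surjI)
    then show ?case using dist_reflection[OF reflection] by blast
  next
    case (composition S T) then show ?case using comp_surj[of T S] by simp
  next
    case (inverse T)
    then have "inj T" by (metis dist_eq_0_iff injI)
    then show ?case using inverse by (metis surj_f_inv_f inv_f_f surjI)
  qed
  then show "\<forall>x y. dist (T x) (T y) = dist x y" by blast
next
  assume *: "\<forall>x y. dist (T x) (T y) = dist x y"
  define f where "f x = T x - T 0" for x
  have of': "orthogonal_transformation f"
    unfolding orthogonal_transformation_isometry using * by (simp add: f_def dist_norm)
  define A where "A = matrix f"
  have fA: "f = (*v) A" using of' by (simp add: A_def orthogonal_transformation_def fun_eq_iff)
  have oA: "orthogonal_matrix A" using of' by (simp add: A_def orthogonal_transformation_matrix)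
  have rf: "rigid_motion f"
  proof (cases "rotation_matrix A")
    case True
    then show ?thesis using rotation[of A 0] fA by simp
  next
    case False
    then have "det A = -1" using oA det_orthogonal_matrix rotation_matrix_def by blast
    define n :: "real^'d" where "n = axis undefined 1"
    have n: "n \<noteq> 0" "n \<bullet> n = 1" by (auto simp: n_def axis_eq_0_iff inner_axis_axis)
    define R where "R = (\<lambda>x. x - (2 * ((x - 0) \<bullet> n) / (n \<bullet> n)) *\<^sub>R n)"
    have "rigid_motion R" unfolding R_def by (rule reflection[OF n(1)])
    have oR: "orthogonal_transformation R" unfolding orthogonal_transformation_isometry using dist_reflection[OF n(1), of _ 0]
      by (simp add: R_def)
    have "matrix R = (\<chi> i j. if i = j then (if i = undefined then -1 else 1) else 0)"
      by (simp add: matrix_def R_def vec_eq_iff n_def inner_axis_axis) (auto simp: axis_def)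
    then have "det (matrix R) = (\<Prod>i\<in>UNIV. if i = (undefined::'d) then -1 else 1)"
      by (subst det_diagonal) auto
    then have "det (matrix R) = -1" by simp
    have oRm: "orthogonal_matrix (matrix R)" using oR by (simp add: orthogonal_transformation_matrix)
    have "rotation_matrix (A ** matrix R)" 
      by (simp add: rotation_matrix_def det_mul \<open>det A = -1\<close> \<open>det (matrix R) = -1\<close> orthogonal_matrix_mul oA oRm)
    from rotation[OF this, of 0] have "rigid_motion (\<lambda>x. (A ** matrix R) *v x)" by simp
    moreover have "R (R x) = x" for x using n by (simp add: R_def inner_diff_left algebra_simps)
    moreover have "(matrix R) *v x = R x" for x using oR by (simp add: orthogonal_transformation_def)
    ultimately have "rigid_motion ((\<lambda>x. (A ** matrix R) *v x) \<circ> R)" using composition \<open>rigid_motion R\<close> by blast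
    also have "((\<lambda>x. (A ** matrix R) *v x) \<circ> R) = f"
      using \<open>\<And>x. R (R x) = x\<close> \<open>\<And>x. (matrix R) *v x = R x\<close>
      by (auto simp: fA fun_eq_iff simp flip: matrix_vector_mul_assoc)
    finally show ?thesis .
  qed
  have "T = (\<lambda>x. T 0 + x) \<circ> f" by (auto simp: f_def)
  then show "rigid_motion T" using composition[OF translation rf] by metis
qed

definition congruent_frameworks ::
    "'v set \<Rightarrow> ('v \<Rightarrow> real ^ 'd) \<Rightarrow> ('v \<Rightarrow> real ^ 'd) \<Rightarrow> bool" where
  "congruent_frameworks V \<rho> \<sigma> \<longleftrightarrow> (\<exists>T. rigid_motion T \<and> (\<forall>u\<in>V. \<sigma> u = T (\<rho> u)))"

definition globally_rigid :: "'v set \<Rightarrow> 'v set set \<Rightarrow> ('v \<Rightarrow> real ^ 'd) \<Rightarrow> bool" where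
  "globally_rigid V E \<rho> \<longleftrightarrow>
     (\<forall>\<sigma>\<in>frameworks V. length_squared E \<sigma> = length_squared E \<rho> \<longrightarrow> congruent_frameworks V \<rho> \<sigma>)"

text \<open>
  A polynomial over the rationals in indeterminates of type \<open>'x\<close> is a finitely supported map from
  monomials to coefficients, a monomial being a finitely supported map from indeterminates to
  exponents.
\<close>

type_synonym 'x rat_mpoly = "('x \<Rightarrow>\<^sub>0 nat) \<Rightarrow>\<^sub>0 rat"

definition mpoly_indets :: "'x rat_mpoly \<Rightarrow> 'x set" where
  "mpoly_indets p = (\<Union>m\<in>Poly_Mapping.keys p. Poly_Mapping.keys m)"

definition mpoly_eval :: "'x rat_mpoly \<Rightarrow> ('x \<Rightarrow> real) \<Rightarrow> real" where
  "mpoly_eval p a =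
     (\<Sum>m\<in>Poly_Mapping.keys p. of_rat (Poly_Mapping.lookup p m) *
        (\<Prod>x\<in>Poly_Mapping.keys m. a x ^ Poly_Mapping.lookup m x))"

text \<open>The indeterminate \<open>(u, i)\<close> stands for the \<open>i\<close>-th coordinate of the vertex \<open>u\<close>.\<close>

definition generic :: "'v set \<Rightarrow> ('v \<Rightarrow> real ^ 'd) \<Rightarrow> bool" where
  "generic V \<rho> \<longleftrightarrow>
     (\<forall>p :: ('v \<times> 'd) rat_mpoly.
        p \<noteq> 0 \<and> mpoly_indets p \<subseteq> V \<times> UNIV \<longrightarrow> mpoly_eval p (\<lambda>(u, i). \<rho> u $ i) \<noteq> 0)"

end

theory Submission
  imports Defs
begin

text \<open>
  Write \<open>\<delta>f\<close> for the differences of a function \<open>f\<close> on the vertices along the edges. For a generic framework \<open>\<rho>\<close> let \<open>T\<close> be the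
  image of the differential of the length-squared map and \<open>K\<close> the common kernel of the equilibrium
  stresses of \<open>\<rho>\<close>, that is, the space of all \<open>f\<close> with \<open>\<delta>f \<sqdot> \<delta>g \<in> T\<close> for all \<open>g\<close>. Consider two conditions: every element of
  \<open>K\<close> is an affine function of \<open>\<rho>\<close>; no quadratic form vanishes on all edge directions but not on all differences
  of vertices. Each holds at all generic frameworks or at none, because the linear relations between
  vectors with rational polynomial entries are the same at all generic points.
  Together they are equivalent to global rigidity of \<open>\<rho>\<close>.

  Sufficiency: if \<open>\<sigma>\<close> has the edge lengths of \<open>\<rho>\<close>, derivations of the reals, which move \<open>\<rho>\<close> in every
  direction, show that \<open>T\<close> is contained in the corresponding space of \<open>\<sigma>\<close>, with equality since \<open>\<rho>\<close> has maximal rank. So the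
  coordinates of \<open>\<sigma>\<close> lie in \<open>K\<close>, \<open>\<sigma>\<close> is an affine image of \<open>\<rho>\<close>, and the second condition makes it congruent to \<open>\<rho>\<close>. If the
  second condition fails, \<open>\<rho>\<close> has a noncongruent affine image with the same edge lengths.

  Suppose the first condition fails. Genericity implies \<open>\<delta>f \<sqdot> \<delta>g \<in> \<Sum>\<^sub>i \<delta>\<rho>\<^sub>i \<sqdot> \<delta>K\<close> for \<open>f\<close> and \<open>g\<close> in \<open>K\<close>, so the
  length-squared map, restricted to the frameworks with coordinates in \<open>K\<close> modulo congruence, goes into a space of
  at most the same dimension. In upper trapezoidal coordinates with nonnegative diagonal it is invariant under the sign change
  of a row whose diagonal entry vanishes. Since \<open>dim K > d + 1\<close>, these sign changes act without fixed points on the simplices in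
  the walls, so a piecewise linear approximation covers generic points an even number of times, and \<open>\<rho>\<close> has a
  noncongruent companion.
\<close>

subsection \<open>Linear independence of finite families\<close>

text \<open>A count modulo 2 needs source and target of equal dimension, and the space of edge
  lengths is too large. Restricted to \<open>K\<close>, the length-squared map takes values in the
  span of the products of a coordinate with a basis function, and there are as many of these as
  entries in an upper trapezoidal matrix. Such matrices parametrise frameworks modulo congruence
  only as a region bounded by the walls where a diagonal entry vanishes, and the wall facets would
  spoil the count. But on a wall the sign of the rest of the row is free, which pairs these facets
  off. For this each row needs an entry to the right of its diagonal entry; for the last row this is
  the condition \<open>dim K > d + 1\<close>. In the sufficiency part the obstacle is that
  \<open>\<sigma>\<close> need not be generic, so nothing is known about its tangent space. A
  derivation of the reals, prescribed on the coordinates of \<open>\<rho>\<close>, extends to any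
  finite set of further reals; applied to the equations between the squared lengths it yields the
  comparison of tangent spaces.\<close>

definition indep_on :: "'j set \<Rightarrow> 's set \<Rightarrow> ('j \<Rightarrow> 's \<Rightarrow> real) \<Rightarrow> bool" where
  "indep_on J S w \<longleftrightarrow> (\<forall>c. (\<forall>s\<in>S. (\<Sum>j\<in>J. c j * w j s) = 0) \<longrightarrow> (\<forall>j\<in>J. c j = 0))"

text \<open>Indexed families with an explicit set \<open>S\<close> of coordinates are used because
  the entries \<open>w j s\<close> will be polynomials evaluated at varying points while
  \<open>J\<close> and \<open>S\<close> stay fixed. Equal vectors with different indices count as
  dependent.\<close>

definition comb_on :: "'j set \<Rightarrow> 's set \<Rightarrow> ('j \<Rightarrow> 's \<Rightarrow> real) \<Rightarrow> ('s \<Rightarrow> real) \<Rightarrow> bool" where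
  "comb_on J S w y \<longleftrightarrow> (\<exists>c. \<forall>s\<in>S. y s = (\<Sum>j\<in>J. c j * w j s))"

lemma indep_onD:
  "indep_on J S w \<Longrightarrow> (\<And>s. s \<in> S \<Longrightarrow> (\<Sum>j\<in>J. c j * w j s) = 0) \<Longrightarrow> j \<in> J \<Longrightarrow> c j = 0"
  unfolding indep_on_def by blast

lemma comb_on_cong:
  "(\<And>s. s \<in> S \<Longrightarrow> y s = y' s) \<Longrightarrow> comb_on J S w y \<Longrightarrow> comb_on J S w y'"
  unfolding comb_on_def by metis

lemma comb_on_member:
  assumes "finite J" "j \<in> J"
  shows "comb_on J S w (w j)"
  unfolding comb_on_def
  by (rule exI[of _ "\<lambda>i. if i = j then 1 else 0"])
    (use assms in \<open>simp add: if_distrib[of "\<lambda>x. x * _"] cong: if_cong\<close>)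

lemma comb_on_zero: "comb_on J S w (\<lambda>s. 0)"
  unfolding comb_on_def by (rule exI[of _ "\<lambda>i. 0"]) simp

lemma comb_on_add:
  assumes "comb_on J S w y" "comb_on J S w z"
  shows "comb_on J S w (\<lambda>s. y s + z s)"
proof -
  obtain c d where "\<forall>s\<in>S. y s = (\<Sum>j\<in>J. c j * w j s)" "\<forall>s\<in>S. z s = (\<Sum>j\<in>J. d j * w j s)"
    using assms unfolding comb_on_def by blast
  then show ?thesis
    unfolding comb_on_def
    by (intro exI[of _ "\<lambda>j. c j + d j"]) (simp add: sum.distrib distrib_right)
qed

lemma comb_on_scale:
  assumes "comb_on J S w y"
  shows "comb_on J S w (\<lambda>s. a * y s)"
proof -
  obtain c where "\<forall>s\<in>S. y s = (\<Sum>j\<in>J. c j * w j s)"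
    using assms unfolding comb_on_def by blast
  then show ?thesis
    unfolding comb_on_def
    by (intro exI[of _ "\<lambda>j. a * c j"]) (simp add: sum_distrib_left mult.assoc)
qed

lemma comb_on_sum:
  assumes "\<And>k. k \<in> A \<Longrightarrow> comb_on J S w (y k)"
  shows "comb_on J S w (\<lambda>s. \<Sum>k\<in>A. y k s)"
  using assms by (induction A rule: infinite_finite_induct) (auto intro: comb_on_add comb_on_zero)

lemma comb_on_trans:
  assumes "comb_on J S w y" "\<And>j. j \<in> J \<Longrightarrow> comb_on J' S w' (w j)"
  shows "comb_on J' S w' y"
proof -
  obtain c where c: "\<forall>s\<in>S. y s = (\<Sum>j\<in>J. c j * w j s)"
    using assms(1) unfolding comb_on_def by blast
  have "comb_on J' S w' (\<lambda>s. \<Sum>j\<in>J. c j * w j s)"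
    by (intro comb_on_sum comb_on_scale assms(2))
  then show ?thesis using c by (auto intro: comb_on_cong[rotated])
qed

lemma comb_on_mono:
  assumes "comb_on J S w y" "J \<subseteq> J'" "finite J'"
  shows "comb_on J' S w y"
  using assms by (auto intro: comb_on_trans comb_on_member)

text \<open>Gaussian elimination, with \<open>J\<close> indexing the unknowns and \<open>S\<close>
  the equations: each equation eliminates at most one unknown.\<close>

lemma homogeneous_system_solution:
  assumes "finite J" "finite S" "card S < card J"
  shows "\<not> indep_on J S w"
  using assms(2,1,3)
proof (induction S arbitrary: J w rule: finite_induct)
  case empty
  then obtain j where "j \<in> J" by (metis card.empty all_not_in_conv less_irrefl)
  then show ?case unfolding indep_on_def by (auto intro!: exI[of _ "\<lambda>_. 1"])
next
  case (insert s S)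
  show ?case
  proof (cases "\<exists>k\<in>J. w k s \<noteq> 0")
    case False
    have "\<not> indep_on J S w" using insert by simp
    then obtain c where c: "\<forall>t\<in>S. (\<Sum>j\<in>J. c j * w j t) = 0" "\<not> (\<forall>j\<in>J. c j = 0)"
      unfolding indep_on_def by blast
    moreover have "(\<Sum>j\<in>J. c j * w j s) = 0" using False by simp
    ultimately show ?thesis unfolding indep_on_def by blast
  next
    case True
    then obtain k where k: "k \<in> J" "w k s \<noteq> 0" by blast
    define w' where "w' j t = w j t - w j s / w k s * w k t" for j t
    have "\<not> indep_on (J - {k}) S w'" using insert k by simp
    then obtain c where c: "\<forall>t\<in>S. (\<Sum>j\<in>J-{k}. c j * w' j t) = 0" "\<not> (\<forall>j\<in>J-{k}. c j = 0)"
      unfolding indep_on_def by blast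
    define c' where "c' j = (if j = k then - (\<Sum>j\<in>J-{k}. c j * w j s) / w k s else c j)" for j
    have eq: "(\<Sum>j\<in>J. c' j * w j t) = (\<Sum>j\<in>J-{k}. c j * w' j t)" for t
    proof -
      have "(\<Sum>j\<in>J. c' j * w j t) = c' k * w k t + (\<Sum>j\<in>J-{k}. c' j * w j t)"
        using insert k by (simp add: sum.remove)
      also have "(\<Sum>j\<in>J-{k}. c' j * w j t) = (\<Sum>j\<in>J-{k}. c j * w j t)"
        by (rule sum.cong) (auto simp: c'_def)
      also have "c' k * w k t = - (\<Sum>j\<in>J-{k}. c j * (w j s / w k s * w k t))"
        by (simp add: c'_def sum_distrib_left sum_distrib_right sum_divide_distrib mult_ac)
      finally show ?thesis by (simp add: w'_def right_diff_distrib sum_subtractf)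
    qed
    have "(\<Sum>j\<in>J. c' j * w j t) = 0" if "t \<in> insert s S" for t
    proof (cases "t \<in> S")
      case True then show ?thesis using eq c by simp
    next
      case False
      then have "t = s" using that by simp
      then show ?thesis unfolding eq using k by (simp add: w'_def)
    qed
    moreover have "\<not> (\<forall>j\<in>J. c' j = 0)" using c(2) unfolding c'_def by (auto split: if_splits)
    ultimately show ?thesis unfolding indep_on_def by blast
  qed
qed

text \<open>Steinitz: with more vectors than generators the rows of the coefficient matrix
  \<open>c\<close> satisfy a nontrivial relation, which carries over to the
  \<open>w j\<close>.\<close>

lemma indep_on_card_le:
  assumes "finite J" "finite J0" "indep_on J S w" "\<And>j. j \<in> J \<Longrightarrow> comb_on J0 S w0 (w j)"
  shows "card J \<le> card J0"
proof (rule ccontr)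
  assume "\<not> card J \<le> card J0"
  have "\<forall>j\<in>J. \<exists>c. \<forall>s\<in>S. w j s = (\<Sum>i\<in>J0. c i * w0 i s)"
    using assms(4) unfolding comb_on_def by blast
  then obtain c where c: "\<And>j s. j \<in> J \<Longrightarrow> s \<in> S \<Longrightarrow> w j s = (\<Sum>i\<in>J0. c j i * w0 i s)" by metis
  have "\<not> indep_on J J0 c"
    using homogeneous_system_solution[of J J0 c] assms \<open>\<not> card J \<le> card J0\<close> by simp
  then obtain x where x: "\<forall>i\<in>J0. (\<Sum>j\<in>J. x j * c j i) = 0" "\<not> (\<forall>j\<in>J. x j = 0)"
    unfolding indep_on_def by blast
  have "(\<Sum>j\<in>J. x j * w j s) = 0" if "s \<in> S" for s
  proof -
    have "(\<Sum>j\<in>J. x j * w j s) = (\<Sum>j\<in>J. \<Sum>i\<in>J0. x j * c j i * w0 i s)"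
      using that by (simp add: c sum_distrib_left mult.assoc)
    also have "\<dots> = (\<Sum>i\<in>J0. (\<Sum>j\<in>J. x j * c j i) * w0 i s)"
      by (subst sum.swap) (simp add: sum_distrib_right)
    finally show ?thesis using x by simp
  qed
  then show False using x(2) assms(3) unfolding indep_on_def by blast
qed

lemma indep_on_insert:
  assumes "finite J" "indep_on J S w" "j \<notin> J" "\<not> comb_on J S w (w j)"
  shows "indep_on (insert j J) S w"
  unfolding indep_on_def
proof (intro allI impI)
  fix c assume c: "\<forall>s\<in>S. (\<Sum>i\<in>insert j J. c i * w i s) = 0"
  then have c': "\<forall>s\<in>S. c j * w j s + (\<Sum>i\<in>J. c i * w i s) = 0" using assms by simp
  have "c j = 0"
  proof (rule ccontr)
    assume "c j \<noteq> 0"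
    have "w j s = (\<Sum>i\<in>J. - c i / c j * w i s)" if "s \<in> S" for s
    proof -
      have "c j * w j s = - (\<Sum>i\<in>J. c i * w i s)" using c' that by (simp add: eq_neg_iff_add_eq_0)
      then have "w j s = - (\<Sum>i\<in>J. c i * w i s) / c j"
        using \<open>c j \<noteq> 0\<close> by (metis nonzero_mult_div_cancel_left)
      also have "\<dots> = (\<Sum>i\<in>J. - c i / c j * w i s)" by (simp add: sum_divide_distrib sum_negf)
      finally show ?thesis .
    qed
    then have "comb_on J S w (w j)" unfolding comb_on_def by (intro exI[of _ "\<lambda>i. - c i / c j"]) blast
    then show False using assms by blast
  qed
  moreover have "c i = 0" if "i \<in> J" for i
    by (rule indep_onD[OF assms(2) _ that]) (use c' \<open>c j = 0\<close> in auto)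
  ultimately show "\<forall>i\<in>insert j J. c i = 0" by blast
qed

lemma comb_on_if_dependent:
  assumes "finite J" "indep_on J S w" "\<not> indep_on (insert j J) S w"
  shows "comb_on J S w (w j)"
proof (cases "j \<in> J")
  case True then show ?thesis using assms(1) by (rule comb_on_member[rotated])
next
  case False
  then show ?thesis using indep_on_insert[of J S w j] assms by metis
qed

lemma maximal_indep_on:
  assumes "finite J"
  obtains J0 where "J0 \<subseteq> J" "indep_on J0 S w" "\<And>j. j \<in> J \<Longrightarrow> comb_on J0 S w (w j)"
proof -
  let ?F = "{J0. J0 \<subseteq> J \<and> indep_on J0 S w}"
  have "?F \<subseteq> Pow J" by blast
  then have F: "finite ?F" using assms finite_subset by blast
  have "{} \<in> ?F" by (simp add: indep_on_def)
  from finite_has_maximal2[OF F this] obtain J0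
    where J0: "J0 \<in> ?F" and "\<forall>J1\<in>?F. J0 \<subseteq> J1 \<longrightarrow> J0 = J1" by (elim bexE conjE)
  then have J0': "J1 = J0" if "J1 \<in> ?F" "J0 \<subseteq> J1" for J1 using that by metis
  have "comb_on J0 S w (w j)" if "j \<in> J" for j
  proof (rule ccontr)
    assume "\<not> comb_on J0 S w (w j)"
    moreover have "finite J0" using J0 assms finite_subset by blast
    ultimately have "indep_on (insert j J0) S w" "j \<notin> J0"
      using comb_on_if_dependent[of J0 S w j] J0 comb_on_member[of J0 j S w] by blast+
    then show False using J0 J0'[of "insert j J0"] that by auto
  qed
  then show ?thesis using that J0 by blast
qed

text \<open>Fraction-free Gaussian elimination: \<open>q\<close> is the product of the pivots.\<close>

lemma indep_on_open_condition:
  fixes w :: "'j \<Rightarrow> 's \<Rightarrow> 'a \<Rightarrow> real"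
  assumes "finite J" "\<And>j s. j \<in> J \<Longrightarrow> s \<in> S \<Longrightarrow> w j s \<in> Q" "(\<lambda>_. 1) \<in> Q"
    "\<And>f g. f \<in> Q \<Longrightarrow> g \<in> Q \<Longrightarrow> (\<lambda>a. f a * g a) \<in> Q"
    "\<And>f g. f \<in> Q \<Longrightarrow> g \<in> Q \<Longrightarrow> (\<lambda>a. f a - g a) \<in> Q"
    "indep_on J S (\<lambda>j s. w j s a0)"
  shows "\<exists>q\<in>Q. q a0 \<noteq> 0 \<and> (\<forall>a. q a \<noteq> 0 \<longrightarrow> indep_on J S (\<lambda>j s. w j s a))"
  using assms(1,2,6)
proof (induction J arbitrary: w rule: finite_induct)
  case empty
  then show ?case using assms(3) by (auto simp: indep_on_def intro!: bexI[of _ "\<lambda>_. 1"])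
next
  case (insert k J)
  have "\<exists>s\<in>S. w k s a0 \<noteq> 0"
  proof (rule ccontr)
    assume "\<not> ?thesis"
    then have "(\<Sum>j\<in>insert k J. (if j = k then 1 else 0) * w j s a0) = 0" if "s \<in> S" for s
      using that by (intro sum.neutral) auto
    from indep_onD[OF insert.prems(2) this] have "(if k = k then 1 else 0::real) = 0" by blast
    then show False by simp
  qed
  then obtain s0 where s0: "s0 \<in> S" "w k s0 a0 \<noteq> 0" by blast
  define w' where "w' j s a = w k s0 a * w j s a - w j s0 a * w k s a" for j s a
  have sum_eq: "(\<Sum>j\<in>J. c j * w' j s a)
      = (\<Sum>j\<in>insert k J. (if j = k then - (\<Sum>j\<in>J. c j * w j s0 a) else w k s0 a * c j) * w j s a)"
    for c s a
  proof -
    have "(\<Sum>j\<in>insert k J. (if j = k then - (\<Sum>j\<in>J. c j * w j s0 a) else w k s0 a * c j) * w j s a)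
      = - (\<Sum>j\<in>J. c j * w j s0 a) * w k s a + (\<Sum>j\<in>J. w k s0 a * c j * w j s a)"
      using insert by (simp, intro sum.cong) auto
    moreover have "(\<Sum>j\<in>J. c j * w' j s a)
      = (\<Sum>j\<in>J. w k s0 a * c j * w j s a) - (\<Sum>j\<in>J. c j * w j s0 a) * w k s a"
      unfolding sum_distrib_right sum_subtractf[symmetric]
      by (rule sum.cong) (auto simp: w'_def algebra_simps)
    ultimately show ?thesis by simp
  qed
  have "indep_on J S (\<lambda>j s. w' j s a0)"
    unfolding indep_on_def
  proof (intro allI impI)
    fix c assume "\<forall>s\<in>S. (\<Sum>j\<in>J. c j * w' j s a0) = 0"
    then have *: "(if j = k then - (\<Sum>j\<in>J. c j * w j s0 a0) else w k s0 a0 * c j) = 0"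
      if "j \<in> insert k J" for j
      unfolding sum_eq using indep_onD[OF insert.prems(2) _ that,
        of "\<lambda>j. if j = k then - (\<Sum>j\<in>J. c j * w j s0 a0) else w k s0 a0 * c j"] by simp
    show "\<forall>j\<in>J. c j = 0"
    proof
      fix j assume "j \<in> J"
      then have "j \<noteq> k" using insert.hyps by blast
      then show "c j = 0" using *[of j] s0 \<open>j \<in> J\<close> by simp
    qed
  qed
  moreover have "w' j s \<in> Q" if "j \<in> J" "s \<in> S" for j s
    unfolding w'_def using that s0 insert.prems(1) by (intro assms(4,5)) auto
  ultimately obtain q where q: "q \<in> Q" "q a0 \<noteq> 0"
      "\<And>a. q a \<noteq> 0 \<Longrightarrow> indep_on J S (\<lambda>j s. w' j s a)"
    using insert.IH[of w'] by metis
  show ?case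
  proof (intro bexI[of _ "\<lambda>a. w k s0 a * q a"] conjI allI impI)
    show "(\<lambda>a. w k s0 a * q a) \<in> Q" using q s0 insert.prems by (intro assms(4)) auto
    show "w k s0 a0 * q a0 \<noteq> 0" using q s0 by simp
    fix a assume a: "w k s0 a * q a \<noteq> 0"
    then have ind: "indep_on J S (\<lambda>j s. w' j s a)" using q by simp
    show "indep_on (insert k J) S (\<lambda>j s. w j s a)"
      unfolding indep_on_def
    proof (intro allI impI)
      fix c assume c: "\<forall>s\<in>S. (\<Sum>j\<in>insert k J. c j * w j s a) = 0"
      then have c': "\<And>s. s \<in> S \<Longrightarrow> (\<Sum>j\<in>J. c j * w j s a) = - c k * w k s a" using insert by force
      have "(\<Sum>j\<in>J. c j * w' j s a) = 0" if "s \<in> S" for s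
      proof -
        have "(\<Sum>j\<in>J. c j * w' j s a) = w k s0 a * (\<Sum>j\<in>J. c j * w j s a) - (\<Sum>j\<in>J. c j * w j s0 a) * w k s a"
          unfolding sum_distrib_right sum_distrib_left sum_subtractf[symmetric]
          by (rule sum.cong) (auto simp: w'_def algebra_simps)
        then show ?thesis using c' that s0 by simp
      qed
      then have cJ: "\<forall>j\<in>J. c j = 0" using ind unfolding indep_on_def by blast
      then have "c k * w k s0 a = 0" using c'[of s0] s0 by simp
      then show "\<forall>j\<in>insert k J. c j = 0" using a cJ by simp
    qed
  qed
qed

subsection \<open>Parity of piecewise linear coverings\<close>

lemma even_card_involution:
  assumes "finite X" "\<And>x. x \<in> X \<Longrightarrow> f x \<in> X" "\<And>x. x \<in> X \<Longrightarrow> f (f x) = x" "\<And>x. x \<in> X \<Longrightarrow> f x \<noteq> x"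
  shows "even (card X)"
  using assms
proof (induction "card X" arbitrary: X rule: less_induct)
  case less
  show ?case
  proof (cases "X = {}")
    case False
    then obtain x where x: "x \<in> X" by blast
    define Y where "Y = X - {x, f x}"
    have "x \<noteq> f x" using less.prems(4)[OF x] by simp
    then have sub: "{x, f x} \<subseteq> X" "card {x, f x} = 2" using x less.prems by auto
    then have card: "card X = card Y + 2"
      unfolding Y_def using less.prems(1) by (metis card_Diff_subset card_mono finite_subset le_add_diff_inverse2)
    have "f y \<in> Y" if "y \<in> Y" for y
    proof -
      have y: "y \<in> X" "y \<noteq> x" "y \<noteq> f x" using that by (auto simp: Y_def)
      then have "f y \<noteq> x" "f y \<noteq> f x" using less.prems(3) x by metis+
      then show ?thesis using less.prems(2) y by (auto simp: Y_def)
    qed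
    then have "even (card Y)"
      using less.hyps[of Y] card less.prems by (auto simp: Y_def)
    then show ?thesis using card by simp
  qed simp
qed

text \<open>If some nonnegative solution has a vanishing coordinate, \<open>nondeg\<close> makes the
  solution space a line, and \<open>bounded\<close> makes this line leave the orthant in both
  directions. The two ends of the resulting segment have exactly one vanishing coordinate each, and
  these differ, so the count is 0 or 2.\<close>

lemma even_card_segment_ends:
  fixes q :: "'h \<Rightarrow> 'c \<Rightarrow> real"
  assumes fin: "finite H" "finite S" "card S < card H"
    and nondeg: "\<And>x h h'. \<forall>c\<in>S. (\<Sum>h\<in>H. x h * q h c) = b c \<Longrightarrow> h \<in> H \<Longrightarrow> h' \<in> H \<Longrightarrow> h \<noteq> h'
      \<Longrightarrow> x h = 0 \<Longrightarrow> x h' \<noteq> 0"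
    and bounded: "\<And>k. \<forall>c\<in>S. (\<Sum>h\<in>H. k h * q h c) = 0 \<Longrightarrow> \<exists>h\<in>H. k h \<noteq> 0
      \<Longrightarrow> (\<exists>h\<in>H. k h > 0) \<and> (\<exists>h\<in>H. k h < 0)"
  shows "even (card {h\<in>H. \<exists>x. (\<forall>c\<in>S. (\<Sum>h\<in>H. x h * q h c) = b c) \<and> (\<forall>h\<in>H. x h \<ge> 0) \<and> x h = 0})"
    (is "even (card ?D)")
proof (cases "?D = {}")
  case True
  show ?thesis unfolding True by simp
next
  case False
  define sol where "sol x \<longleftrightarrow> (\<forall>c\<in>S. (\<Sum>h\<in>H. x h * q h c) = b c)" for x
  define ker where "ker x \<longleftrightarrow> (\<forall>c\<in>S. (\<Sum>h\<in>H. x h * q h c) = 0)" for x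
  have sol_add: "sol (\<lambda>h. x h + t * k h)" if "sol x" "ker k" for x k t
    using that by (simp add: sol_def ker_def distrib_right sum.distrib mult.assoc flip: sum_distrib_left)
  have nondeg': "h = h'" if "sol x" "h \<in> H" "h' \<in> H" "x h = 0" "x h' = 0" for x h h'
    using nondeg[of x h h'] that unfolding sol_def by blast
  from False obtain z h0 where z: "sol z" "\<And>h. h \<in> H \<Longrightarrow> z h \<ge> 0" "h0 \<in> H" "z h0 = 0"
    unfolding sol_def by blast
  obtain k0 where k0: "ker k0" "\<exists>h\<in>H. k0 h \<noteq> 0"
    using homogeneous_system_solution[of H S q] fin unfolding indep_on_def ker_def by blast
  \<comment> \<open>A second independent kernel direction \<open>y\<close> could be used to make
    another coordinate vanish together with \<open>h1\<close>, contrary to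
    \<open>nondeg\<close>.\<close>
  have line: "x h = z h + (x h1 - z h1) / k h1 * k h"
    if x: "sol x" and k: "ker k" "h1 \<in> H" "k h1 \<noteq> 0" and h: "h \<in> H" for x k h1 h
  proof -
    define r where "r = (x h1 - z h1) / k h1"
    define y where "y h = x h - z h - r * k h" for h
    have "ker y" unfolding ker_def y_def using x z(1) k(1)
      by (simp add: sol_def ker_def left_diff_distrib sum_subtractf mult.assoc flip: sum_distrib_left)
    have "y h1 = 0" using k by (simp add: y_def r_def)
    have "y h = 0"
    proof (rule ccontr)
      assume "y h \<noteq> 0"
      define a where "a = - z h1 / k h1"
      define s where "s = - (z h + a * k h) / y h"
      have "sol (\<lambda>h. (z h + a * k h) + s * y h)"
        using sol_add[OF sol_add[OF z(1) k(1)] \<open>ker y\<close>] .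
      moreover have "(z h1 + a * k h1) + s * y h1 = 0" using k \<open>y h1 = 0\<close> by (simp add: a_def)
      moreover have "(z h + a * k h) + s * y h = 0" using \<open>y h \<noteq> 0\<close> by (simp add: s_def)
      ultimately have "h1 = h" using nondeg' k h by blast
      then show False using \<open>y h1 = 0\<close> \<open>y h \<noteq> 0\<close> by simp
    qed
    then show ?thesis by (simp add: y_def r_def)
  qed
  \<comment> \<open>For \<open>k h < 0\<close> this is the time at which coordinate \<open>h\<close>
    vanishes on the way from \<open>z\<close> in direction \<open>k\<close>; the least of these
    times gives the exit point.\<close>
  define len where "len k h = z h / (- k h)" for k h
  have exit_point: "\<exists>h1\<in>H. k h1 < 0 \<and> (\<forall>h\<in>H. k h < 0 \<longrightarrow> len k h1 \<le> len k h)
      \<and> (\<forall>h\<in>H. z h + len k h1 * k h \<ge> 0)" if k: "ker k" "\<exists>h\<in>H. k h \<noteq> 0" for k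
  proof -
    define A where "A = {h\<in>H. k h < 0}"
    have "finite A" "A \<noteq> {}" using fin bounded[of k] k unfolding A_def ker_def by auto
    define h1 where "h1 = arg_min_on (len k) A"
    have h1: "h1 \<in> A" "\<And>h. h \<in> A \<Longrightarrow> len k h1 \<le> len k h"
      unfolding h1_def using \<open>finite A\<close> \<open>A \<noteq> {}\<close>
      by (auto intro: arg_min_if_finite arg_min_least)
    have "z h + len k h1 * k h \<ge> 0" if h: "h \<in> H" for h
    proof (cases "k h < 0")
      case True
      then have "len k h1 * (- k h) \<le> len k h * (- k h)" using h1(2)[of h] h
        by (intro mult_right_mono) (auto simp: A_def)
      also have "\<dots> = z h" using True by (simp add: len_def)
      finally show ?thesis by simp
    next
      case False
      have "len k h1 \<ge> 0" using h1(1) z(2) unfolding A_def len_def by (auto intro: divide_nonneg_pos simp: divide_nonneg_neg)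
      then show ?thesis using False z(2)[OF h] by simp
    qed
    then show ?thesis using h1 unfolding A_def by blast
  qed
  \<comment> \<open>Along a direction with \<open>k0 h0 = 0\<close> coordinate \<open>h0\<close>
    would stay zero until a second one vanishes.\<close>
  have k0_h0: "k0 h0 \<noteq> 0"
  proof
    assume "k0 h0 = 0"
    obtain h1 where h1: "h1 \<in> H" "k0 h1 < 0" using exit_point[OF k0] by blast
    have "sol (\<lambda>h. z h + len k0 h1 * k0 h)" using sol_add z k0 by blast
    moreover have "z h1 + len k0 h1 * k0 h1 = 0" using h1 by (simp add: len_def)
    ultimately have "h0 = h1" using nondeg'[of _ h0 h1] z h1 \<open>k0 h0 = 0\<close> by simp
    then show False using h1 \<open>k0 h0 = 0\<close> by simp
  qed
  define k where "k h = k0 h / k0 h0" for h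
  have k: "ker k" "k h0 > 0" "\<exists>h\<in>H. k h \<noteq> 0"
    using k0 k0_h0 z(3) by (auto simp: ker_def k_def simp flip: sum_divide_distrib)
  obtain h1 where h1: "h1 \<in> H" "k h1 < 0" "\<And>h. h \<in> H \<Longrightarrow> k h < 0 \<Longrightarrow> len k h1 \<le> len k h"
      "\<And>h. h \<in> H \<Longrightarrow> z h + len k h1 * k h \<ge> 0"
    using exit_point[OF k(1,3)] by metis
  have ne: "h0 \<noteq> h1" using k h1 by auto
  have end1: "sol (\<lambda>h. z h + len k h1 * k h)" "z h1 + len k h1 * k h1 = 0"
    subgoal by (rule sol_add[OF z(1) k(1)])
    subgoal using h1(2) by (simp add: len_def)
    done
  have "?D = {h0, h1}"
  proof (intro subset_antisym subsetI)
    fix h assume "h \<in> {h0, h1}"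
    then consider "h = h0" | "h = h1" by blast
    then show "h \<in> ?D"
    proof cases
      case 1
      then show ?thesis using z unfolding sol_def by (auto intro!: exI[of _ z])
    next
      case 2
      then show ?thesis using end1 h1(1,4) unfolding sol_def
        by (auto intro!: exI[of _ "\<lambda>h. z h + len k h1 * k h"])
    qed
  next
    fix h assume "h \<in> ?D"
    then have "h \<in> H" "\<exists>x. sol x \<and> (\<forall>h\<in>H. x h \<ge> 0) \<and> x h = 0" unfolding sol_def by auto
    then obtain x where x: "h \<in> H" "sol x" "\<And>h. h \<in> H \<Longrightarrow> x h \<ge> 0" "x h = 0" by blast
    \<comment> \<open>Every solution lies on the line through \<open>z\<close>, so \<open>x\<close>
      is reached at a time \<open>t \<ge> 0\<close>. If its vanishing coordinate is not
      \<open>h0\<close>, then \<open>t\<close> is the exit time of that coordinate, hence at least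
      that of \<open>h1\<close>, while \<open>x h1 \<ge> 0\<close> gives the converse
      inequality.\<close>
    define t where "t = (x h0 - z h0) / k h0"
    have xt: "x h' = z h' + t * k h'" if "h' \<in> H" for h'
      unfolding t_def using line[OF x(2) k(1) z(3)] k(2) that by simp
    have "t \<ge> 0" using x(3)[of h0] z k by (simp add: t_def)
    show "h \<in> {h0, h1}"
    proof (rule ccontr)
      assume "h \<notin> {h0, h1}"
      then have "z h \<noteq> 0" using nondeg'[OF z(1), of h h0] x z by auto
      then have "z h > 0" using z(2)[of h] x(1) by simp
      then have "t * k h < 0" using xt[OF x(1)] x(4) by simp
      then have kh: "k h < 0" using \<open>t \<ge> 0\<close> by (simp add: mult_less_0_iff)
      then have "t = len k h" using xt[OF x(1)] x(4) by (simp add: len_def field_simps)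
      have "t * (- k h1) \<le> z h1" using xt[OF h1(1)] x(3)[OF h1(1)] by simp
      then have "t \<le> len k h1" using h1(2) by (simp add: len_def field_simps)
      then have "t = len k h1" using h1(3)[OF x(1) kh] \<open>t = len k h\<close> by simp
      then have "x h1 = 0" using xt[OF h1(1)] end1 by simp
      then have "h = h1" using nondeg'[OF x(2,1) h1(1) x(4)] by simp
      then show False using \<open>h \<notin> {h0, h1}\<close> by simp
    qed
  qed
  then show ?thesis using ne by simp
qed

section \<open>Triangulation of a box, symmetric under sign changes\<close>

definition flip :: "'i set \<Rightarrow> ('i \<Rightarrow> 'a::uminus) \<Rightarrow> 'i \<Rightarrow> 'a" where
  "flip A x = (\<lambda>i. if i \<in> A then - x i else x i)"

text \<open>The chamber \<open>(v, e, xs)\<close> is a simplex of the unit cube with opposite vertices \<open>v\<close> (even) and \<open>v + e\<close>, reached from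
  \<open>v\<close> by changing the coordinates in the order \<open>xs\<close>. Choosing \<open>v\<close> even makes the triangulation invariant under
  reflections in the coordinate hyperplanes.\<close>

type_synonym 'i chamber = "('i \<Rightarrow> int) \<times> ('i \<Rightarrow> int) \<times> 'i list"

fun vert :: "'i chamber \<Rightarrow> nat \<Rightarrow> 'i \<Rightarrow> int" where
  "vert (v, e, xs) k = (\<lambda>i. v i + (if i \<in> set (take k xs) then e i else 0))"

fun flip_chamber :: "'i set \<Rightarrow> 'i chamber \<Rightarrow> 'i chamber" where
  "flip_chamber A (v, e, xs) = (flip A v, flip A e, xs)"

lemma vert_flip_chamber: "vert (flip_chamber A C) k = flip A (vert C k)"
  by (cases C) (auto simp: flip_def fun_eq_iff)

definition swap_at :: "nat \<Rightarrow> 'i list \<Rightarrow> 'i list" where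
  "swap_at j xs = xs[j - 1 := xs ! j, j := xs ! (j - 1)]"

text \<open>Exchanging two neighbours in the order of the coordinates alters only one prefix, that
  is, only vertex \<open>j\<close> of the chamber.\<close>

lemma swap_at_props:
  assumes "0 < j" "j < length xs"
  shows "length (swap_at j xs) = length xs" "mset (swap_at j xs) = mset xs"
    "swap_at j (swap_at j xs) = xs"
    "k \<noteq> j \<Longrightarrow> set (take k (swap_at j xs)) = set (take k xs)"
proof -
  show l: "length (swap_at j xs) = length xs" by (simp add: swap_at_def)
  show "mset (swap_at j xs) = mset xs"
    unfolding swap_at_def using assms by (intro mset_swap) auto
  show "swap_at j (swap_at j xs) = xs"
    using assms by (intro nth_equalityI) (auto simp: swap_at_def nth_list_update)
  assume "k \<noteq> j"
  show "set (take k (swap_at j xs)) = set (take k xs)"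
  proof (cases "k < j")
    case True
    then have "take k (swap_at j xs) = take k xs"
      using assms by (simp add: swap_at_def)
    then show ?thesis by simp
  next
    case False
    then have "take k (swap_at j xs) = swap_at j (take k xs)"
      using assms \<open>k \<noteq> j\<close> by (simp add: swap_at_def take_update_swap)
    moreover have "mset (swap_at j (take k xs)) = mset (take k xs)"
      unfolding swap_at_def using assms False \<open>k \<noteq> j\<close> by (intro mset_swap) auto
    ultimately show ?thesis by (metis set_mset_mset)
  qed
qed

text \<open>The box has the range \<open>[0, N]\<close> in the coordinates of \<open>P\<close> and
  \<open>[-N, N]\<close> in the others. On the wall where coordinate \<open>p\<close> vanishes, the
  coordinates in \<open>R p\<close> will change sign: \<open>R p \<subseteq> I - P\<close> keeps the
  box invariant, and \<open>R p \<noteq> {}\<close> makes the change move every chamber. Even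
  \<open>N\<close> puts the boundary of the box on the grid of even vertices.\<close>

locale chamber_box =
  fixes I P :: "'i set" and R :: "'i \<Rightarrow> 'i set" and N :: int
  assumes fin: "finite I" and ne: "I \<noteq> {}" and P: "P \<subseteq> I"
    and R: "\<And>p. p \<in> P \<Longrightarrow> R p \<subseteq> I - P" "\<And>p. p \<in> P \<Longrightarrow> R p \<noteq> {}"
    and N: "even N"
begin

definition in_box :: "'i \<Rightarrow> int \<Rightarrow> bool" where
  "in_box i a \<longleftrightarrow> (if i \<in> P then 0 else - N) \<le> a \<and> a \<le> N"

text \<open>The values 0 outside \<open>I\<close> make the chambers finite in number and let
  different triples be different simplices.\<close>

fun chamber :: "'i chamber \<Rightarrow> bool" where
  "chamber (v, e, xs) \<longleftrightarrow> distinct xs \<and> set xs = I \<and> (\<forall>i. i \<notin> I \<longrightarrow> v i = 0 \<and> e i = 0) \<and>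
    (\<forall>i\<in>I. even (v i) \<and> (e i = 1 \<or> e i = -1) \<and> in_box i (v i) \<and> in_box i (v i + e i))"

text \<open>\<open>step j C\<close> is the chamber on the other side of the facet of \<open>C\<close> opposite to vertex \<open>j\<close>.\<close>

fun step :: "nat \<Rightarrow> 'i chamber \<Rightarrow> 'i chamber" where
  "step j (v, e, xs) =
    (if j = 0 then (v(hd xs := v (hd xs) + 2 * e (hd xs)), e(hd xs := - e (hd xs)), xs)
     else if j < length xs then (v, e, swap_at j xs)
     else (v, e(last xs := - e (last xs)), xs))"

lemma length_chamber: "chamber (v, e, xs) \<Longrightarrow> length xs = card I"
  by (auto simp: distinct_card)

lemma card_pos: "card I > 0"
  using fin ne by (simp add: card_gt_0_iff)

lemma finite_chambers: "finite {C. chamber C}"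
proof -
  let ?F = "\<lambda>A. {v::'i \<Rightarrow> int. (\<forall>i. (i \<in> I \<longrightarrow> v i \<in> A) \<and> (i \<notin> I \<longrightarrow> v i = 0))}"
  have "{C. chamber C} \<subseteq> ?F {- \<bar>N\<bar>..\<bar>N\<bar>} \<times> ?F {-1, 1} \<times> {xs. set xs \<subseteq> I \<and> length xs = card I}"
  proof
    fix C assume "C \<in> {C. chamber C}"
    then obtain v e xs where C: "C = (v, e, xs)" and c: "chamber (v, e, xs)" by (cases C) auto
    have "in_box i a \<Longrightarrow> a \<in> {- \<bar>N\<bar>..\<bar>N\<bar>}" for i a
      by (auto simp: in_box_def split: if_splits)
    then show "C \<in> ?F {- \<bar>N\<bar>..\<bar>N\<bar>} \<times> ?F {-1, 1} \<times> {xs. set xs \<subseteq> I \<and> length xs = card I}"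
      unfolding C using c by (auto simp: distinct_card)
  qed
  moreover have "finite \<dots>"
    by (intro finite_cartesian_product finite_set_of_finite_funs fin finite_lists_length_eq) auto
  ultimately show ?thesis by (rule finite_subset)
qed

lemma vert_step:
  assumes "chamber C" "j \<le> card I" "k \<le> card I" "k \<noteq> j"
  shows "vert (step j C) k = vert C k"
proof -
  obtain v e xs where C: "C = (v, e, xs)" by (cases C)
  have xs: "length xs = card I" "distinct xs" "xs \<noteq> []"
    using assms(1) card_pos length_chamber[of v e xs] unfolding C by auto
  consider "j = 0" | "0 < j" "j < length xs" | "j = length xs" "j \<noteq> 0" using xs assms by linarith
  then show ?thesis
  proof cases
    case 1
    then have "hd xs \<in> set (take k xs)" using xs assms by (cases xs; cases k) auto
    then show ?thesis using 1 by (auto simp: C fun_eq_iff)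
  next
    case 2
    then show ?thesis using assms by (simp add: C swap_at_props(4) fun_eq_iff)
  next
    case 3
    then have "k < length xs" using xs assms by simp
    then have "last xs \<notin> set (take k xs)"
      using xs by (metis append_take_drop_id distinct_append disjoint_iff drop_eq_Nil last_appendR last_in_set not_le)
    then show ?thesis using 3 by (auto simp: C fun_eq_iff)
  qed
qed

lemma step_step:
  assumes "chamber C" "j \<le> card I"
  shows "step j (step j C) = C"
proof -
  obtain v e xs where C: "C = (v, e, xs)" by (cases C)
  have xs: "length xs = card I" using assms length_chamber unfolding C by blast
  show ?thesis
    using assms(2) xs swap_at_props(1,3)[of j xs] unfolding C by auto
qed

lemma step_neq:
  assumes "chamber C" "j \<le> card I"
  shows "step j C \<noteq> C"
proof -
  obtain v e xs where C: "C = (v, e, xs)" by (cases C)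
  have xs: "length xs = card I" "distinct xs" "set xs = I" "xs \<noteq> []"
    using assms card_pos length_chamber[of v e xs] unfolding C by auto
  have e: "e (hd xs) \<noteq> 0" "e (last xs) \<noteq> 0" using assms(1) xs unfolding C
    by (metis chamber.simps hd_in_set last_in_set zero_neq_one zero_neq_neg_one)+
  have "swap_at j xs \<noteq> xs" if "0 < j" "j < length xs"
  proof
    assume "swap_at j xs = xs"
    then have "xs ! j = swap_at j xs ! j" by simp
    also have "\<dots> = xs ! (j - 1)" using that by (simp add: swap_at_def)
    finally show False using that xs(2) by (simp add: nth_eq_iff_index_eq)
  qed
  then show ?thesis
    using assms(2) xs e unfolding C by (auto simp: fun_eq_iff dest: spec[of _ "last xs"] spec[of _ "hd xs"])
qed

text \<open>The delicate case is \<open>j = 0\<close>: there \<open>v i + e i\<close> is odd and so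
  lies strictly between the even bounds of the box, hence \<open>v i + 2 * e i\<close> is still
  inside. Thus only the facet opposite the last vertex can lie on the boundary.\<close>

lemma chamber_step:
  assumes "chamber C" "j < card I"
  shows "chamber (step j C)"
proof -
  obtain v e xs where C: "C = (v, e, xs)" by (cases C)
  have xs: "length xs = card I" "distinct xs" "set xs = I" "xs \<noteq> []"
    using assms card_pos length_chamber[of v e xs] unfolding C by auto
  show ?thesis
  proof (cases "j = 0")
    case True
    have "hd xs \<in> I" using xs by auto
    then have h: "even (v (hd xs))" "e (hd xs) = 1 \<or> e (hd xs) = -1"
      "in_box (hd xs) (v (hd xs))" "in_box (hd xs) (v (hd xs) + e (hd xs))"
      using assms(1) unfolding C by auto
    have "in_box (hd xs) (v (hd xs) + 2 * e (hd xs))"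
      using h N unfolding in_box_def by (auto split: if_splits elim!: evenE; presburger)
    then show ?thesis using True assms(1) h xs(4) unfolding C by (auto simp: add.commute split: if_splits)
  next
    case False
    then have "mset (swap_at j xs) = mset xs" using assms xs by (intro swap_at_props(2)) auto
    then have "distinct (swap_at j xs)" "set (swap_at j xs) = set xs"
      using xs by (metis mset_eq_imp_distinct_iff, metis set_mset_mset)
    then show ?thesis using False assms xs unfolding C by simp
  qed
qed

text \<open>Coordinate \<open>i = last xs\<close> changes only in the final step of the path from
  \<open>v\<close>, so it has the constant value \<open>v i\<close> on the facet opposite the last
  vertex. If reversing \<open>e i\<close> leads out of the box, the even number \<open>v i\<close>
  must be one of the bounds: an outer one, or the wall 0 of a coordinate in
  \<open>P\<close>.\<close>

lemma chamber_step_last: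
  assumes "chamber C" "\<not> chamber (step (card I) C)"
  obtains i where "i \<in> I" "i = last (snd (snd C))" "\<And>k. k < card I \<Longrightarrow> \<bar>vert C k i\<bar> = \<bar>N\<bar>"
  | p where "p \<in> P" "p = last (snd (snd C))" "\<And>k. k < card I \<Longrightarrow> vert C k p = 0"
proof -
  obtain v e xs where C: "C = (v, e, xs)" by (cases C)
  have xs: "length xs = card I" "distinct xs" "set xs = I" "xs \<noteq> []"
    using assms(1) card_pos length_chamber[of v e xs] unfolding C by auto
  define i where "i = last xs"
  have "i \<in> I" using xs i_def by auto
  have out: "\<not> in_box i (v i - e i)"
  proof
    assume "in_box i (v i - e i)"
    then have "chamber (step (card I) C)"
      using assms(1) xs card_pos \<open>i \<in> I\<close> unfolding C by (auto simp: i_def)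
    then show False using assms(2) by simp
  qed
  have "vert C k i = v i" if "k < card I" for k
  proof -
    have "i \<notin> set (take k xs)" unfolding i_def using xs that
      by (metis append_take_drop_id distinct_append disjoint_iff drop_eq_Nil last_appendR last_in_set not_le)
    then show ?thesis by (simp add: C)
  qed
  moreover have "\<bar>v i\<bar> = \<bar>N\<bar> \<or> i \<in> P \<and> v i = 0"
  proof -
    have "even (v i)" "e i = 1 \<or> e i = -1" "in_box i (v i)" "in_box i (v i + e i)"
      using assms(1) \<open>i \<in> I\<close> unfolding C by auto
    then show ?thesis using out N unfolding in_box_def by (auto split: if_splits elim!: evenE; presburger)
  qed
  ultimately show ?thesis using that \<open>i \<in> I\<close> unfolding C i_def by auto
qed

text \<open>No chamber is its own mirror image, because \<open>e\<close> changes sign on the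
  nonempty set \<open>R p\<close>. The sign change commutes with \<open>step (card I)\<close>, so it
  maps boundary facets to boundary facets.\<close>

lemma chamber_flip:
  assumes "chamber C" "p \<in> P"
  shows "chamber (flip_chamber (R p) C)" "flip_chamber (R p) C \<noteq> C"
    "flip_chamber (R p) (flip_chamber (R p) C) = C"
    "chamber (step (card I) (flip_chamber (R p) C)) \<longleftrightarrow> chamber (step (card I) C)"
proof -
  obtain v e xs where C: "C = (v, e, xs)" by (cases C)
  have xs: "length xs = card I" "distinct xs" "set xs = I" "xs \<noteq> []"
    using assms(1) card_pos length_chamber[of v e xs] unfolding C by auto
  have sub: "R p \<subseteq> I - P" "R p \<noteq> {}" using R assms by auto
  have *: "chamber (flip_chamber (R p) (v, e, xs))" if "chamber (v, e, xs)" for v e xs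
    using that sub by (auto simp: flip_def in_box_def)
  show "chamber (flip_chamber (R p) C)" using * assms(1) unfolding C by blast
  show inv: "flip_chamber (R p) (flip_chamber (R p) C) = C" for C
    by (cases C) (auto simp: flip_def fun_eq_iff)
  obtain r where "r \<in> R p" using sub by blast
  then have "r \<in> I" using sub by blast
  then have "e r = 1 \<or> e r = -1" using assms(1) unfolding C by simp
  then have "e r \<noteq> 0" by auto
  then show "flip_chamber (R p) C \<noteq> C"
    using \<open>r \<in> R p\<close> unfolding C by (auto simp: flip_def dest!: fun_cong[of _ _ r])
  have comm: "step (card I) (flip_chamber (R p) C) = flip_chamber (R p) (step (card I) C)"
    using xs card_pos unfolding C by (auto simp: flip_def fun_eq_iff)
  show "chamber (step (card I) (flip_chamber (R p) C)) \<longleftrightarrow> chamber (step (card I) C)"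
    unfolding comm using * inv by (metis prod_cases3)
qed

end

section \<open>Parity of the number of simplices covering a point\<close>

context chamber_box begin

text \<open>Entries \<open>0\<close> to \<open>card I\<close> of \<open>x\<close> are barycentric
  coordinates in the chamber, entry \<open>Suc (card I)\<close> is the parameter on the ray. As
  unknowns of one linear system they put the starting point of the ray on the same footing as the
  facets.\<close>

definition ray_eqs ::
  "(('i \<Rightarrow> int) \<Rightarrow> 'i \<Rightarrow> real) \<Rightarrow> ('i \<Rightarrow> real) \<Rightarrow> ('i \<Rightarrow> real) \<Rightarrow> 'i chamber \<Rightarrow> (nat \<Rightarrow> real) \<Rightarrow> bool" where
  "ray_eqs g y d C x \<longleftrightarrow> (\<Sum>k\<le>card I. x k) = 1 \<and>
     (\<forall>i\<in>I. (\<Sum>k\<le>card I. x k * g (vert C k) i) = y i + x (Suc (card I)) * d i)"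

definition ray_zero ::
  "(('i \<Rightarrow> int) \<Rightarrow> 'i \<Rightarrow> real) \<Rightarrow> ('i \<Rightarrow> real) \<Rightarrow> ('i \<Rightarrow> real) \<Rightarrow> 'i chamber \<Rightarrow> nat \<Rightarrow> bool" where
  "ray_zero g y d C h \<longleftrightarrow> (\<exists>x. ray_eqs g y d C x \<and> (\<forall>k\<le>Suc (card I). x k \<ge> 0) \<and> x h = 0)"

text \<open>The ray from \<open>y\<close> in direction \<open>d\<close> meets the simplex \<open>g C\<close> in a segment: one of its ends may be
  \<open>y\<close> itself (index \<open>card I + 1\<close>), the others lie on facets (indices up to \<open>card I\<close>).\<close>

lemma even_card_ray_zeros:
  assumes nondeg: "\<And>x h h'. ray_eqs g y d C x \<Longrightarrow> h \<le> Suc (card I) \<Longrightarrow> h' \<le> Suc (card I)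
      \<Longrightarrow> h \<noteq> h' \<Longrightarrow> x h = 0 \<Longrightarrow> x h' \<noteq> 0"
    and d: "\<exists>i\<in>I. d i \<noteq> 0"
  shows "even (card {h. h \<le> Suc (card I) \<and> ray_zero g y d C h})"
proof -
  define n where "n = card I"
  define S where "S = insert None (Some ` I)"
  \<comment> \<open>Row \<open>None\<close> normalises the barycentric coordinates, row
    \<open>Some i\<close> is coordinate \<open>i\<close> of the equation of the ray:
    \<open>n + 1\<close> equations for \<open>n + 2\<close> unknowns.\<close>
  define q where "q h c = (case c of None \<Rightarrow> (if h \<le> n then 1 else 0)
      | Some i \<Rightarrow> (if h \<le> n then g (vert C h) i else - d i))" for h :: nat and c
  define b where "b c = (case c of None \<Rightarrow> 1 | Some i \<Rightarrow> y i)" for c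
  have S: "finite S" "card S = Suc n"
    using fin by (auto simp: S_def n_def card_image)
  have sum_None: "(\<Sum>h\<le>Suc n. x h * q h None) = (\<Sum>h\<le>n. x h)" for x
    by (simp add: q_def)
  have sum_Some: "(\<Sum>h\<le>Suc n. x h * q h (Some i)) = (\<Sum>h\<le>n. x h * g (vert C h) i) - x (Suc n) * d i" for x i
    by (simp add: q_def)
  have eqs: "(\<forall>c\<in>S. (\<Sum>h\<le>Suc n. x h * q h c) = b c) \<longleftrightarrow> ray_eqs g y d C x" for x
    unfolding S_def ray_eqs_def n_def[symmetric] ball_simps image_iff sum_None sum_Some
    by (simp add: sum_None sum_Some b_def diff_eq_eq)
  have "even (card {h\<in>{..Suc n}. \<exists>x. (\<forall>c\<in>S. (\<Sum>h\<le>Suc n. x h * q h c) = b c) \<and> (\<forall>h\<in>{..Suc n}. x h \<ge> 0) \<and> x h = 0})"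
  proof (rule even_card_segment_ends)
    show "finite {..Suc n}" "finite S" "card S < card {..Suc n}" using S by simp_all
    show "x h' \<noteq> 0" if "\<forall>c\<in>S. (\<Sum>h\<le>Suc n. x h * q h c) = b c" "h \<in> {..Suc n}" "h' \<in> {..Suc n}" "h \<noteq> h'" "x h = 0"
      for x h h' using nondeg[OF that(1)[unfolded eqs] _ _ that(4,5)] that(2,3) by (simp add: n_def)
    fix k assume k: "\<forall>c\<in>S. (\<Sum>h\<le>Suc n. k h * q h c) = 0" "\<exists>h\<in>{..Suc n}. k h \<noteq> 0"
    have k0: "(\<Sum>h\<le>n. k h) = 0" using k(1) sum_None unfolding S_def by auto
    have ki: "(\<Sum>h\<le>n. k h * g (vert C h) i) = k (Suc n) * d i" if "i \<in> I" for i
    proof -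
      have "(\<Sum>h\<le>Suc n. k h * q h (Some i)) = 0" using k(1) that unfolding S_def by blast
      then show ?thesis unfolding sum_Some by simp
    qed
    \<comment> \<open>The barycentric part of a kernel vector sums to 0, so it has both signs unless
      it vanishes; if it vanished, so would the parameter, because
      \<open>d \<noteq> 0\<close>.\<close>
    have "\<exists>h\<le>n. k h \<noteq> 0"
    proof (rule ccontr)
      assume *: "\<not> ?thesis"
      obtain i where "i \<in> I" "d i \<noteq> 0" using d by blast
      then have "k (Suc n) = 0" using ki[of i] * by simp
      then show False using k(2) * by (auto simp: le_Suc_eq)
    qed
    then obtain h where h: "h \<le> n" "k h \<noteq> 0" by blast
    have "\<exists>h\<le>n. k h > 0"
    proof (rule ccontr)
      assume "\<not> ?thesis"
      then have "\<forall>h\<in>{..n}. - k h = 0"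
        using k0 by (subst sum_nonneg_eq_0_iff[symmetric]) (auto simp: not_less sum_negf)
      then show False using h by simp
    qed
    moreover have "\<exists>h\<le>n. k h < 0"
    proof (rule ccontr)
      assume "\<not> ?thesis"
      then have "\<forall>h\<in>{..n}. k h = 0"
        using k0 by (subst sum_nonneg_eq_0_iff[symmetric]) (auto simp: not_less)
      then show False using h by simp
    qed
    ultimately show "(\<exists>h\<in>{..Suc n}. k h > 0) \<and> (\<exists>h\<in>{..Suc n}. k h < 0)"
      by (meson atMost_iff le_SucI)
  qed
  then show ?thesis unfolding eqs unfolding ray_zero_def n_def by (simp only: Ball_def atMost_iff)
qed

lemma ray_zero_cong:
  assumes "\<And>k i. k \<le> card I \<Longrightarrow> k \<noteq> j \<Longrightarrow> i \<in> I \<Longrightarrow> g (vert C k) i = g (vert C' k) i" "ray_zero g y d C j"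
  shows "ray_zero g y d C' j"
proof -
  obtain x where x: "ray_eqs g y d C x" "\<forall>k\<le>Suc (card I). x k \<ge> 0" "x j = 0"
    using assms(2) unfolding ray_zero_def by blast
  have "(\<Sum>k\<le>card I. x k * g (vert C k) i) = (\<Sum>k\<le>card I. x k * g (vert C' k) i)" if "i \<in> I" for i
    using assms(1) x(3) that by (intro sum.cong) auto
  then have "ray_eqs g y d C' x" using x(1) unfolding ray_eqs_def by simp
  then show ?thesis using x unfolding ray_zero_def by blast
qed

text \<open>Double counting of the pairs of a chamber and an end of its segment. Each chamber
  contributes an even number. The ends on facets cancel in pairs: an inner facet belongs to two
  chambers, a wall facet has a mirror image with the same values of \<open>g\<close>, and outer
  facets are not met. What remains are the chambers whose image contains \<open>y\<close>.\<close>

theorem even_card_covering: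
  assumes nondeg: "\<And>C x h h'. chamber C \<Longrightarrow> ray_eqs g y d C x \<Longrightarrow> h \<le> Suc (card I)
      \<Longrightarrow> h' \<le> Suc (card I) \<Longrightarrow> h \<noteq> h' \<Longrightarrow> x h = 0 \<Longrightarrow> x h' \<noteq> 0"
    and d: "\<exists>i\<in>I. d i \<noteq> 0"
    and flip: "\<And>p q i. p \<in> P \<Longrightarrow> q p = 0 \<Longrightarrow> i \<in> I \<Longrightarrow> g (flip (R p) q) i = g q i"
    and outer: "\<And>C i. chamber C \<Longrightarrow> i \<in> I \<Longrightarrow> (\<And>k. k < card I \<Longrightarrow> \<bar>vert C k i\<bar> = \<bar>N\<bar>)
      \<Longrightarrow> \<not> ray_zero g y d C (card I)"
  shows "even (card {C. chamber C \<and> ray_zero g y d C (Suc (card I))})"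
proof -
  define n where "n = card I"
  define Z where "Z C = {h. h \<le> Suc n \<and> ray_zero g y d C h}" for C
  define X where "X = {(C, j). chamber C \<and> j \<le> n \<and> ray_zero g y d C j}"
  define Y where "Y = {C. chamber C \<and> ray_zero g y d C (Suc n)}"
  \<comment> \<open>If \<open>step j C\<close> leaves the box, the facet lies on the wall of the
    last coordinate of \<open>C\<close>, which therefore selects the sign change.\<close>
  define f where "f Cj = (case Cj of (C, j) \<Rightarrow> if chamber (step j C) then (step j C, j)
      else (flip_chamber (R (last (snd (snd C)))) C, j))" for Cj :: "'i chamber \<times> nat"
  have "even (\<Sum>C\<in>{C. chamber C}. card (Z C))"
    by (rule dvd_sum) (use even_card_ray_zeros nondeg d in \<open>simp add: Z_def n_def\<close>)
  also have "(\<Sum>C\<in>{C. chamber C}. card (Z C)) = card (SIGMA C:{C. chamber C}. Z C)"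
    by (rule card_SigmaI[symmetric]) (auto simp: finite_chambers Z_def)
  also have "(SIGMA C:{C. chamber C}. Z C) = X \<union> (\<lambda>C. (C, Suc n)) ` Y"
    by (auto simp: X_def Y_def Z_def le_Suc_eq)
  also have "card \<dots> = card X + card ((\<lambda>C. (C, Suc n)) ` Y)"
  proof (rule card_Un_disjoint)
    have "X \<subseteq> {C. chamber C} \<times> {..n}" by (auto simp: X_def)
    then show "finite X" by (rule finite_subset) (use finite_chambers in auto)
    show "finite ((\<lambda>C. (C, Suc n)) ` Y)" using finite_chambers by (simp add: Y_def)
  qed (auto simp: X_def)
  also have "card ((\<lambda>C. (C, Suc n)) ` Y) = card Y" by (rule card_image) (auto simp: inj_on_def)
  finally have sum: "even (card X + card Y)" .
  have wall: "\<exists>p. j = n \<and> p \<in> P \<and> p = last (snd (snd C)) \<and> (\<forall>k<n. vert C k p = 0)"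
    if "(C, j) \<in> X" "\<not> chamber (step j C)" for C j
  proof -
    have C: "chamber C" "j \<le> n" "ray_zero g y d C j" using that(1) by (auto simp: X_def)
    then have "j = n" using chamber_step[of C j] that(2) unfolding n_def by force
    then have "\<not> chamber (step (card I) C)" using that(2) n_def by simp
    from chamber_step_last[OF C(1) this] show ?thesis
      using outer[OF C(1)] C(3) \<open>j = n\<close> unfolding n_def by metis
  qed
  have "finite X"
    by (rule finite_subset[of _ "{C. chamber C} \<times> {..n}"]) (use finite_chambers in \<open>auto simp: X_def\<close>)
  have "f Cj \<in> X \<and> f (f Cj) = Cj \<and> f Cj \<noteq> Cj" if "Cj \<in> X" for Cj
  proof -
    obtain C j where Cj: "Cj = (C, j)" by (cases Cj)
    have CX: "(C, j) \<in> X" using that Cj by simp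
    then have C: "chamber C" "j \<le> n" "ray_zero g y d C j" by (auto simp: X_def)
    show ?thesis
    proof (cases "chamber (step j C)")
      case True
      have "ray_zero g y d (step j C) j"
        by (rule ray_zero_cong[OF _ C(3)]) (use vert_step C in \<open>simp add: n_def\<close>)
      then show ?thesis
        using True C step_step[OF C(1), of j] step_neq[OF C(1), of j] unfolding Cj f_def X_def n_def by simp
    next
      case False
      then obtain p where p: "j = n" "p \<in> P" "p = last (snd (snd C))" "\<forall>k<n. vert C k p = 0"
        using wall[OF CX False] by blast
      define C' where "C' = flip_chamber (R p) C"
      have "ray_zero g y d C' j"
      proof (rule ray_zero_cong[OF _ C(3)])
        fix k i assume "k \<le> card I" "k \<noteq> j" "i \<in> I"
        then show "g (vert C k) i = g (vert C' k) i"
          using flip[OF p(2), of "vert C k" i] p unfolding C'_def vert_flip_chamber n_def by simp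
      qed
      moreover have "last (snd (snd C')) = p" using p by (cases C) (simp add: C'_def)
      ultimately show ?thesis
        using False C p chamber_flip[OF C(1) p(2)] unfolding Cj f_def X_def n_def C'_def by simp
    qed
  qed
  then have "even (card X)" using \<open>finite X\<close> by (intro even_card_involution[of X f]) auto
  then show ?thesis using sum unfolding Y_def n_def by simp
qed

end

section \<open>General position by means of the moment curve\<close>

lemma finite_moment_curve_hyperplane:
  fixes a :: "'i \<Rightarrow> real"
  assumes "finite I" "inj_on pos I" "\<exists>i\<in>I. a i \<noteq> 0"
  shows "finite {t. (\<Sum>i\<in>I. a i * t ^ Suc (pos i)) = c}"
proof -
  obtain i0 where i0: "i0 \<in> I" "a i0 \<noteq> 0" using assms by blast
  define p where "p = (\<Sum>i\<in>I. monom (a i) (Suc (pos i))) - [:c:]"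
  \<comment> \<open>The exponents are distinct and positive, so neither another term nor the
    constant \<open>c\<close> can cancel this coefficient.\<close>
  have "coeff p (Suc (pos i0)) = (\<Sum>i\<in>I. if i = i0 then a i else 0)"
    unfolding p_def coeff_diff coeff_sum
    using assms(2) i0 by (auto intro!: sum.cong simp: inj_on_eq_iff)
  also have "\<dots> \<noteq> 0" using i0 assms(1) by simp
  finally have "p \<noteq> 0" by auto
  then have "finite {t. poly p t = 0}" by (rule poly_roots_finite)
  moreover have "poly p t = (\<Sum>i\<in>I. a i * t ^ Suc (pos i)) - c" for t
    by (simp add: p_def poly_sum poly_monom)
  ultimately show ?thesis by simp
qed

context chamber_box begin

text \<open>The moment curve meets a hyperplane only finitely often. So \<open>t\<close> can be
  chosen such that \<open>y\<close> avoids a hyperplane through the image of each facet, and then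
  \<open>d\<close> such that the ray avoids the images of the faces of codimension 2. Since
  \<open>g\<close> is arbitrary, the images may be degenerate; counting unknowns still gives a
  hyperplane containing them.\<close>

lemma generic_ray:
  assumes pos: "inj_on pos I" and h: "h \<noteq> 0" and l: "\<exists>i\<in>I. l i \<noteq> 0"
  obtains t d where "0 < t" "t < 1" "\<exists>i\<in>I. d i \<noteq> 0" "(\<Sum>i\<in>I. l i * d i) < 0"
    "\<And>C x j j'. chamber C \<Longrightarrow> ray_eqs g (\<lambda>i. b i + h * t ^ Suc (pos i)) d C x \<Longrightarrow> j \<le> Suc (card I)
      \<Longrightarrow> j' \<le> Suc (card I) \<Longrightarrow> j \<noteq> j' \<Longrightarrow> x j = 0 \<Longrightarrow> x j' \<noteq> 0"
proof -
  define n where "n = card I"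
  have n: "n > 0" using card_pos n_def by simp
  let ?Fac = "{C. chamber C} \<times> {..n}"
  have finFac: "finite ?Fac" using finite_chambers by simp
  \<comment> \<open>The \<open>n + 1\<close> unknowns are the normal vector and the constant term
    \<open>c None\<close> of a hyperplane through \<open>n\<close> given points.\<close>
  have facet: "\<exists>a c. (\<exists>i\<in>I. a i \<noteq> 0) \<and> (\<forall>k\<le>n. k \<noteq> j \<longrightarrow> (\<Sum>i\<in>I. a i * g (vert C k) i) = c)" if "j \<le> n" for C j
  proof -
    define w where "w o' k = (case o' of Some i \<Rightarrow> g (vert C k) i | None \<Rightarrow> - 1)" for o' k
    have "\<not> indep_on (insert None (Some ` I)) ({..n} - {j}) w"
      using fin that by (intro homogeneous_system_solution) (auto simp: card_image n_def)
    then obtain c where c: "\<And>k. k \<le> n \<Longrightarrow> k \<noteq> j \<Longrightarrow> (\<Sum>o'\<in>insert None (Some ` I). c o' * w o' k) = 0"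
        "\<exists>o'\<in>insert None (Some ` I). c o' \<noteq> 0"
      unfolding indep_on_def by blast
    have c': "(\<Sum>i\<in>I. c (Some i) * g (vert C k) i) = c None" if "k \<le> n" "k \<noteq> j" for k
      using c(1)[OF that] fin by (simp add: w_def sum.reindex)
    have "\<exists>i\<in>I. c (Some i) \<noteq> 0"
    proof (rule ccontr)
      assume *: "\<not> ?thesis"
      obtain k where "k \<le> n" "k \<noteq> j" using n by (metis le0 order_refl less_irrefl)
      then have "c None = 0" using c'[of k] * by simp
      then show False using c(2) * by auto
    qed
    then show ?thesis using c' by (intro exI[of _ "\<lambda>i. c (Some i)"] exI[of _ "c None"]) blast
  qed
  have "\<forall>z. \<exists>f. snd z \<le> n \<longrightarrow> (\<exists>i\<in>I. fst f i \<noteq> 0) \<and>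
      (\<forall>k\<le>n. k \<noteq> snd z \<longrightarrow> (\<Sum>i\<in>I. fst f i * g (vert (fst z) k) i) = snd f)"
  proof
    fix z :: "'i chamber \<times> nat"
    show "\<exists>f. snd z \<le> n \<longrightarrow> (\<exists>i\<in>I. fst f i \<noteq> 0) \<and>
      (\<forall>k\<le>n. k \<noteq> snd z \<longrightarrow> (\<Sum>i\<in>I. fst f i * g (vert (fst z) k) i) = snd f)"
    proof (cases "snd z \<le> n")
      case True
      from facet[OF this, of "fst z"] obtain a c where "(\<exists>i\<in>I. a i \<noteq> 0)"
        "(\<forall>k\<le>n. k \<noteq> snd z \<longrightarrow> (\<Sum>i\<in>I. a i * g (vert (fst z) k) i) = c)" by (elim exE conjE)
      then show ?thesis by (intro exI[of _ "(a, c)"]) simp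
    qed simp
  qed
  from choice[OF this] obtain f where f: "\<And>z. snd z \<le> n \<Longrightarrow> (\<exists>i\<in>I. fst (f z) i \<noteq> 0) \<and>
      (\<forall>k\<le>n. k \<noteq> snd z \<longrightarrow> (\<Sum>i\<in>I. fst (f z) i * g (vert (fst z) k) i) = snd (f z))" by blast
  define a c where "a C j = fst (f (C, j))" and "c C j = snd (f (C, j))" for C j
  have ac: "\<exists>i\<in>I. a C j i \<noteq> 0"
      "\<And>k. k \<le> n \<Longrightarrow> k \<noteq> j \<Longrightarrow> (\<Sum>i\<in>I. a C j i * g (vert C k) i) = c C j" if "j \<le> n" for C j
    using f[of "(C, j)"] that by (simp_all add: a_def c_def)
  define bad where "bad = (\<Union>(C, j)\<in>?Fac. {t. (\<Sum>i\<in>I. (h * a C j i) * t ^ Suc (pos i)) = c C j - (\<Sum>i\<in>I. a C j i * b i)})"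
  have "finite bad" unfolding bad_def
  proof (intro finite_UN_I finFac)
    fix z assume "z \<in> ?Fac"
    then obtain C j where z: "z = (C, j)" "j \<le> n" by (cases z) auto
    then have "\<exists>i\<in>I. h * a C j i \<noteq> 0" using ac(1)[of j C] h by simp
    from finite_moment_curve_hyperplane[OF fin pos this]
    show "finite (case z of (C, j) \<Rightarrow>
      {t. (\<Sum>i\<in>I. h * a C j i * t ^ Suc (pos i)) = c C j - (\<Sum>i\<in>I. a C j i * b i)})"
      unfolding z(1) by simp
  qed
  then have "infinite ({0<..<1} - bad)" by (simp add: Diff_infinite_finite infinite_Ioo)
  then have "{0<..<1} - bad \<noteq> {}" by (metis finite.emptyI)
  then obtain t where "t \<in> {0<..<1} - bad" by blast
  then have t: "0 < t" "t < 1" "t \<notin> bad" by auto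
  define y where "y = (\<lambda>i. b i + h * t ^ Suc (pos i))"
  have y: "(\<Sum>i\<in>I. a C j i * y i) \<noteq> c C j" if "chamber C" "j \<le> n" for C j
  proof
    assume "(\<Sum>i\<in>I. a C j i * y i) = c C j"
    then have "(\<Sum>i\<in>I. (h * a C j i) * t ^ Suc (pos i)) = c C j - (\<Sum>i\<in>I. a C j i * b i)"
      by (simp add: y_def distrib_left sum.distrib mult_ac)
    then show False using t(3) that unfolding bad_def by blast
  qed
  \<comment> \<open>A hyperplane through \<open>y\<close> and the \<open>n - 1\<close> remaining
    vertices.\<close>
  have "\<exists>a. (\<exists>i\<in>I. a i \<noteq> 0) \<and> (\<forall>k\<le>n. k \<noteq> j \<longrightarrow> k \<noteq> j' \<longrightarrow> (\<Sum>i\<in>I. a i * (g (vert C k) i - y i)) = 0)"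
    if "j \<le> n" "j' \<le> n" "j \<noteq> j'" for C j j'
  proof -
    have "\<not> indep_on I ({..n} - {j, j'}) (\<lambda>i k. g (vert C k) i - y i)"
      using fin that n by (intro homogeneous_system_solution) (auto simp: n_def)
    then show ?thesis unfolding indep_on_def by blast
  qed
  then have "\<forall>z. \<exists>a. case z of (C, j, j') \<Rightarrow> j \<le> n \<longrightarrow> j' \<le> n \<longrightarrow> j \<noteq> j' \<longrightarrow> (\<exists>i\<in>I. a i \<noteq> 0) \<and>
      (\<forall>k\<le>n. k \<noteq> j \<longrightarrow> k \<noteq> j' \<longrightarrow> (\<Sum>i\<in>I. a i * (g (vert C k) i - y i)) = 0)"
    by (simp add: split_paired_all)
  from choice[OF this] obtain f' where f': "\<And>z. case z of (C, j, j') \<Rightarrow> j \<le> n \<longrightarrow> j' \<le> n \<longrightarrow> j \<noteq> j'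
      \<longrightarrow> (\<exists>i\<in>I. f' z i \<noteq> 0) \<and>
      (\<forall>k\<le>n. k \<noteq> j \<longrightarrow> k \<noteq> j' \<longrightarrow> (\<Sum>i\<in>I. f' z i * (g (vert C k) i - y i)) = 0)" by blast
  define a' where "a' C j j' = f' (C, j, j')" for C j j'
  have a': "\<exists>i\<in>I. a' C j j' i \<noteq> 0"
    "\<And>k. k \<le> n \<Longrightarrow> k \<noteq> j \<Longrightarrow> k \<noteq> j' \<Longrightarrow> (\<Sum>i\<in>I. a' C j j' i * (g (vert C k) i - y i)) = 0"
    if "j \<le> n" "j' \<le> n" "j \<noteq> j'" for C j j'
    using f'[of "(C, j, j')"] that by (simp_all add: a'_def)
  define bad' where "bad' = {t. (\<Sum>i\<in>I. l i * t ^ Suc (pos i)) = 0} \<union>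
    (\<Union>(C, j, j')\<in>{C. chamber C} \<times> {(j, j'). j \<le> n \<and> j' \<le> n \<and> j \<noteq> j'}.
      {t. (\<Sum>i\<in>I. a' C j j' i * t ^ Suc (pos i)) = 0})"
  have "finite {(j, j'). j \<le> n \<and> j' \<le> n \<and> j \<noteq> j'}"
    by (rule finite_subset[of _ "{..n} \<times> {..n}"]) auto
  then have "finite bad'" unfolding bad'_def
  proof (intro finite_UnI finite_UN_I finite_cartesian_product finite_chambers
      finite_moment_curve_hyperplane[OF fin pos l])
    fix z assume "z \<in> {C. chamber C} \<times> {(j, j'). j \<le> n \<and> j' \<le> n \<and> j \<noteq> j'}"
    then obtain C j j' where z: "z = (C, j, j')" "j \<le> n" "j' \<le> n" "j \<noteq> j'" by (cases z) auto
    from finite_moment_curve_hyperplane[OF fin pos a'(1)[OF z(2-4), of C]]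
    show "finite (case z of (C, j, j') \<Rightarrow> {t. (\<Sum>i\<in>I. a' C j j' i * t ^ Suc (pos i)) = 0})"
      unfolding z(1) by simp
  qed
  then have "infinite ({0<..<1} - bad')" by (simp add: Diff_infinite_finite infinite_Ioo)
  then have "{0<..<1} - bad' \<noteq> {}" by (metis finite.emptyI)
  then obtain s where "s \<in> {0<..<1} - bad'" by blast
  then have s: "0 < s" "s < 1" "s \<notin> bad'" by auto
  \<comment> \<open>The sign makes the functional \<open>l\<close> decrease along the ray.\<close>
  define d where "d = (\<lambda>i. (if (\<Sum>i\<in>I. l i * s ^ Suc (pos i)) < 0 then 1 else -1) * s ^ Suc (pos i))"
  have d_sum: "(\<Sum>i\<in>I. f i * d i)
      = (if (\<Sum>i\<in>I. l i * s ^ Suc (pos i)) < 0 then 1 else -1) * (\<Sum>i\<in>I. f i * s ^ Suc (pos i))" for f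
    unfolding sum_distrib_left by (rule sum.cong) (auto simp: d_def)
  have "(\<Sum>i\<in>I. l i * s ^ Suc (pos i)) \<noteq> 0" using s(3) unfolding bad'_def by blast
  then have ld: "(\<Sum>i\<in>I. l i * d i) < 0" unfolding d_sum by (auto split: if_splits)
  have a'd: "(\<Sum>i\<in>I. a' C j j' i * d i) \<noteq> 0" if "chamber C" "j \<le> n" "j' \<le> n" "j \<noteq> j'" for C j j'
  proof -
    have "(C, j, j') \<in> {C. chamber C} \<times> {(j, j'). j \<le> n \<and> j' \<le> n \<and> j \<noteq> j'}" using that by blast
    then have "(\<Sum>i\<in>I. a' C j j' i * s ^ Suc (pos i)) \<noteq> 0" using s(3) unfolding bad'_def by blast
    then show ?thesis unfolding d_sum by (auto simp del: power_Suc split: if_splits)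
  qed
  have no_facet: False
    if C: "chamber C" "ray_eqs g y d C x" "j \<le> n" "x j = 0" "x (Suc n) = 0" for C x j
  proof -
    have "(\<Sum>i\<in>I. a C j i * y i) = (\<Sum>i\<in>I. a C j i * (\<Sum>k\<le>n. x k * g (vert C k) i))"
      using C(2,5) unfolding ray_eqs_def n_def by simp
    also have "\<dots> = (\<Sum>k\<le>n. x k * (\<Sum>i\<in>I. a C j i * g (vert C k) i))"
      unfolding sum_distrib_left by (subst sum.swap) (simp add: mult_ac)
    also have "\<dots> = (\<Sum>k\<le>n. x k * c C j)"
    proof (rule sum.cong)
      fix k assume "k \<in> {..n}"
      then show "x k * (\<Sum>i\<in>I. a C j i * g (vert C k) i) = x k * c C j"
        using ac(2)[OF C(3), of k C] C(4) by (cases "k = j") auto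
    qed simp
    also have "\<dots> = c C j" using C(2) unfolding ray_eqs_def n_def by (simp flip: sum_distrib_right)
    finally show False using y[OF C(1,3)] by simp
  qed
  have nondeg: False
    if C: "chamber C" "ray_eqs g y d C x" "j \<le> Suc n" "j' \<le> Suc n" "j \<noteq> j'" "x j = 0" "x j' = 0" for C x j j'
  proof -
    consider "j = Suc n" "j' \<le> n" | "j' = Suc n" "j \<le> n" | "j \<le> n" "j' \<le> n" using C by linarith
    then show False
    proof cases
      case 1 then show ?thesis using no_facet C by blast
    next
      case 2 then show ?thesis using no_facet C by blast
    next
      case 3
      have "x (Suc n) * (\<Sum>i\<in>I. a' C j j' i * d i)
        = (\<Sum>i\<in>I. a' C j j' i * ((\<Sum>k\<le>n. x k * g (vert C k) i) - y i))"
        using C(2) unfolding ray_eqs_def n_def by (simp add: sum_distrib_left mult_ac)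
      also have "\<dots> = (\<Sum>i\<in>I. a' C j j' i * (\<Sum>k\<le>n. x k * (g (vert C k) i - y i)))"
        using C(2) unfolding ray_eqs_def n_def
        by (simp add: right_diff_distrib sum_subtractf flip: sum_distrib_right)
      also have "\<dots> = (\<Sum>k\<le>n. x k * (\<Sum>i\<in>I. a' C j j' i * (g (vert C k) i - y i)))"
        unfolding sum_distrib_left by (subst sum.swap) (simp add: mult_ac)
      also have "\<dots> = 0"
      proof (intro sum.neutral ballI)
        fix k assume "k \<in> {..n}"
        then show "x k * (\<Sum>i\<in>I. a' C j j' i * (g (vert C k) i - y i)) = 0"
          using a'(2)[OF 3 C(5), of k C] C(6,7) by (cases "k = j \<or> k = j'") auto
      qed
      finally have "x (Suc n) = 0" using a'd[OF C(1) 3 C(5)] by simp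
      then show ?thesis using no_facet C(1,2,6) 3 by blast
    qed
  qed
  show ?thesis
  proof (rule that[of t d])
    show "\<exists>i\<in>I. d i \<noteq> 0"
    proof (rule ccontr)
      assume "\<not> ?thesis"
      then have "(\<Sum>i\<in>I. l i * d i) = 0" by simp
      then show False using ld by simp
    qed
    show "x j' \<noteq> 0" if "chamber C" "ray_eqs g (\<lambda>i. b i + h * t ^ Suc (pos i)) d C x" "j \<le> Suc (card I)"
      "j' \<le> Suc (card I)" "j \<noteq> j'" "x j = 0" for C x j j'
      using nondeg that unfolding y_def n_def by blast
  qed (use t ld in auto)
qed

section \<open>Locating a point in the triangulation\<close>

lemma sum_vert:
  assumes "chamber (v, e, xs)" "p < card I" "(\<Sum>k\<le>card I. x k) = (1::real)"
  shows "(\<Sum>k\<le>card I. x k * of_int (vert (v, e, xs) k (xs ! p)))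
    = of_int (v (xs ! p)) + of_int (e (xs ! p)) * (\<Sum>k\<in>{p<..card I}. x k)"
proof -
  have xs: "length xs = card I" "distinct xs" using assms(1) length_chamber by auto
  \<comment> \<open>Coordinate \<open>xs ! p\<close> has its new value exactly at the vertices after
    number \<open>p\<close>, so the tails of the barycentric coordinates appear below.\<close>
  have mem: "xs ! p \<in> set (take k xs) \<longleftrightarrow> p < k" if "k \<le> card I" for k
    using that xs assms(2) by (auto simp: in_set_conv_nth nth_eq_iff_index_eq)
  have "(\<Sum>k\<le>card I. x k * of_int (vert (v, e, xs) k (xs ! p)))
    = (\<Sum>k\<le>card I. x k * of_int (v (xs ! p))) + (\<Sum>k\<le>card I. if p < k then x k * of_int (e (xs ! p)) else 0)"
    unfolding sum.distrib[symmetric] by (rule sum.cong) (auto simp: mem distrib_left)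
  also have "(\<Sum>k\<le>card I. x k * of_int (v (xs ! p))) = of_int (v (xs ! p))"
    using assms(3) by (simp flip: sum_distrib_right)
  also have "(\<Sum>k\<le>card I. if p < k then x k * of_int (e (xs ! p)) else 0) = (\<Sum>k\<in>{p<..card I}. x k * of_int (e (xs ! p)))"
    by (rule sum.mono_neutral_cong_right) auto
  also have "\<dots> = of_int (e (xs ! p)) * (\<Sum>k\<in>{p<..card I}. x k)"
    unfolding sum_distrib_left by (simp add: mult.commute)
  finally show ?thesis .
qed

text \<open>The offsets \<open>t ^ Suc (pos i)\<close> from the even point \<open>v\<close> are
  distinct and lie strictly between 0 and 1. Parity recovers \<open>v\<close>, positivity recovers
  \<open>e\<close>, and since the tails of the barycentric coordinates decrease along the path of a
  chamber, the order of the offsets recovers \<open>xs\<close>.\<close>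

lemma chamber_of_generic_point:
  assumes C0: "chamber (v, e, xs)" and e: "\<And>i. i \<in> I \<Longrightarrow> e i = 1" and t: "0 < t" "t < (1::real)"
    and pos: "\<And>p. p < card I \<Longrightarrow> pos (xs ! p) = p"
    and C: "chamber C" and x: "(\<Sum>k\<le>card I. x k) = 1" "\<And>k. k \<le> card I \<Longrightarrow> x k \<ge> 0"
    and eq: "\<And>i. i \<in> I \<Longrightarrow> (\<Sum>k\<le>card I. x k * of_int (vert C k i)) = of_int (v i) + t ^ Suc (pos i)"
  shows "C = (v, e, xs)"
proof -
  obtain v' e' xs' where C': "C = (v', e', xs')" by (cases C)
  have xs: "length xs = card I" "distinct xs" "set xs = I"
    and xs': "length xs' = card I" "distinct xs'" "set xs' = I"
    using C0 C length_chamber unfolding C' by auto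
  define \<mu> where "\<mu> p = (\<Sum>k\<in>{p<..card I}. x k)" for p
  have \<mu>: "0 \<le> \<mu> p" "\<mu> p \<le> 1" for p
  proof -
    show "0 \<le> \<mu> p" unfolding \<mu>_def by (rule sum_nonneg) (use x in auto)
    have "\<mu> p \<le> (\<Sum>k\<le>card I. x k)" unfolding \<mu>_def by (rule sum_mono2) (use x in auto)
    then show "\<mu> p \<le> 1" using x by simp
  qed
  have \<mu>_anti: "\<mu> p' \<le> \<mu> p" if "p \<le> p'" for p p'
    unfolding \<mu>_def by (rule sum_mono2) (use x that in auto)
  have key: "v' (xs' ! p) = v (xs' ! p) \<and> e' (xs' ! p) = 1 \<and> \<mu> p = t ^ Suc (pos (xs' ! p))"
    if p: "p < card I" for p
  proof -
    define i where "i = xs' ! p"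
    have i: "i \<in> I" using xs' p i_def by auto
    have ev: "even (v i)" "even (v' i)" "e' i = 1 \<or> e' i = -1" using C0 C i unfolding C' by auto
    have "t ^ Suc (pos i) > 0" using t by simp
    have "t ^ Suc (pos i) < 1" using t power_Suc_less_one[of t "pos i"] by simp
    have eqi: "of_int (v' i) + of_int (e' i) * \<mu> p = of_int (v i) + t ^ Suc (pos i)"
      using eq[OF i] sum_vert[of v' e' xs' p x] C p x(1) unfolding C' \<mu>_def i_def by simp
    have "\<bar>of_int (v' i) - of_int (v i) :: real\<bar> < 2"
      using eqi \<mu>[of p] \<open>t ^ Suc (pos i) > 0\<close> \<open>t ^ Suc (pos i) < 1\<close> ev(3) by auto
    then have "\<bar>v' i - v i\<bar> < 2" by linarith
    then have "v' i = v i" using ev(1,2) by presburger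
    then have "of_int (e' i) * \<mu> p = t ^ Suc (pos i)" using eqi by simp
    then have "e' i = 1" using ev(3) \<mu>(1)[of p] \<open>t ^ Suc (pos i) > 0\<close> by auto
    then show ?thesis using \<open>v' i = v i\<close> \<open>of_int (e' i) * \<mu> p = _\<close> unfolding i_def by simp
  qed
  have all: "\<exists>p<card I. i = xs' ! p" if "i \<in> I" for i using that xs' by (metis in_set_conv_nth)
  have "v' i = v i \<and> e' i = e i" for i
  proof (cases "i \<in> I")
    case True then show ?thesis using all key e by metis
  next
    case False then show ?thesis using C0 C unfolding C' by auto
  qed
  moreover have "xs' = xs"
  proof -
    have "sorted (map pos xs')"
      unfolding sorted_iff_nth_mono
    proof (intro allI impI)
      fix p p' assume "p \<le> p'" "p' < length (map pos xs')"
      then have "t ^ Suc (pos (xs' ! p')) \<le> t ^ Suc (pos (xs' ! p))"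
        using key[of p] key[of p'] \<mu>_anti[of p p'] xs' by simp
      then have "\<not> Suc (pos (xs' ! p')) < Suc (pos (xs' ! p))"
        using t power_strict_decreasing[of "Suc (pos (xs' ! p'))" "Suc (pos (xs' ! p))" t] by linarith
      then show "map pos xs' ! p \<le> map pos xs' ! p'" using \<open>p \<le> p'\<close> \<open>p' < _\<close> by simp
    qed
    moreover have "sorted (map pos xs)" unfolding sorted_iff_nth_mono using pos xs by auto
    moreover have inj: "inj_on pos I"
    proof (rule inj_onI)
      fix i i' assume "i \<in> I" "i' \<in> I" "pos i = pos i'"
      then show "i = i'" using pos xs by (metis in_set_conv_nth)
    qed
    ultimately have "map pos xs' = map pos xs"
      using xs xs' by (intro sorted_distinct_set_unique) (auto simp: distinct_map)
    then show ?thesis using inj xs xs' by (auto dest: map_inj_on)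
  qed
  ultimately show ?thesis unfolding C' by (auto simp: fun_eq_iff)
qed

text \<open>The tails of the barycentric coordinates have to be the offsets. So the coordinates are
  differences of consecutive powers of \<open>t\<close>, except for the last, which is a power
  itself because \<open>\<tau>\<close> is cut off to 0.\<close>

lemma generic_point_in_chamber:
  assumes C0: "chamber (v, e, xs)" and e: "\<And>i. i \<in> I \<Longrightarrow> e i = 1" and t: "0 < t" "t < (1::real)"
    and pos: "\<And>p. p < card I \<Longrightarrow> pos (xs ! p) = p"
  obtains x where "(\<Sum>k\<le>card I. x k) = 1" "\<And>k. k \<le> card I \<Longrightarrow> x k \<ge> 0"
    "\<And>i. i \<in> I \<Longrightarrow> (\<Sum>k\<le>card I. x k * of_int (vert (v, e, xs) k i)) = of_int (v i) + t ^ Suc (pos i)"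
proof -
  define \<tau> where "\<tau> k = (if k > card I then 0 else t ^ k)" for k
  define x where "x k = \<tau> k - \<tau> (Suc k)" for k
  have tel: "(\<Sum>k\<in>{m..card I}. x k) = \<tau> m" if "m \<le> Suc (card I)" for m
  proof -
    have "(\<Sum>k\<in>{m..card I}. x k) = (\<Sum>k\<in>{m..card I}. - \<tau> (Suc k) - - \<tau> k)"
      by (rule sum.cong) (auto simp: x_def)
    also have "\<dots> = - \<tau> (Suc (card I)) - - \<tau> m" using that by (rule sum_Suc_diff)
    also have "\<dots> = \<tau> m" by (simp add: \<tau>_def)
    finally show ?thesis .
  qed
  have s1: "(\<Sum>k\<le>card I. x k) = 1" using tel[of 0] by (simp add: \<tau>_def atMost_atLeast0)
  show ?thesis
  proof (rule that[of x])
    show "x k \<ge> 0" if "k \<le> card I" for k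
      using t power_decreasing[of k "Suc k" t] by (auto simp: x_def \<tau>_def)
    fix i assume "i \<in> I"
    moreover have xs: "length xs = card I" "set xs = I" using C0 length_chamber by auto
    ultimately obtain p where p: "p < card I" "i = xs ! p" by (metis in_set_conv_nth)
    have "{p<..card I} = {Suc p..card I}" by auto
    then have "(\<Sum>k\<in>{p<..card I}. x k) = t ^ Suc (pos i)"
      using tel[of "Suc p"] p pos by (simp add: \<tau>_def)
    then show "(\<Sum>k\<le>card I. x k * of_int (vert (v, e, xs) k i)) = of_int (v i) + t ^ Suc (pos i)"
      using sum_vert[OF C0 p(1) s1] p e \<open>i \<in> I\<close> by simp
  qed (fact s1)
qed

end

subsection \<open>A second preimage\<close>

text \<open>Bolzano-Weierstrass, passing to a further subsequence for each coordinate.\<close>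

lemma bounded_subsequence_on:
  fixes U :: "nat \<Rightarrow> 'i \<Rightarrow> real"
  assumes "finite I" "\<And>k i. i \<in> I \<Longrightarrow> \<bar>U k i\<bar> \<le> M"
  obtains r x where "strict_mono (r :: nat \<Rightarrow> nat)" "\<And>i. i \<in> I \<Longrightarrow> (\<lambda>k. U (r k) i) \<longlonglongrightarrow> x i"
proof -
  have "\<exists>r x. strict_mono (r :: nat \<Rightarrow> nat) \<and> (\<forall>i\<in>I. (\<lambda>k. U (r k) i) \<longlonglongrightarrow> x i)"
    using assms
  proof (induction I rule: finite_induct)
    case empty
    then show ?case using strict_mono_id by blast
  next
    case (insert j I)
    then obtain r x where r: "strict_mono (r :: nat \<Rightarrow> nat)" "\<forall>i\<in>I. (\<lambda>k. U (r k) i) \<longlonglongrightarrow> x i" by force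
    have "\<forall>k. U (r k) j \<in> {-M..M}" using insert.prems[of j] by (simp add: abs_le_iff minus_le_iff)
    then obtain l s where s: "strict_mono (s :: nat \<Rightarrow> nat)" "((\<lambda>k. U (r k) j) \<circ> s) \<longlonglongrightarrow> l"
      using compact_Icc[of "-M" M, unfolded compact_def, rule_format, of "\<lambda>k. U (r k) j"] by blast
    show ?case
    proof (intro exI[of _ "r \<circ> s"] exI[of _ "x(j := l)"] conjI ballI)
      show "strict_mono (r \<circ> s)" using r(1) s(1) by (rule strict_mono_o)
      fix i assume i: "i \<in> insert j I"
      show "(\<lambda>k. U ((r \<circ> s) k) i) \<longlonglongrightarrow> (x(j := l)) i"
      proof (cases "i = j")
        case True then show ?thesis using s(2) by (simp add: o_def)
      next
        case False
        then have "((\<lambda>k. U (r k) i) \<circ> s) \<longlonglongrightarrow> x i" using r(2) i s(1) by (intro LIMSEQ_subseq_LIMSEQ) auto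
        then show ?thesis using False by (simp add: o_def)
      qed
    qed
  qed
  then show ?thesis using that by blast
qed

definition dist_on :: "'i set \<Rightarrow> ('i \<Rightarrow> real) \<Rightarrow> ('i \<Rightarrow> real) \<Rightarrow> real" where
  "dist_on I x y = (\<Sum>i\<in>I. \<bar>x i - y i\<bar>)"

text \<open>Affine near \<open>x0\<close>, so that exactly one small simplex there covers a generic point near \<open>F x0\<close>.\<close>

definition flattened :: "'i set \<Rightarrow> (('i \<Rightarrow> real) \<Rightarrow> 'i \<Rightarrow> real) \<Rightarrow> ('i \<Rightarrow> real) \<Rightarrow> real \<Rightarrow> ('i \<Rightarrow> real) \<Rightarrow> 'i \<Rightarrow> real" where
  "flattened I F x0 r x i = F x0 i + (x i - x0 i)
     + max 0 (min 1 (2 * dist_on I x x0 / r - 1)) * (F x i - F x0 i - (x i - x0 i))"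

lemma flattened_near: "r > 0 \<Longrightarrow> dist_on I x x0 \<le> r / 2 \<Longrightarrow> flattened I F x0 r x i = F x0 i + (x i - x0 i)"
  by (simp add: flattened_def max_def min_def field_simps)

lemma flattened_far: "r > 0 \<Longrightarrow> dist_on I x x0 \<ge> r \<Longrightarrow> flattened I F x0 r x i = F x i"
  by (simp add: flattened_def max_def min_def field_simps)

text \<open>\<open>x0\<close> is farther than \<open>r\<close> from the walls, and by
  \<open>deriv\<close> the map is so close to a translation within \<open>r\<close> that
  \<open>x0\<close> is the only preimage of \<open>F x0\<close> there. \<open>outer\<close> takes
  the place of properness: on the outer boundary a linear functional of \<open>F\<close> exceeds its
  value at \<open>x0\<close> by more than 1, so a ray that starts near \<open>F x0\<close> and
  decreases this functional does not meet the image of that boundary.\<close>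

locale folded_map =
  fixes I P :: "'i set" and R :: "'i \<Rightarrow> 'i set" and F :: "('i \<Rightarrow> real) \<Rightarrow> 'i \<Rightarrow> real"
    and x0 l :: "'i \<Rightarrow> real" and r M :: real
  assumes fin: "finite I" and ne: "I \<noteq> {}" and P: "P \<subseteq> I"
    and R: "\<And>p. p \<in> P \<Longrightarrow> R p \<subseteq> I - P" "\<And>p. p \<in> P \<Longrightarrow> R p \<noteq> {}"
    and cont: "\<And>X x i. (\<And>i. i \<in> I \<Longrightarrow> (\<lambda>k. X k i) \<longlonglongrightarrow> x i) \<Longrightarrow> i \<in> I \<Longrightarrow> (\<lambda>k. F (X k) i) \<longlonglongrightarrow> F x i"
    and folded: "\<And>p x i. p \<in> P \<Longrightarrow> x p = 0 \<Longrightarrow> i \<in> I \<Longrightarrow> F (flip (R p) x) i = F x i"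
    and r: "r > 0" and x0: "\<And>p. p \<in> P \<Longrightarrow> x0 p > r"
    and deriv: "\<And>x. dist_on I x x0 \<le> r \<Longrightarrow>
      (\<Sum>i\<in>I. \<bar>F x i - F x0 i - (x i - x0 i)\<bar>) \<le> dist_on I x x0 / 2"
    and M: "\<And>i. i \<in> I \<Longrightarrow> \<bar>x0 i\<bar> + r < M"
    and outer: "\<And>x i. i \<in> I \<Longrightarrow> \<bar>x i\<bar> = M \<Longrightarrow> (\<Sum>j\<in>I. l j * F x j) > (\<Sum>j\<in>I. l j * F x0 j) + 1"
begin

abbreviation "F' \<equiv> flattened I F x0 r"

lemma M_pos: "M > 0"
  using M ne r abs_ge_zero by (metis add_nonneg_pos all_not_in_conv dual_order.strict_trans)

lemma dist_on_ge: "i \<in> I \<Longrightarrow> \<bar>x i - y i\<bar> \<le> dist_on I x y"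
  unfolding dist_on_def by (rule member_le_sum) (use fin in auto)

lemma far_if_abs_eq_M: "i \<in> I \<Longrightarrow> \<bar>x i\<bar> = M \<Longrightarrow> dist_on I x x0 \<ge> r"
  using dist_on_ge[of i x x0] M[of i] by linarith

text \<open>On the grid of width \<open>h\<close>, a simplex in the cell of \<open>x0\<close> covers
  a point \<open>y\<close> near \<open>F x0\<close>. The number of covering simplices is even, so
  there is another one. It cannot have all its vertices within \<open>r / 2\<close> of
  \<open>x0\<close>, since \<open>F'\<close> is a translation there and the chamber is then
  determined by \<open>y\<close>. The bounds in \<open>small\<close> keep the cell within
  \<open>r / 2\<close> of \<open>x0\<close>, and \<open>y\<close> below the barrier given by
  \<open>outer\<close>.\<close>

lemma far_cover:
  assumes even_N: "even N" and N_pos: "N > 0" and h: "h = M / of_int N"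
    and small: "4 * h * card I \<le> r" "2 * h * (\<Sum>i\<in>I. \<bar>l i\<bar>) \<le> 1"
  obtains u :: "nat \<Rightarrow> 'i \<Rightarrow> real" and x where
    "\<And>k. k \<le> card I \<Longrightarrow> x k \<ge> 0" "(\<Sum>k\<le>card I. x k) = 1"
    "\<And>i. i \<in> I \<Longrightarrow> \<bar>(\<Sum>k\<le>card I. x k * F' (u k) i) - F x0 i\<bar> \<le> 2 * h"
    "\<exists>k\<le>card I. dist_on I (u k) x0 > r / 2"
    "\<And>k i. k \<le> card I \<Longrightarrow> i \<in> I \<Longrightarrow> \<bar>u k i - u 0 i\<bar> \<le> h \<and> \<bar>u k i\<bar> \<le> M"
    "\<And>k p. k \<le> card I \<Longrightarrow> p \<in> P \<Longrightarrow> u k p \<ge> 0"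
proof -
  interpret chamber_box I P R N by unfold_locales (use fin ne P R even_N in auto)
  have h0: "h > 0" using h N_pos M_pos by simp
  have hN: "h * of_int N = M" using h N_pos by simp
  \<comment> \<open>In each coordinate the largest even grid point not above
    \<open>x0\<close>.\<close>
  define v where "v i = (if i \<in> I then 2 * \<lfloor>x0 i / (2 * h)\<rfloor> else 0)" for i
  define e :: "'i \<Rightarrow> int" where "e i = (if i \<in> I then 1 else 0)" for i
  obtain xs where xs: "distinct xs" "set xs = I" using finite_distinct_list[OF fin] by blast
  have len: "length xs = card I" using xs distinct_card by metis
  define pos where "pos = inv_into {..<card I} ((!) xs)"
  have "inj_on ((!) xs) {..<card I}" using xs len by (auto simp: inj_on_def nth_eq_iff_index_eq)
  then have pos: "pos (xs ! p) = p" if "p < card I" for p unfolding pos_def using that by (simp add: inv_into_f_f)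
  have inj: "inj_on pos I"
  proof (rule inj_onI)
    fix i i' assume "i \<in> I" "i' \<in> I" "pos i = pos i'"
    then show "i = i'" using pos xs len by (metis in_set_conv_nth)
  qed
  have v: "h * of_int (v i) \<le> x0 i" "x0 i < h * of_int (v i) + 2 * h" if "i \<in> I" for i
  proof -
    define w where "w = \<lfloor>x0 i / (2 * h)\<rfloor>"
    have "of_int w \<le> x0 i / (2 * h)" "x0 i / (2 * h) < of_int w + 1" unfolding w_def by linarith+
    then have "of_int w * (2 * h) \<le> x0 i" "x0 i < (of_int w + 1) * (2 * h)"
      using h0 by (simp_all only: pos_le_divide_eq pos_divide_less_eq mult_pos_pos zero_less_numeral)
    moreover have "v i = 2 * w" using that by (simp add: v_def w_def)
    ultimately show "h * of_int (v i) \<le> x0 i" "x0 i < h * of_int (v i) + 2 * h"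
      by (simp_all add: algebra_simps)
  qed
  have C0: "chamber (v, e, xs)"
  proof -
    have "even (v i) \<and> in_box i (v i) \<and> in_box i (v i + 1)" if i: "i \<in> I" for i
    proof -
      have ev: "even (v i)" using i by (simp add: v_def)
      have "h * of_int (v i) < h * of_int N" using v(1)[OF i] M[OF i] r unfolding hN by linarith
      then have up: "v i < N" using h0 by simp
      have "h * of_int (- N) < h * of_int (v i + 2)"
        using v(2)[OF i] M[OF i] r hN by (simp add: algebra_simps)
      then have "of_int (- N) < (of_int (v i + 2) :: real)" using h0 by (simp only: mult_less_cancel_left_pos)
      then have lo: "- N < v i + 2" by (simp only: of_int_less_iff)
      have lo': "v i \<ge> 0" if "i \<in> P"
      proof -
        have "x0 i > 0" using x0[OF that] r by simp
        then show ?thesis using i h0 by (simp add: v_def)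
      qed
      have "- N \<le> v i" using ev lo even_N by presburger
      then show ?thesis using ev up lo' unfolding in_box_def by auto
    qed
    then show ?thesis using xs by (auto simp: e_def v_def)
  qed
  define g where "g q = F' (\<lambda>i. h * of_int (q i))" for q :: "'i \<Rightarrow> int"
  \<comment> \<open>The value of \<open>F'\<close> at the grid point \<open>v\<close>; adding the
    scaled offsets will give \<open>y\<close> as the image of a generic point of the chamber
    \<open>(v, e, xs)\<close>.\<close>
  define b where "b i = F x0 i + (h * of_int (v i) - x0 i)" for i
  have l: "\<exists>i\<in>I. l i \<noteq> 0"
  proof (rule ccontr)
    assume *: "\<not> ?thesis"
    obtain i where "i \<in> I" using ne by blast
    then show False using outer[of i "\<lambda>_. M"] * M_pos by simp
  qed
  obtain t d where t: "0 < t" "t < 1" and d: "\<exists>i\<in>I. d i \<noteq> 0" "(\<Sum>i\<in>I. l i * d i) < 0"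
    and nondeg: "\<And>C x j j'. chamber C \<Longrightarrow> ray_eqs g (\<lambda>i. b i + h * t ^ Suc (pos i)) d C x \<Longrightarrow> j \<le> Suc (card I)
      \<Longrightarrow> j' \<le> Suc (card I) \<Longrightarrow> j \<noteq> j' \<Longrightarrow> x j = 0 \<Longrightarrow> x j' \<noteq> 0"
    by (rule generic_ray[OF inj less_imp_neq[OF h0, symmetric] l, of g b]) (rule that)
  define y where "y = (\<lambda>i. b i + h * t ^ Suc (pos i))"
  have tpow: "0 < t ^ Suc (pos i)" "t ^ Suc (pos i) < 1" for i
    using t power_Suc_less_one[of t "pos i"] by auto
  have y: "\<bar>y i - F x0 i\<bar> \<le> 2 * h" if "i \<in> I" for i
  proof -
    have "0 < h * t ^ Suc (pos i)" "h * t ^ Suc (pos i) < h" using tpow[of i] h0 by simp_all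
    then show ?thesis using v[OF that] unfolding y_def b_def by linarith
  qed
  have "even (card {C. chamber C \<and> ray_zero g y d C (Suc (card I))})"
  proof (rule even_card_covering)
    show "x h' \<noteq> 0" if "chamber C" "ray_eqs g y d C x" "j \<le> Suc (card I)" "h' \<le> Suc (card I)" "j \<noteq> h'" "x j = 0"
      for C x j h' using nondeg that unfolding y_def by blast
    show "\<exists>i\<in>I. d i \<noteq> 0" by (fact d(1))
    show "g (flip (R p) q) i = g q i" if p: "p \<in> P" "q p = 0" and i: "i \<in> I" for p q i
    proof -
      let ?x = "\<lambda>i. h * of_int (q i)"
      have p': "p \<in> I" "p \<notin> R p" using P R p by auto
      have eq: "(\<lambda>i. h * of_int (flip (R p) q i)) = flip (R p) ?x" by (auto simp: flip_def)
      \<comment> \<open>Because of \<open>x0 p > r\<close> the wall of \<open>p\<close> lies outside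
        the region where \<open>F\<close> has been changed.\<close>
      have "dist_on I ?x x0 \<ge> r" "dist_on I (flip (R p) ?x) x0 \<ge> r"
        using dist_on_ge[of p ?x x0] dist_on_ge[of p "flip (R p) ?x" x0] x0[OF p(1)] p p'
        by (auto simp: flip_def)
      then have "F' ?x i = F ?x i" "F' (flip (R p) ?x) i = F (flip (R p) ?x) i"
        by (simp_all only: flattened_far[OF r])
      then show ?thesis unfolding g_def eq using folded[OF p(1), of ?x i] p i by simp
    qed
    show "\<not> ray_zero g y d C (card I)"
      if C: "chamber C" and i: "i \<in> I" and wall: "\<And>k. k < card I \<Longrightarrow> \<bar>vert C k i\<bar> = \<bar>N\<bar>" for C i
    proof
      assume "ray_zero g y d C (card I)"
      then obtain x where x: "ray_eqs g y d C x" "\<And>k. k \<le> Suc (card I) \<Longrightarrow> x k \<ge> 0" "x (card I) = 0"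
        unfolding ray_zero_def by blast
      define L where "L f = (\<Sum>j\<in>I. l j * f j)" for f :: "'i \<Rightarrow> real"
      have big: "L (g (vert C k)) \<ge> L (F x0) + 1" if "k < card I" for k
      proof -
        let ?x = "\<lambda>j. h * of_int (vert C k j)"
        have "\<bar>?x i\<bar> = h * \<bar>of_int (vert C k i)\<bar>" using h0 by (simp add: abs_mult)
        also have "\<dots> = M" using wall[OF that] N_pos hN by (metis abs_of_pos of_int_abs)
        finally have xM: "\<bar>?x i\<bar> = M" .
        then have "g (vert C k) = F ?x"
          unfolding g_def by (intro ext flattened_far[OF r] far_if_abs_eq_M[OF i])
        then show ?thesis using outer[OF i, of ?x] xM unfolding L_def by simp
      qed
      \<comment> \<open>The outer facet is mapped above the barrier, while the ray starts below it
        and descends.\<close>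
      have "L (F x0) + 1 = (\<Sum>k\<le>card I. x k * (L (F x0) + 1))"
        using x(1) unfolding ray_eqs_def by (simp flip: sum_distrib_right)
      also have "\<dots> \<le> (\<Sum>k\<le>card I. x k * L (g (vert C k)))"
      proof (rule sum_mono)
        fix k assume "k \<in> {..card I}"
        then show "x k * (L (F x0) + 1) \<le> x k * L (g (vert C k))"
          using big[of k] x(2)[of k] x(3) by (cases "k = card I") (auto intro: mult_left_mono)
      qed
      also have "\<dots> = (\<Sum>j\<in>I. l j * (\<Sum>k\<le>card I. x k * g (vert C k) j))"
        unfolding L_def sum_distrib_left by (subst sum.swap) (simp add: mult_ac)
      also have "\<dots> = (\<Sum>j\<in>I. l j * (y j + x (Suc (card I)) * d j))"
        using x(1) unfolding ray_eqs_def by simp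
      also have "\<dots> = L y + x (Suc (card I)) * (\<Sum>i\<in>I. l i * d i)"
        by (simp add: L_def distrib_left sum.distrib sum_distrib_left mult_ac)
      also have "\<dots> \<le> L y" using x(2)[of "Suc (card I)"] d(2) by (simp add: mult_nonneg_nonpos)
      finally have 1: "L (F x0) + 1 \<le> L y" .
      have gap: "L y - L (F x0) = (\<Sum>j\<in>I. l j * (y j - F x0 j))"
        by (simp add: L_def right_diff_distrib sum_subtractf)
      show False
      proof -
        obtain j0 where j0: "j0 \<in> I" "l j0 \<noteq> 0" using l by blast
        \<comment> \<open>The bound in \<open>small(2)\<close> is not strict; strictness comes from
          an index with \<open>l j0 \<noteq> 0\<close>, as every \<open>y j\<close> is closer than
          \<open>2 * h\<close> to \<open>F x0 j\<close>.\<close>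
        have "(\<Sum>j\<in>I. l j * (y j - F x0 j)) < (\<Sum>j\<in>I. \<bar>l j\<bar> * (2 * h))"
        proof (rule sum_strict_mono_ex1[OF fin])
          have strict: "\<bar>y j - F x0 j\<bar> < 2 * h" if "j \<in> I" for j
          proof -
            have "0 < h * t ^ Suc (pos j)" "h * t ^ Suc (pos j) < h" using tpow[of j] h0 by simp_all
            then show ?thesis using v[OF that] h0 unfolding y_def b_def by linarith
          qed
          show "\<forall>j\<in>I. l j * (y j - F x0 j) \<le> \<bar>l j\<bar> * (2 * h)"
          proof
            fix j assume "j \<in> I"
            have "l j * (y j - F x0 j) \<le> \<bar>l j\<bar> * \<bar>y j - F x0 j\<bar>" by (metis abs_ge_self abs_mult)
            also have "\<dots> \<le> \<bar>l j\<bar> * (2 * h)" using y[OF \<open>j \<in> I\<close>] by (intro mult_left_mono) auto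
            finally show "l j * (y j - F x0 j) \<le> \<bar>l j\<bar> * (2 * h)" .
          qed
          have "l j0 * (y j0 - F x0 j0) \<le> \<bar>l j0\<bar> * \<bar>y j0 - F x0 j0\<bar>" by (metis abs_ge_self abs_mult)
          also have "\<dots> < \<bar>l j0\<bar> * (2 * h)" using strict[OF j0(1)] j0(2) by simp
          finally show "\<exists>a\<in>I. l a * (y a - F x0 a) < \<bar>l a\<bar> * (2 * h)" using j0 by blast
        qed
        also have "\<dots> = 2 * h * (\<Sum>i\<in>I. \<bar>l i\<bar>)" by (simp add: sum_distrib_left mult_ac)
        finally show False using 1 gap small(2) by linarith
      qed
    qed
  qed
  moreover have C0_mem: "(v, e, xs) \<in> {C. chamber C \<and> ray_zero g y d C (Suc (card I))}"
  proof -
    obtain x where x: "(\<Sum>k\<le>card I. x k) = 1" "\<And>k. k \<le> card I \<Longrightarrow> x k \<ge> 0"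
      "\<And>i. i \<in> I \<Longrightarrow> (\<Sum>k\<le>card I. x k * of_int (vert (v, e, xs) k i)) = of_int (v i) + t ^ Suc (pos i)"
      using generic_point_in_chamber[OF C0 _ t pos] unfolding e_def by auto
    \<comment> \<open>The ray parameter is 0: the simplex covers the starting point.\<close>
    define x' where "x' k = (if k \<le> card I then x k else 0)" for k
    have near: "g (vert (v, e, xs) k) i = F x0 i + (h * of_int (vert (v, e, xs) k i) - x0 i)" for k i
    proof -
      have "dist_on I (\<lambda>i. h * of_int (vert (v, e, xs) k i)) x0 \<le> (\<Sum>i\<in>I. 2 * h)"
        unfolding dist_on_def
      proof (rule sum_mono)
        fix i assume "i \<in> I"
        have "vert (v, e, xs) k i = v i \<or> vert (v, e, xs) k i = v i + 1" by (simp add: e_def)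
        then have "h * of_int (vert (v, e, xs) k i) = h * of_int (v i) \<or>
          h * of_int (vert (v, e, xs) k i) = h * of_int (v i) + h" by (auto simp: algebra_simps)
        then show "\<bar>h * of_int (vert (v, e, xs) k i) - x0 i\<bar> \<le> 2 * h" using v[OF \<open>i \<in> I\<close>] h0 by linarith
      qed
      also have "\<dots> \<le> r / 2" using small(1) by (simp add: field_simps)
      finally show ?thesis unfolding g_def by (rule flattened_near[OF r])
    qed
    have "ray_eqs g y d (v, e, xs) x'"
      unfolding ray_eqs_def
    proof (intro conjI ballI)
      show "sum x' {..card I} = 1" using x(1) by (simp add: x'_def)
      fix i assume "i \<in> I"
      have "(\<Sum>k\<le>card I. x' k * g (vert (v, e, xs) k) i)
        = (\<Sum>k\<le>card I. x k * (F x0 i - x0 i)) + h * (\<Sum>k\<le>card I. x k * of_int (vert (v, e, xs) k i))"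
        unfolding near sum_distrib_left sum.distrib[symmetric]
        by (rule sum.cong) (auto simp: x'_def algebra_simps)
      also have "\<dots> = F x0 i - x0 i + h * (of_int (v i) + t ^ Suc (pos i))"
        using x(1) x(3)[OF \<open>i \<in> I\<close>] by (simp flip: sum_distrib_right)
      also have "\<dots> = y i" by (simp add: y_def b_def algebra_simps)
      finally show "(\<Sum>k\<le>card I. x' k * g (vert (v, e, xs) k) i) = y i + x' (Suc (card I)) * d i"
        by (simp add: x'_def)
    qed
    then have "ray_zero g y d (v, e, xs) (Suc (card I))"
      unfolding ray_zero_def by (rule_tac x = x' in exI) (auto simp: x'_def x(2))
    then show ?thesis using C0 by simp
  qed
  ultimately have "{C. chamber C \<and> ray_zero g y d C (Suc (card I))} \<noteq> {(v, e, xs)}" by auto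
  then obtain C where C: "chamber C" "ray_zero g y d C (Suc (card I))" "C \<noteq> (v, e, xs)"
    using C0_mem by blast
  then obtain x where x: "ray_eqs g y d C x" "\<And>k. k \<le> Suc (card I) \<Longrightarrow> x k \<ge> 0" "x (Suc (card I)) = 0"
    unfolding ray_zero_def by blast
  define u where "u k = (\<lambda>i. h * of_int (vert C k i))" for k
  have cover: "(\<Sum>k\<le>card I. x k * F' (u k) i) = y i" if "i \<in> I" for i
    using x(1,3) that unfolding ray_eqs_def g_def u_def by simp
  have sum1: "(\<Sum>k\<le>card I. x k) = 1" using x(1) unfolding ray_eqs_def by simp
  show ?thesis
  proof (rule that[of x u])
    show "\<bar>(\<Sum>k\<le>card I. x k * F' (u k) i) - F x0 i\<bar> \<le> 2 * h" if "i \<in> I" for i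
      using cover[OF that] y[OF that] by simp
    show "\<exists>k\<le>card I. dist_on I (u k) x0 > r / 2"
    proof (rule ccontr)
      assume "\<not> ?thesis"
      then have near: "F' (u k) i = F x0 i + (u k i - x0 i)" if "k \<le> card I" for k i
        using that by (intro flattened_near[OF r]) (simp add: not_less)
      have "(\<Sum>k\<le>card I. x k * of_int (vert C k i)) = of_int (v i) + t ^ Suc (pos i)" if "i \<in> I" for i
      proof -
        have "y i = (\<Sum>k\<le>card I. x k * (F x0 i + (u k i - x0 i)))"
          unfolding cover[OF that, symmetric] by (rule sum.cong) (auto simp: near)
        also have "\<dots> = (\<Sum>k\<le>card I. x k * (F x0 i - x0 i)) + h * (\<Sum>k\<le>card I. x k * of_int (vert C k i))"
          unfolding sum_distrib_left sum.distrib[symmetric]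
          by (rule sum.cong) (auto simp: u_def algebra_simps)
        also have "\<dots> = F x0 i - x0 i + h * (\<Sum>k\<le>card I. x k * of_int (vert C k i))"
          using sum1 by (simp flip: sum_distrib_right)
        finally have "h * (\<Sum>k\<le>card I. x k * of_int (vert C k i)) = h * (of_int (v i) + t ^ Suc (pos i))"
          by (simp add: y_def b_def algebra_simps)
        then show ?thesis using h0 by simp
      qed
      then have "C = (v, e, xs)"
        using chamber_of_generic_point[OF C0 _ t pos C(1) sum1] x(2) unfolding e_def by simp
      then show False using C by simp
    qed
    obtain v' e' xs' where C': "C = (v', e', xs')" by (cases C)
    have box: "in_box i (vert C k i)" "\<bar>vert C k i - vert C 0 i\<bar> \<le> 1" if "i \<in> I" for i k
      using C(1) that unfolding C' by auto
    show "\<bar>u k i - u 0 i\<bar> \<le> h \<and> \<bar>u k i\<bar> \<le> M" if "k \<le> card I" "i \<in> I" for k i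
    proof
      have "\<bar>of_int (vert C k i - vert C 0 i) :: real\<bar> \<le> 1" using box(2)[OF that(2), of k] by linarith
      then have "h * \<bar>of_int (vert C k i - vert C 0 i) :: real\<bar> \<le> h * 1" using h0 by (intro mult_left_mono) auto
      moreover have "\<bar>u k i - u 0 i\<bar> = h * \<bar>of_int (vert C k i - vert C 0 i) :: real\<bar>"
        unfolding u_def using h0 by (simp add: abs_mult flip: right_diff_distrib)
      ultimately show "\<bar>u k i - u 0 i\<bar> \<le> h" by simp
      have "\<bar>vert C k i\<bar> \<le> N" using box(1)[OF that(2), of k] N_pos unfolding in_box_def by (auto split: if_splits)
      then have "\<bar>of_int (vert C k i) :: real\<bar> \<le> of_int N" by linarith
      then have "h * \<bar>of_int (vert C k i) :: real\<bar> \<le> h * of_int N" using h0 by (intro mult_left_mono) auto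
      then show "\<bar>u k i\<bar> \<le> M" using hN h0 unfolding u_def by (simp add: abs_mult)
    qed
    show "u k p \<ge> 0" if "k \<le> card I" "p \<in> P" for k p
      using box(1)[of p k] that P h0 unfolding in_box_def u_def by auto
  qed (use x sum1 in auto)
qed

lemma tendsto_flattened:
  assumes "\<And>i. i \<in> I \<Longrightarrow> (\<lambda>k. X k i) \<longlonglongrightarrow> x i" "i \<in> I"
  shows "(\<lambda>k. F' (X k) i) \<longlonglongrightarrow> F' x i"
proof -
  have "(\<lambda>k. dist_on I (X k) x0) \<longlonglongrightarrow> dist_on I x x0"
    unfolding dist_on_def using assms(1) by (intro tendsto_intros) auto
  then have "(\<lambda>k. max 0 (min 1 (2 * dist_on I (X k) x0 / r - 1))) \<longlonglongrightarrow> max 0 (min 1 (2 * dist_on I x x0 / r - 1))"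
    using r by (intro tendsto_intros) auto
  then show ?thesis
    unfolding flattened_def by (intro tendsto_add tendsto_mult tendsto_diff tendsto_const assms cont)
qed

text \<open>As the mesh tends to 0, the far simplices shrink to a point \<open>a\<close> with
  \<open>F' a = F x0\<close> at distance at least \<open>r / 2\<close> from \<open>x0\<close>. The
  bound \<open>deriv\<close> excludes such points within \<open>r\<close>, and beyond
  \<open>r\<close> the maps \<open>F'\<close> and \<open>F\<close> agree.\<close>

theorem second_preimage:
  obtains x where "\<And>p. p \<in> P \<Longrightarrow> x p \<ge> 0" "\<And>i. i \<in> I \<Longrightarrow> F x i = F x0 i" "\<exists>i\<in>I. x i \<noteq> x0 i"
proof -
  define n where "n = card I"
  \<comment> \<open>Large enough for both bounds on the mesh \<open>M / N m\<close>, and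
    positive.\<close>
  define K where "K = nat \<lceil>4 * M * n / r + 2 * M * (\<Sum>i\<in>I. \<bar>l i\<bar>)\<rceil> + 1"
  define N where "N m = 2 * int (K + m)" for m
  define h where "h m = M / of_int (N m)" for m
  have "K > 0" by (simp add: K_def)
  then have N: "even (N m)" "N m > 0" for m by (simp_all add: N_def)
  have h_pos: "h m > 0" for m unfolding h_def using N(2)[of m] M_pos by simp
  have K_ge: "4 * M * n / r + 2 * M * (\<Sum>i\<in>I. \<bar>l i\<bar>) \<le> real K" unfolding K_def by linarith
  have parts: "0 \<le> 4 * M * n / r" "0 \<le> 2 * M * (\<Sum>i\<in>I. \<bar>l i\<bar>)"
    using M_pos r by (auto intro!: mult_nonneg_nonneg sum_nonneg divide_nonneg_pos)
  have small: "4 * h m * n \<le> r" "2 * h m * (\<Sum>i\<in>I. \<bar>l i\<bar>) \<le> 1" for m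
  proof -
    have Nr: "real K \<le> of_int (N m)" "of_int (N m) > (0::real)" using N(2)[of m] by (simp_all add: N_def)
    have "4 * M * n / r \<le> of_int (N m)" using K_ge parts Nr by linarith
    then show "4 * h m * n \<le> r" unfolding h_def using Nr r by (simp add: field_simps)
    have "2 * M * (\<Sum>i\<in>I. \<bar>l i\<bar>) \<le> of_int (N m)" using K_ge parts Nr by linarith
    then show "2 * h m * (\<Sum>i\<in>I. \<bar>l i\<bar>) \<le> 1" unfolding h_def using Nr by (simp add: field_simps)
  qed
  have h_lim: "h \<longlonglongrightarrow> 0"
  proof -
    have "(\<lambda>m. M / 2 * inverse (real (Suc m))) \<longlonglongrightarrow> M / 2 * 0"
      by (intro tendsto_mult tendsto_const LIMSEQ_inverse_real_of_nat)
    then have "(\<lambda>m. M / 2 * inverse (real (Suc m))) \<longlonglongrightarrow> 0" by simp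
    moreover have "h m \<le> M / 2 * inverse (real (Suc m))" for m
    proof -
      have "real (Suc m) \<le> real (K + m)" by (simp add: K_def)
      then have "M / 2 / real (K + m) \<le> M / 2 / real (Suc m)" using M_pos by (intro divide_left_mono) (auto simp: K_def)
      moreover have "h m = M / 2 / real (K + m)" by (simp add: h_def N_def)
      ultimately show ?thesis by (simp only: divide_inverse)
    qed
    ultimately show ?thesis
      using h_pos by (intro Lim_null_comparison[of h "\<lambda>m. M / 2 * inverse (real (Suc m))"] always_eventually allI)
        (simp_all add: less_imp_le)
  qed
  define good where "good m u x \<longleftrightarrow> (\<forall>k\<le>n. x k \<ge> 0) \<and> (\<Sum>k\<le>n. x k) = 1 \<and>
      (\<forall>i\<in>I. \<bar>(\<Sum>k\<le>n. x k * F' (u k) i) - F x0 i\<bar> \<le> 2 * h m) \<and>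
      (\<exists>k\<le>n. dist_on I (u k) x0 > r / 2) \<and>
      (\<forall>k\<le>n. \<forall>i\<in>I. \<bar>u k i - u 0 i\<bar> \<le> h m \<and> \<bar>u k i\<bar> \<le> M) \<and> (\<forall>k\<le>n. \<forall>p\<in>P. u k p \<ge> 0)"
    for m :: nat and u :: "nat \<Rightarrow> 'i \<Rightarrow> real" and x :: "nat \<Rightarrow> real"
  have "\<exists>u x. good m u x" for m
  proof (rule far_cover[OF N(1)[of m] N(2)[of m] h_def small[unfolded n_def]])
    fix x u
    assume "\<And>k. k \<le> card I \<Longrightarrow> x k \<ge> 0" "(\<Sum>k\<le>card I. x k) = 1"
      "\<And>i. i \<in> I \<Longrightarrow> \<bar>(\<Sum>k\<le>card I. x k * F' (u k) i) - F x0 i\<bar> \<le> 2 * h m"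
      "\<exists>k\<le>card I. dist_on I (u k) x0 > r / 2"
      "\<And>k i. k \<le> card I \<Longrightarrow> i \<in> I \<Longrightarrow> \<bar>u k i - u 0 i\<bar> \<le> h m \<and> \<bar>u k i\<bar> \<le> M"
      "\<And>k p. k \<le> card I \<Longrightarrow> p \<in> P \<Longrightarrow> u k p \<ge> 0"
    then have "good m u x" unfolding good_def n_def by simp
    then show ?thesis by (intro exI)
  qed
  then have "\<forall>m. \<exists>ux. good m (fst ux) (snd ux)" by simp
  from choice[OF this] obtain ux where ux: "\<forall>m. good m (fst (ux m)) (snd (ux m))" ..
  define u x where "u m = fst (ux m)" and "x m = snd (ux m)" for m
  have good: "good m (u m) (x m)" for m using ux by (simp add: u_def x_def)
  have u_le: "\<bar>u m 0 i\<bar> \<le> M" if "i \<in> I" for m i using good[of m] that unfolding good_def by simp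
  obtain s a where s: "strict_mono (s :: nat \<Rightarrow> nat)" "\<And>i. i \<in> I \<Longrightarrow> (\<lambda>m. u (s m) 0 i) \<longlonglongrightarrow> a i"
    by (rule bounded_subsequence_on[OF fin, of "\<lambda>m. u m 0", OF u_le], assumption) (rule that)
  have hs: "(\<lambda>m. h (s m)) \<longlonglongrightarrow> 0" using LIMSEQ_subseq_LIMSEQ[OF h_lim s(1)] by (simp add: o_def)
  have u_lim: "(\<lambda>m. u (s m) k i) \<longlonglongrightarrow> a i" if "k \<le> n" "i \<in> I" for k i
  proof -
    have "(\<lambda>m. u (s m) k i - u (s m) 0 i) \<longlonglongrightarrow> 0"
      by (rule Lim_null_comparison[OF _ hs]) (use good that in \<open>auto simp: good_def intro!: always_eventually\<close>)
    from tendsto_add[OF this s(2)[OF that(2)]] show ?thesis by simp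
  qed
  have Fa: "F' a i = F x0 i" if i: "i \<in> I" for i
  proof -
    have lim: "(\<lambda>m. F' (u (s m) k) i) \<longlonglongrightarrow> F' a i" if "k \<le> n" for k
      using u_lim[OF that] i by (intro tendsto_flattened) auto
    have "(\<lambda>m. (\<Sum>k\<le>n. \<bar>F' (u (s m) k) i - F' a i\<bar>) + 2 * h (s m)) \<longlonglongrightarrow> (\<Sum>k\<le>n. \<bar>F' a i - F' a i\<bar>) + 2 * 0"
      using lim hs by (intro tendsto_intros) auto
    moreover have "\<bar>F' a i - F x0 i\<bar> \<le> (\<Sum>k\<le>n. \<bar>F' (u (s m) k) i - F' a i\<bar>) + 2 * h (s m)" for m
    proof -
      have g: "\<And>k. k \<le> n \<Longrightarrow> x (s m) k \<ge> 0" "(\<Sum>k\<le>n. x (s m) k) = 1"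
        "\<bar>(\<Sum>k\<le>n. x (s m) k * F' (u (s m) k) i) - F x0 i\<bar> \<le> 2 * h (s m)"
        using good[of "s m"] i unfolding good_def by auto
      have x1: "x (s m) k \<le> 1" if "k \<le> n" for k
        using member_le_sum[of k "{..n}" "x (s m)"] g that by simp
      have "(\<Sum>k\<le>n. x (s m) k * F' (u (s m) k) i) - F' a i = (\<Sum>k\<le>n. x (s m) k * (F' (u (s m) k) i - F' a i))"
        using g(2) by (simp add: right_diff_distrib sum_subtractf flip: sum_distrib_right)
      also have "\<bar>\<dots>\<bar> \<le> (\<Sum>k\<le>n. \<bar>F' (u (s m) k) i - F' a i\<bar>)"
      proof (rule order_trans[OF sum_abs], rule sum_mono)
        fix k assume "k \<in> {..n}"
        then show "\<bar>x (s m) k * (F' (u (s m) k) i - F' a i)\<bar> \<le> \<bar>F' (u (s m) k) i - F' a i\<bar>"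
          using g(1)[of k] x1[of k] by (simp add: abs_mult mult_left_le_one_le)
      qed
      finally show ?thesis using g(3) by linarith
    qed
    ultimately have "\<bar>F' a i - F x0 i\<bar> \<le> (\<Sum>k\<le>n. \<bar>F' a i - F' a i\<bar>) + 2 * 0"
      by (intro LIMSEQ_le_const) auto
    then show ?thesis by simp
  qed
  have "dist_on I a x0 \<ge> r / 2"
  proof -
    \<comment> \<open>The index of the far vertex may change with \<open>m\<close>; summing the
      positive parts over all vertices avoids a further subsequence.\<close>
    have "(\<lambda>m. \<Sum>k\<le>n. max 0 (dist_on I (u (s m) k) x0 - dist_on I a x0)) \<longlonglongrightarrow>
      (\<Sum>k\<le>n. max 0 (dist_on I a x0 - dist_on I a x0))"
      unfolding dist_on_def using u_lim by (intro tendsto_intros) auto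
    moreover have "r / 2 - dist_on I a x0 \<le> (\<Sum>k\<le>n. max 0 (dist_on I (u (s m) k) x0 - dist_on I a x0))" for m
    proof -
      obtain k where k: "k \<le> n" "dist_on I (u (s m) k) x0 > r / 2" using good[of "s m"] unfolding good_def by blast
      have "max 0 (dist_on I (u (s m) k) x0 - dist_on I a x0)
        \<le> (\<Sum>k\<le>n. max 0 (dist_on I (u (s m) k) x0 - dist_on I a x0))"
        using k by (intro member_le_sum[of k "{..n}" "\<lambda>k. max 0 (dist_on I (u (s m) k) x0 - dist_on I a x0)"]) auto
      then show ?thesis using k by linarith
    qed
    ultimately have "r / 2 - dist_on I a x0 \<le> (\<Sum>k\<le>n. max 0 (dist_on I a x0 - dist_on I a x0))"
      by (intro LIMSEQ_le_const) auto
    then show ?thesis by simp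
  qed
  have far: "dist_on I a x0 > r"
  proof (rule ccontr)
    assume *: "\<not> ?thesis"
    \<comment> \<open>With the interpolation weight \<open>\<theta>\<close>,
      \<open>F' a = F x0\<close> says that \<open>a - x0\<close> is \<open>- \<theta>\<close> times
      the remainder of \<open>F\<close>, which is at most half as long.\<close>
    define \<theta> where "\<theta> = max 0 (min 1 (2 * dist_on I a x0 / r - 1))"
    have \<theta>: "0 \<le> \<theta>" "\<theta> \<le> 1" by (auto simp: \<theta>_def)
    have "\<bar>a i - x0 i\<bar> \<le> \<bar>F a i - F x0 i - (a i - x0 i)\<bar>" if "i \<in> I" for i
    proof -
      have "a i - x0 i = - (\<theta> * (F a i - F x0 i - (a i - x0 i)))"
        using Fa[OF that] unfolding flattened_def \<theta>_def by linarith
      then have "\<bar>a i - x0 i\<bar> = \<theta> * \<bar>F a i - F x0 i - (a i - x0 i)\<bar>"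
        using \<theta> by (metis abs_minus_cancel abs_mult abs_of_nonneg)
      then show ?thesis using \<theta> by (simp add: mult_left_le_one_le)
    qed
    then have "dist_on I a x0 \<le> (\<Sum>i\<in>I. \<bar>F a i - F x0 i - (a i - x0 i)\<bar>)"
      unfolding dist_on_def by (rule sum_mono)
    also have "\<dots> \<le> dist_on I a x0 / 2" using * by (intro deriv) simp
    finally show False using \<open>dist_on I a x0 \<ge> r / 2\<close> r by simp
  qed
  show ?thesis
  proof (rule that[of a])
    show "a p \<ge> 0" if "p \<in> P" for p
    proof (rule LIMSEQ_le_const[OF s(2)])
      show "p \<in> I" using that P by blast
      show "\<exists>N. \<forall>m\<ge>N. 0 \<le> u (s m) 0 p" using good that unfolding good_def by blast
    qed
    show "F a i = F x0 i" if "i \<in> I" for i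
      using Fa[OF that] flattened_far[OF r, of I a x0 F i] far by simp
    show "\<exists>i\<in>I. a i \<noteq> x0 i"
    proof (rule ccontr)
      assume "\<not> ?thesis"
      then have "dist_on I a x0 = 0" by (simp add: dist_on_def)
      then show False using far r by simp
    qed
  qed
qed

end

subsection \<open>Generic points\<close>

definition mono_eval :: "('x \<Rightarrow>\<^sub>0 nat) \<Rightarrow> ('x \<Rightarrow> real) \<Rightarrow> real" where
  "mono_eval m a = (\<Prod>x\<in>Poly_Mapping.keys m. a x ^ Poly_Mapping.lookup m x)"

lemma mono_eval_add: "mono_eval (m + m') a = mono_eval m a * mono_eval m' a"
proof -
  let ?S = "Poly_Mapping.keys m \<union> Poly_Mapping.keys m'"
  have ext: "mono_eval n a = (\<Prod>x\<in>?S. a x ^ Poly_Mapping.lookup n x)" if "Poly_Mapping.keys n \<subseteq> ?S" for n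
    unfolding mono_eval_def by (rule prod.mono_neutral_left) (use that in \<open>auto simp: in_keys_iff\<close>)
  have "mono_eval (m + m') a = (\<Prod>x\<in>?S. a x ^ Poly_Mapping.lookup (m + m') x)"
    by (rule ext) (rule keys_add)
  also have "\<dots> = mono_eval m a * mono_eval m' a"
    by (simp add: ext lookup_add power_add prod.distrib)
  finally show ?thesis .
qed

lemma mpoly_eval_superset:
  assumes "finite S" "Poly_Mapping.keys p \<subseteq> S"
  shows "mpoly_eval p a = (\<Sum>m\<in>S. of_rat (Poly_Mapping.lookup p m) * mono_eval m a)"
  unfolding mpoly_eval_def mono_eval_def
  by (rule sum.mono_neutral_left) (use assms in \<open>auto simp: in_keys_iff\<close>)

lemma mpoly_eval_add: "mpoly_eval (p + q) a = mpoly_eval p a + mpoly_eval q a"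
proof -
  let ?S = "Poly_Mapping.keys p \<union> Poly_Mapping.keys q"
  have "mpoly_eval (p + q) a = (\<Sum>m\<in>?S. of_rat (Poly_Mapping.lookup (p + q) m) * mono_eval m a)"
    by (rule mpoly_eval_superset) (auto intro: keys_add[THEN subsetD, THEN UnE])
  then show ?thesis
    by (simp add: mpoly_eval_superset[of ?S] lookup_add of_rat_add distrib_right sum.distrib)
qed

lemma mpoly_eval_0: "mpoly_eval 0 a = 0"
  by (simp add: mpoly_eval_def)

lemma mpoly_eval_single: "mpoly_eval (Poly_Mapping.single m c) a = of_rat c * mono_eval m a"
  by (subst mpoly_eval_superset[of "{m}"]) auto

lemma mpoly_eval_sum: "mpoly_eval (\<Sum>k\<in>A. p k) a = (\<Sum>k\<in>A. mpoly_eval (p k) a)"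
  by (induction A rule: infinite_finite_induct) (auto simp: mpoly_eval_0 mpoly_eval_add)

lemma sum_single_keys:
  "(\<Sum>m\<in>Poly_Mapping.keys p. Poly_Mapping.single m (Poly_Mapping.lookup p m)) = p"
proof (rule poly_mapping_eqI)
  fix k
  have "(\<Sum>m\<in>Poly_Mapping.keys p. Poly_Mapping.lookup (Poly_Mapping.single m (Poly_Mapping.lookup p m)) k)
    = (\<Sum>m\<in>Poly_Mapping.keys p. if m = k then Poly_Mapping.lookup p m else 0)"
    by (rule sum.cong) (auto simp: lookup_single when_def)
  also have "\<dots> = Poly_Mapping.lookup p k" by (simp add: in_keys_iff)
  finally show "Poly_Mapping.lookup (\<Sum>m\<in>Poly_Mapping.keys p. Poly_Mapping.single m (Poly_Mapping.lookup p m)) k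
    = Poly_Mapping.lookup p k" by (simp add: lookup_sum)
qed

lemma mpoly_eval_mult: "mpoly_eval (p * q) a = mpoly_eval p a * mpoly_eval q a"
proof -
  let ?l = Poly_Mapping.lookup and ?k = Poly_Mapping.keys and ?s = Poly_Mapping.single
  have "mpoly_eval (p * q) a = mpoly_eval ((\<Sum>m\<in>?k p. ?s m (?l p m)) * (\<Sum>m'\<in>?k q. ?s m' (?l q m'))) a"
    by (simp only: sum_single_keys)
  also have "\<dots> = (\<Sum>m\<in>?k p. \<Sum>m'\<in>?k q. of_rat (?l p m * ?l q m') * mono_eval (m + m') a)"
    by (simp add: sum_product mult_single mpoly_eval_sum mpoly_eval_single)
  also have "\<dots> = (\<Sum>m\<in>?k p. of_rat (?l p m) * mono_eval m a) * (\<Sum>m'\<in>?k q. of_rat (?l q m') * mono_eval m' a)"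
    by (simp add: sum_product of_rat_mult mono_eval_add mult_ac)
  finally show ?thesis by (simp add: mpoly_eval_def mono_eval_def)
qed

definition rat_poly_on :: "'x set \<Rightarrow> (('x \<Rightarrow> real) \<Rightarrow> real) set" where
  "rat_poly_on X = {q. \<exists>p :: 'x rat_mpoly. mpoly_indets p \<subseteq> X \<and> (\<forall>a. q a = mpoly_eval p a)}"

lemma rat_poly_on_const: "(\<lambda>a. of_rat c) \<in> rat_poly_on X"
  unfolding rat_poly_on_def
  by (auto simp: mpoly_eval_single mono_eval_def mpoly_indets_def split: if_splits
      intro!: exI[of _ "Poly_Mapping.single 0 c"])

lemma rat_poly_on_1: "(\<lambda>a. 1) \<in> rat_poly_on X"
  using rat_poly_on_const[of 1] by simp

lemma rat_poly_on_0: "(\<lambda>a. 0) \<in> rat_poly_on X"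
  using rat_poly_on_const[of 0] by simp

lemma rat_poly_on_var: "x \<in> X \<Longrightarrow> (\<lambda>a. a x) \<in> rat_poly_on X"
  unfolding rat_poly_on_def
  by (auto simp: mpoly_eval_single mono_eval_def mpoly_indets_def
      intro!: exI[of _ "Poly_Mapping.single (Poly_Mapping.single x 1) 1"])

lemma rat_poly_on_add:
  assumes "f \<in> rat_poly_on X" "g \<in> rat_poly_on X"
  shows "(\<lambda>a. f a + g a) \<in> rat_poly_on X"
proof -
  obtain p q where "mpoly_indets p \<subseteq> X" "\<forall>a. f a = mpoly_eval p a" "mpoly_indets q \<subseteq> X" "\<forall>a. g a = mpoly_eval q a"
    using assms unfolding rat_poly_on_def by blast
  moreover have "mpoly_indets (p + q) \<subseteq> mpoly_indets p \<union> mpoly_indets q"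
    using keys_add[of p q] unfolding mpoly_indets_def by blast
  ultimately show ?thesis
    unfolding rat_poly_on_def by (auto simp: mpoly_eval_add intro!: exI[of _ "p + q"])
qed

lemma rat_poly_on_mult:
  assumes "f \<in> rat_poly_on X" "g \<in> rat_poly_on X"
  shows "(\<lambda>a. f a * g a) \<in> rat_poly_on X"
proof -
  obtain p q where pq: "mpoly_indets p \<subseteq> X" "\<forall>a. f a = mpoly_eval p a" "mpoly_indets q \<subseteq> X" "\<forall>a. g a = mpoly_eval q a"
    using assms unfolding rat_poly_on_def by blast
  have "mpoly_indets (p * q) \<subseteq> mpoly_indets p \<union> mpoly_indets q"
  proof
    fix x assume "x \<in> mpoly_indets (p * q)"
    then obtain m m' where "m \<in> Poly_Mapping.keys p" "m' \<in> Poly_Mapping.keys q" "x \<in> Poly_Mapping.keys (m + m')"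
      using keys_mult[of p q] unfolding mpoly_indets_def by blast
    then show "x \<in> mpoly_indets p \<union> mpoly_indets q"
      using keys_add[of m m'] unfolding mpoly_indets_def by blast
  qed
  then show ?thesis
    using pq unfolding rat_poly_on_def by (auto simp: mpoly_eval_mult intro!: exI[of _ "p * q"])
qed

lemma rat_poly_on_diff:
  assumes "f \<in> rat_poly_on X" "g \<in> rat_poly_on X"
  shows "(\<lambda>a. f a - g a) \<in> rat_poly_on X"
  using rat_poly_on_add[OF assms(1) rat_poly_on_mult[OF rat_poly_on_const[of "-1"] assms(2)]] by simp

lemmas rat_poly_on_intros = rat_poly_on_var rat_poly_on_add rat_poly_on_mult rat_poly_on_diff
  rat_poly_on_0 rat_poly_on_1

text \<open>Nonzero means nonzero at some point \<open>a0\<close> rather than as a formal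
  polynomial. The uses below provide such a point, and its existence implies that the formal
  polynomial is not 0.\<close>

definition generic_point :: "'x set \<Rightarrow> ('x \<Rightarrow> real) \<Rightarrow> bool" where
  "generic_point X a \<longleftrightarrow> (\<forall>q\<in>rat_poly_on X. \<forall>a0. q a0 \<noteq> 0 \<longrightarrow> q a \<noteq> 0)"

lemma generic_imp_generic_point:
  fixes \<rho> :: "'v \<Rightarrow> real ^ 'd"
  assumes "generic V \<rho>"
  shows "generic_point (V \<times> UNIV) (\<lambda>(u, i). \<rho> u $ i)"
  unfolding generic_point_def
proof (intro ballI allI impI)
  fix q and a0 :: "'v \<times> 'd \<Rightarrow> real"
  assume "q \<in> rat_poly_on (V \<times> UNIV)" and q: "q a0 \<noteq> 0"
  then obtain p :: "('v \<times> 'd) rat_mpoly" where p: "mpoly_indets p \<subseteq> V \<times> UNIV" "\<And>a. q a = mpoly_eval p a"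
    unfolding rat_poly_on_def by blast
  then have "p \<noteq> 0" using q by (auto simp: mpoly_eval_0)
  then show "q (\<lambda>(u, i). \<rho> u $ i) \<noteq> 0" using assms p unfolding generic_def by auto
qed

text \<open>Rank is maximal at generic points: independence at \<open>a0\<close> is witnessed by a
  product of pivots, a rational polynomial that does not vanish at \<open>a0\<close> and hence not
  at \<open>a\<close>.\<close>

lemma generic_indep_on:
  assumes "finite J" "\<And>j s. j \<in> J \<Longrightarrow> s \<in> S \<Longrightarrow> w j s \<in> rat_poly_on X" "generic_point X a"
    "indep_on J S (\<lambda>j s. w j s a0)"
  shows "indep_on J S (\<lambda>j s. w j s a)"
proof -
  have "\<exists>q\<in>rat_poly_on X. q a0 \<noteq> 0 \<and> (\<forall>a. q a \<noteq> 0 \<longrightarrow> indep_on J S (\<lambda>j s. w j s a))"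
    by (rule indep_on_open_condition[where w = w, OF assms(1,2) rat_poly_on_1 rat_poly_on_mult rat_poly_on_diff assms(4)])
  then show ?thesis using assms(3) unfolding generic_point_def by blast
qed

text \<open>Independence transfers between generic points in both directions. So a maximal
  independent subfamily at \<open>a\<close> stays independent at \<open>a'\<close>, and adjoining
  \<open>j\<close> leaves it dependent there, as it does at \<open>a\<close>.\<close>

lemma generic_comb_on:
  assumes J: "finite J" "J' \<subseteq> J" "j \<in> J" and w: "\<And>j s. j \<in> J \<Longrightarrow> s \<in> S \<Longrightarrow> w j s \<in> rat_poly_on X"
    and a: "generic_point X a" "generic_point X a'"
    and comb: "comb_on J' S (\<lambda>j s. w j s a) (\<lambda>s. w j s a)"
  shows "comb_on J' S (\<lambda>j s. w j s a') (\<lambda>s. w j s a')"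
proof -
  have fin: "finite J'" using J finite_subset by blast
  obtain J0 where J0: "J0 \<subseteq> J'" "indep_on J0 S (\<lambda>j s. w j s a)" "\<And>j. j \<in> J' \<Longrightarrow> comb_on J0 S (\<lambda>j s. w j s a) (\<lambda>s. w j s a)"
    by (rule maximal_indep_on[OF fin, of S "\<lambda>j s. w j s a"]) (rule that)
  have finJ0: "finite J0" "J0 \<subseteq> J" using J0(1) fin J(2) finite_subset by auto
  have ind': "indep_on J0 S (\<lambda>j s. w j s a')"
    by (rule generic_indep_on[where w = w, OF finJ0(1) _ a(2) J0(2)]) (use w finJ0 in auto)
  have combJ0: "comb_on J0 S (\<lambda>j s. w j s a) (\<lambda>s. w j s a)" using comb J0(3) by (rule comb_on_trans)
  have "comb_on J0 S (\<lambda>j s. w j s a') (\<lambda>s. w j s a')"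
  proof (cases "j \<in> J0")
    case True
    then show ?thesis using comb_on_member[OF finJ0(1), of j S "\<lambda>j s. w j s a'"] by simp
  next
    case False
    have "\<not> indep_on (insert j J0) S (\<lambda>j s. w j s a')"
    proof
      assume ind: "indep_on (insert j J0) S (\<lambda>j s. w j s a')"
      have "indep_on (insert j J0) S (\<lambda>j s. w j s a)"
        by (rule generic_indep_on[where w = w, OF _ _ a(1) ind]) (use w finJ0 J(3) in auto)
      then have "card (insert j J0) \<le> card J0"
        by (intro indep_on_card_le[where w = "\<lambda>j s. w j s a" and ?w0.0 = "\<lambda>j s. w j s a", OF _ finJ0(1)])
          (use finJ0(1) combJ0 comb_on_member[OF finJ0(1), of _ S "\<lambda>j s. w j s a"] in auto)
      then show False using False finJ0(1) by simp
    qed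
    then show ?thesis using comb_on_if_dependent[OF finJ0(1) ind'] by blast
  qed
  then show ?thesis using comb_on_mono J0(1) fin by blast
qed

lemma indep_on_reindex:
  assumes "inj_on f J"
  shows "indep_on (f ` J) S w \<longleftrightarrow> indep_on J S (\<lambda>j. w (f j))"
proof
  assume *: "indep_on (f ` J) S w"
  show "indep_on J S (\<lambda>j. w (f j))"
    unfolding indep_on_def
  proof (intro allI impI)
    fix c assume c: "\<forall>s\<in>S. (\<Sum>j\<in>J. c j * w (f j) s) = 0"
    have "(\<Sum>k\<in>f ` J. c (the_inv_into J f k) * w k s) = (\<Sum>j\<in>J. c j * w (f j) s)" for s
      using assms by (simp add: sum.reindex the_inv_into_f_f)
    then have zero: "c (the_inv_into J f k) = 0" if "k \<in> f ` J" for k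
      using indep_onD[OF *, of "\<lambda>k. c (the_inv_into J f k)"] c that by metis
    show "\<forall>j\<in>J. c j = 0"
    proof
      fix j assume "j \<in> J"
      then show "c j = 0" using zero[of "f j"] assms by (simp add: the_inv_into_f_f)
    qed
  qed
next
  assume *: "indep_on J S (\<lambda>j. w (f j))"
  show "indep_on (f ` J) S w"
    unfolding indep_on_def
  proof (intro allI impI)
    fix c assume "\<forall>s\<in>S. (\<Sum>j\<in>f ` J. c j * w j s) = 0"
    then have "\<forall>s\<in>S. (\<Sum>j\<in>J. c (f j) * w (f j) s) = 0" using assms by (simp add: sum.reindex)
    then have "c (f j) = 0" if "j \<in> J" for j using indep_onD[OF *, of "\<lambda>j. c (f j)"] that by metis
    then show "\<forall>j\<in>f ` J. c j = 0" by blast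
  qed
qed

text \<open>If the first order image of a kernel vector were outside the image at \<open>a\<close>, the rank at a point near \<open>a\<close> would
  exceed the rank at \<open>a\<close>, which is maximal.\<close>

lemma generic_pencil:
  assumes J: "finite J" and w: "\<And>j s. j \<in> J \<Longrightarrow> s \<in> S \<Longrightarrow> w j s \<in> rat_poly_on X"
    and a: "generic_point X a"
    and lin: "\<And>j s t. j \<in> J \<Longrightarrow> s \<in> S \<Longrightarrow> w j s (\<lambda>x. a x + t * b x) = w j s a + t * w' j s"
    and ker: "\<And>s. s \<in> S \<Longrightarrow> (\<Sum>j\<in>J. c j * w j s a) = 0"
  shows "comb_on J S (\<lambda>j s. w j s a) (\<lambda>s. \<Sum>j\<in>J. c j * w' j s)"
proof (rule ccontr)
  define y where "y s = (\<Sum>j\<in>J. c j * w' j s)" for s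
  assume "\<not> ?thesis"
  then have not_comb: "\<not> comb_on J S (\<lambda>j s. w j s a) y" by (simp add: y_def[abs_def])
  obtain J0 where J0: "J0 \<subseteq> J" "indep_on J0 S (\<lambda>j s. w j s a)" "\<And>j. j \<in> J \<Longrightarrow> comb_on J0 S (\<lambda>j s. w j s a) (\<lambda>s. w j s a)"
    by (rule maximal_indep_on[OF J, of S "\<lambda>j s. w j s a"]) (rule that)
  have finJ0: "finite J0" using J0 J finite_subset by blast
  \<comment> \<open>\<open>None\<close> stands for the supposed extra direction \<open>y\<close>.
    For \<open>t \<noteq> 0\<close> it lies in the span of the family at \<open>a + t * b\<close>,
    being \<open>1 / t\<close> times the combination with coefficients \<open>c\<close>, which
    vanishes at \<open>t = 0\<close>.\<close>
  define W where "W k s t = (case k of Some j \<Rightarrow> w j s a + t * w' j s | None \<Rightarrow> y s)" for k s and t :: real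
  have W_Some: "(\<lambda>j s. W (Some j) s 0) = (\<lambda>j s. w j s a)" by (simp add: W_def)
  have "indep_on (Some ` J0) S (\<lambda>k s. W k s 0)"
    using J0(2) by (subst indep_on_reindex) (auto simp: W_def)
  moreover have "\<not> comb_on (Some ` J0) S (\<lambda>k s. W k s 0) (\<lambda>s. W None s 0)"
  proof
    assume "comb_on (Some ` J0) S (\<lambda>k s. W k s 0) (\<lambda>s. W None s 0)"
    then obtain d where "\<forall>s\<in>S. y s = (\<Sum>k\<in>Some ` J0. d k * W k s 0)" unfolding comb_on_def W_def by auto
    then have "\<forall>s\<in>S. y s = (\<Sum>j\<in>J0. d (Some j) * w j s a)" by (simp add: sum.reindex W_def)
    then have "comb_on J0 S (\<lambda>j s. w j s a) y" unfolding comb_on_def by (intro exI[of _ "\<lambda>j. d (Some j)"])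
    then show False using not_comb comb_on_mono J0(1) J by blast
  qed
  ultimately have ind0: "indep_on (insert None (Some ` J0)) S (\<lambda>k s. W k s 0)"
    using finJ0 by (intro indep_on_insert) auto
  have "\<exists>q\<in>range poly. q 0 \<noteq> 0 \<and> (\<forall>t. q t \<noteq> 0 \<longrightarrow> indep_on (insert None (Some ` J0)) S (\<lambda>k s. W k s t))"
  proof (rule indep_on_open_condition[where w = W, OF _ _ _ _ _ ind0])
    show "finite (insert None (Some ` J0))" using finJ0 by simp
    show "W k s \<in> range poly" for k s
    proof (cases k)
      case None
      then have "W k s = poly [:y s:]" by (auto simp: W_def)
      then show ?thesis by blast
    next
      case (Some j)
      then have "W k s = poly [:w j s a, w' j s:]" by (auto simp: W_def)
      then show ?thesis by blast
    qed
    have "(\<lambda>_. 1) = poly [:1::real:]" by auto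
    then show "(\<lambda>_::real. 1::real) \<in> range poly" by blast
    fix f g :: "real \<Rightarrow> real" assume "f \<in> range poly" "g \<in> range poly"
    then obtain p q where pq: "f = poly p" "g = poly q" by blast
    have "(\<lambda>t. f t * g t) = poly (p * q)" "(\<lambda>t. f t - g t) = poly (p - q)" using pq by auto
    then show "(\<lambda>t. f t * g t) \<in> range poly" "(\<lambda>t. f t - g t) \<in> range poly" by blast+
  qed
  then obtain p where p: "poly p 0 \<noteq> 0"
      "\<And>t. poly p t \<noteq> 0 \<Longrightarrow> indep_on (insert None (Some ` J0)) S (\<lambda>k s. W k s t)"
    by blast
  then have "p \<noteq> 0" by auto
  then have "finite (insert 0 {t. poly p t = 0})" by (simp add: poly_roots_finite)
  then obtain t where t: "t \<noteq> 0" "poly p t \<noteq> 0" using ex_new_if_finite[OF infinite_UNIV_char_0] by blast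
  define a' where "a' x = a x + t * b x" for x
  have wa': "w j s a' = w j s a + t * w' j s" if "j \<in> J" "s \<in> S" for j s
    unfolding a'_def[abs_def] using lin[OF that] .
  obtain J1 where J1: "J1 \<subseteq> J" "indep_on J1 S (\<lambda>j s. w j s a')" "\<And>j. j \<in> J \<Longrightarrow> comb_on J1 S (\<lambda>j s. w j s a') (\<lambda>s. w j s a')"
    by (rule maximal_indep_on[OF J, of S "\<lambda>j s. w j s a'"]) (rule that)
  have finJ1: "finite J1" using J1 J finite_subset by blast
  have "card (insert None (Some ` J0)) \<le> card J1"
  proof (rule indep_on_card_le[OF _ finJ1 p(2)[OF t(2)]])
    fix k assume k: "k \<in> insert None (Some ` J0)"
    show "comb_on J1 S (\<lambda>j s. w j s a') (\<lambda>s. W k s t)"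
    proof (cases k)
      case (Some j)
      then have "j \<in> J" using k J0 by auto
      show ?thesis by (rule comb_on_cong[OF _ J1(3)[OF \<open>j \<in> J\<close>]]) (simp add: Some W_def wa'[OF \<open>j \<in> J\<close>])
    next
      case None
      have "comb_on J1 S (\<lambda>j s. w j s a') (\<lambda>s. (1 / t) * (\<Sum>j\<in>J. c j * w j s a'))"
        by (intro comb_on_scale comb_on_sum J1(3))
      moreover have "(1 / t) * (\<Sum>j\<in>J. c j * w j s a') = W k s t" if "s \<in> S" for s
      proof -
        have "(\<Sum>j\<in>J. c j * w j s a') = (\<Sum>j\<in>J. c j * w j s a) + t * (\<Sum>j\<in>J. c j * w' j s)"
          unfolding sum_distrib_left sum.distrib[symmetric]
          by (rule sum.cong) (auto simp: wa' that algebra_simps)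
        then show ?thesis using ker[OF that] t(1) by (simp add: None W_def y_def)
      qed
      ultimately show ?thesis by (rule comb_on_cong[rotated])
    qed
  qed (use finJ0 in simp)
  moreover have "card J1 \<le> card J0"
  proof (rule indep_on_card_le[OF finJ1 finJ0])
    show "indep_on J1 S (\<lambda>j s. w j s a)"
      by (rule generic_indep_on[where w = w, OF finJ1 _ a J1(2)]) (use w J1(1) in auto)
  qed (use J0(3) J1(1) in auto)
  ultimately show False using finJ0 by (simp add: card_image)
qed

subsection \<open>The shared stress kernel\<close>

text \<open>\<open>s\<close> and \<open>t\<close> orient the edges arbitrarily; products of two
  differences along the same edge do not depend on the orientation.\<close>

locale edge_ends =
  fixes V :: "'v set" and E :: "'e set" and s t :: "'e \<Rightarrow> 'v"
  assumes finV: "finite V" and finE: "finite E" and ends: "\<And>e. e \<in> E \<Longrightarrow> s e \<in> V" "\<And>e. e \<in> E \<Longrightarrow> t e \<in> V"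
begin

definition delta :: "('v \<Rightarrow> real) \<Rightarrow> 'e \<Rightarrow> real" where
  "delta f e = f (s e) - f (t e)"

definition ind :: "'v \<Rightarrow> 'v \<Rightarrow> real" where
  "ind u = (\<lambda>w. if w = u then 1 else 0)"

text \<open>\<open>tang a\<close> is the image of the differential of the length-squared map at the framework with coordinate
  functions \<open>\<lambda>u. a (u, i)\<close>, up to a factor 2. By duality \<open>stress_kernel a\<close> is the common kernel of its
  equilibrium stresses.\<close>

definition tang :: "('v \<times> 'd::finite \<Rightarrow> real) \<Rightarrow> ('e \<Rightarrow> real) \<Rightarrow> bool" where
  "tang a y \<longleftrightarrow> (\<exists>h. \<forall>e\<in>E. y e = (\<Sum>i\<in>UNIV. delta (\<lambda>u. a (u, i)) e * delta (h i) e))"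

definition stress_kernel :: "('v \<times> 'd::finite \<Rightarrow> real) \<Rightarrow> ('v \<Rightarrow> real) set" where
  "stress_kernel a = {f. \<forall>g. tang a (\<lambda>e. delta f e * delta g e)}"

lemma delta_cong: "e \<in> E \<Longrightarrow> (\<And>u. u \<in> V \<Longrightarrow> f u = g u) \<Longrightarrow> delta f e = delta g e"
  using ends by (simp add: delta_def)

lemma delta_add: "delta (\<lambda>u. f u + g u) e = delta f e + delta g e"
  by (simp add: delta_def)

lemma delta_scale: "delta (\<lambda>u. c * f u) e = c * delta f e"
  by (simp add: delta_def right_diff_distrib)

lemma delta_const: "delta (\<lambda>u. c) e = 0"
  by (simp add: delta_def)

lemma delta_sum: "delta (\<lambda>u. \<Sum>k\<in>A. f k u) e = (\<Sum>k\<in>A. delta (f k) e)"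
  by (simp add: delta_def sum_subtractf)

lemma delta_ind: "e \<in> E \<Longrightarrow> (\<Sum>u\<in>V. f u * delta (ind u) e) = delta f e"
  using ends finV by (simp add: delta_def ind_def right_diff_distrib sum_subtractf if_distrib[of "\<lambda>x. _ * x"] cong: if_cong)

lemma tang_cong: "(\<And>e. e \<in> E \<Longrightarrow> y e = z e) \<Longrightarrow> tang a y \<Longrightarrow> tang a z"
  unfolding tang_def by metis

lemma tang_basic: "tang a (\<lambda>e. \<Sum>i\<in>UNIV. delta (\<lambda>u. a (u, i)) e * delta (h i) e)"
  unfolding tang_def by blast

lemma tang_zero: "tang a (\<lambda>e. 0)"
  unfolding tang_def by (rule exI[of _ "\<lambda>i u. 0"]) (simp add: delta_const)

lemma tang_add:
  assumes "tang a y" "tang a z"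
  shows "tang a (\<lambda>e. y e + z e)"
proof -
  obtain g h where "\<forall>e\<in>E. y e = (\<Sum>i\<in>UNIV. delta (\<lambda>u. a (u, i)) e * delta (g i) e)"
    "\<forall>e\<in>E. z e = (\<Sum>i\<in>UNIV. delta (\<lambda>u. a (u, i)) e * delta (h i) e)"
    using assms unfolding tang_def by blast
  then show ?thesis unfolding tang_def
    by (intro exI[of _ "\<lambda>i u. g i u + h i u"]) (simp add: delta_add distrib_left sum.distrib)
qed

lemma tang_scale:
  assumes "tang a y"
  shows "tang a (\<lambda>e. c * y e)"
proof -
  obtain h where "\<forall>e\<in>E. y e = (\<Sum>i\<in>UNIV. delta (\<lambda>u. a (u, i)) e * delta (h i) e)"
    using assms unfolding tang_def by blast
  then show ?thesis unfolding tang_def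
    by (intro exI[of _ "\<lambda>i u. c * h i u"]) (simp add: delta_scale sum_distrib_left mult_ac)
qed

lemma tang_sum: "(\<And>k. k \<in> A \<Longrightarrow> tang a (y k)) \<Longrightarrow> tang a (\<lambda>e. \<Sum>k\<in>A. y k e)"
  by (induction A rule: infinite_finite_induct) (auto intro: tang_zero tang_add)

lemma stress_kernelD: "f \<in> stress_kernel a \<Longrightarrow> tang a (\<lambda>e. delta f e * delta g e)"
  unfolding stress_kernel_def by blast

text \<open>Testing on indicator functions suffices by linearity, which turns membership into a
  finite linear system.\<close>

lemma stress_kernelI:
  assumes "\<And>u. u \<in> V \<Longrightarrow> tang a (\<lambda>e. delta f e * delta (ind u) e)"
  shows "f \<in> stress_kernel a"
  unfolding stress_kernel_def
proof (intro CollectI allI)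
  fix g
  have "tang a (\<lambda>e. \<Sum>u\<in>V. g u * (delta f e * delta (ind u) e))"
    by (intro tang_sum tang_scale assms)
  moreover have "(\<Sum>u\<in>V. g u * (delta f e * delta (ind u) e)) = delta f e * delta g e" if "e \<in> E" for e
    unfolding delta_ind[OF that, of g, symmetric] sum_distrib_left by (simp add: mult_ac)
  ultimately show "tang a (\<lambda>e. delta f e * delta g e)" by (rule tang_cong[rotated])
qed

lemma stress_kernel_add: "f \<in> stress_kernel a \<Longrightarrow> g \<in> stress_kernel a \<Longrightarrow> (\<lambda>u. f u + g u) \<in> stress_kernel a"
  unfolding stress_kernel_def by (auto simp: delta_add distrib_right intro: tang_add)

lemma stress_kernel_scale: "f \<in> stress_kernel a \<Longrightarrow> (\<lambda>u. c * f u) \<in> stress_kernel a"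
  unfolding stress_kernel_def by (auto simp: delta_scale mult.assoc intro: tang_scale)

lemma stress_kernel_const: "(\<lambda>u. c) \<in> stress_kernel a"
  unfolding stress_kernel_def by (simp add: delta_const tang_zero)

lemma stress_kernel_diff: "f \<in> stress_kernel a \<Longrightarrow> g \<in> stress_kernel a \<Longrightarrow> (\<lambda>u. f u - g u) \<in> stress_kernel a"
  using stress_kernel_add[of f a "\<lambda>u. -1 * g u"] stress_kernel_scale[of g a "-1"] by simp

lemma stress_kernel_sum: "(\<And>k. k \<in> A \<Longrightarrow> f k \<in> stress_kernel a) \<Longrightarrow> (\<lambda>u. \<Sum>k\<in>A. f k u) \<in> stress_kernel a"
  by (induction A rule: infinite_finite_induct) (auto intro: stress_kernel_add stress_kernel_const)

lemma stress_kernel_coordinate: "(\<lambda>u. a (u, i)) \<in> stress_kernel a"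
  unfolding stress_kernel_def
proof (intro CollectI allI)
  fix g
  have "tang a (\<lambda>e. \<Sum>j\<in>UNIV. delta (\<lambda>u. a (u, j)) e * delta (if j = i then g else (\<lambda>u. 0)) e)"
    by (rule tang_basic)
  moreover have "(\<Sum>j\<in>UNIV. delta (\<lambda>u. a (u, j)) e * delta (if j = i then g else (\<lambda>u. 0)) e)
    = (\<Sum>j\<in>UNIV. if j = i then delta (\<lambda>u. a (u, j)) e * delta g e else 0)" for e
    by (rule sum.cong) (auto simp: delta_const)
  ultimately show "tang a (\<lambda>e. delta (\<lambda>u. a (u, i)) e * delta g e)" by simp
qed

text \<open>The columns of the linear system \<open>(f, h) \<mapsto> (delta f * delta (ind j) - (\<Sum>i. delta a\<^sub>i * delta h\<^sub>i\<^sub>j))\<^sub>j\<close>, whose kernel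
  projects onto \<open>stress_kernel a\<close>.\<close>

definition ucol :: "'v + 'd::finite \<times> 'v \<times> 'v \<Rightarrow> 'e \<times> 'v \<Rightarrow> ('v \<times> 'd \<Rightarrow> real) \<Rightarrow> real" where
  "ucol k ej a = (case ej of (e, j) \<Rightarrow> (case k of Inl u \<Rightarrow> delta (ind u) e * delta (ind j) e
     | Inr (i, j', u) \<Rightarrow> if j' = j then - delta (\<lambda>u. a (u, i)) e * delta (ind u) e else 0))"

abbreviation ucols :: "('v + 'd::finite \<times> 'v \<times> 'v) set" where
  "ucols \<equiv> V <+> (UNIV \<times> V \<times> V)"

lemma ucol_rat_poly: "ej \<in> E \<times> V \<Longrightarrow> ucol k ej \<in> rat_poly_on (V \<times> UNIV)"
proof (cases ej; cases k)
  fix e j u assume "ej \<in> E \<times> V" "ej = (e, j)" "k = Inl u"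
  have "delta (ind u) e * delta (ind j) e \<in> \<rat>"
    by (auto simp: delta_def ind_def)
  then obtain c where "delta (ind u) e * delta (ind j) e = of_rat c" by (auto elim: Rats_cases)
  then have "ucol k ej = (\<lambda>a. of_rat c)" by (auto simp: ucol_def \<open>ej = _\<close> \<open>k = _\<close>)
  then show ?thesis by (simp add: rat_poly_on_const)
next
  fix e j b assume ej: "ej \<in> E \<times> V" "ej = (e, j)" "k = Inr b"
  obtain i j' u where b: "b = (i, j', u)" by (cases b)
  have "delta (ind u) e \<in> \<rat>" by (auto simp: delta_def ind_def)
  then obtain c where c: "delta (ind u) e = of_rat c" by (auto elim: Rats_cases)
  show ?thesis
  proof (cases "j' = j")
    case True
    have "ucol k ej = (\<lambda>a. (a (t e, i) - a (s e, i)) * of_rat c)"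
      unfolding ucol_def ej b using True c by (auto simp: delta_def)
    then show ?thesis using ej ends by (auto intro!: rat_poly_on_intros rat_poly_on_const)
  next
    case False
    then have "ucol k ej = (\<lambda>a. 0)" by (auto simp: ucol_def ej b)
    then show ?thesis by (simp add: rat_poly_on_0)
  qed
qed

lemma finite_ucols: "finite (ucols :: ('v + 'd::finite \<times> 'v \<times> 'v) set)"
  using finV by simp

lemma sum_ucols:
  assumes "e \<in> E" "j \<in> V"
  shows "(\<Sum>k\<in>ucols. c k * ucol k (e, j) a) =
    delta (\<lambda>u. c (Inl u)) e * delta (ind j) e
      - (\<Sum>i\<in>UNIV. delta (\<lambda>u. a (u, i)) e * delta (\<lambda>u. c (Inr (i, j, u))) e)"
proof -
  have "(\<Sum>k\<in>ucols. c k * ucol k (e, j) a) = (\<Sum>u\<in>V. c (Inl u) * ucol (Inl u) (e, j) a)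
    + (\<Sum>z\<in>UNIV \<times> V \<times> V. c (Inr z) * ucol (Inr z) (e, j) a)"
    using finV by (simp add: sum.Plus)
  also have "(\<Sum>u\<in>V. c (Inl u) * ucol (Inl u) (e, j) a) = delta (\<lambda>u. c (Inl u)) e * delta (ind j) e"
    unfolding delta_ind[OF assms(1), of "\<lambda>u. c (Inl u)", symmetric]
    by (simp add: ucol_def sum_distrib_left mult_ac)
  also have "(\<Sum>z\<in>UNIV \<times> V \<times> V. c (Inr z) * ucol (Inr z) (e, j) a)
    = (\<Sum>i\<in>UNIV. \<Sum>j'\<in>V. \<Sum>u\<in>V. c (Inr (i, j', u)) * ucol (Inr (i, j', u)) (e, j) a)"
    by (simp add: sum.cartesian_product)
  also have "\<dots> = (\<Sum>i\<in>UNIV. - (delta (\<lambda>u. a (u, i)) e * delta (\<lambda>u. c (Inr (i, j, u))) e))"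
  proof (rule sum.cong)
    fix i
    have "(\<Sum>j'\<in>V. \<Sum>u\<in>V. c (Inr (i, j', u)) * ucol (Inr (i, j', u)) (e, j) a)
      = (\<Sum>j'\<in>V. if j' = j then (\<Sum>u\<in>V. c (Inr (i, j, u)) * (- delta (\<lambda>u. a (u, i)) e * delta (ind u) e)) else 0)"
      by (rule sum.cong) (auto simp: ucol_def intro!: sum.cong)
    also have "\<dots> = - (delta (\<lambda>u. a (u, i)) e * (\<Sum>u\<in>V. c (Inr (i, j, u)) * delta (ind u) e))"
      using assms(2) finV by (simp add: sum_distrib_left sum_negf mult_ac)
    finally show "(\<Sum>j'\<in>V. \<Sum>u\<in>V. c (Inr (i, j', u)) * ucol (Inr (i, j', u)) (e, j) a)
      = - (delta (\<lambda>u. a (u, i)) e * delta (\<lambda>u. c (Inr (i, j, u))) e)"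
      using delta_ind[OF assms(1), of "\<lambda>u. c (Inr (i, j, u))"] by simp
  qed simp
  finally show ?thesis by (simp add: sum_negf)
qed

lemma stress_kernel_of_kernel:
  assumes "\<And>e j. e \<in> E \<Longrightarrow> j \<in> V \<Longrightarrow> (\<Sum>k\<in>ucols. c k * ucol k (e, j) a) = 0"
  shows "(\<lambda>u. c (Inl u)) \<in> stress_kernel a"
proof (rule stress_kernelI)
  fix j assume "j \<in> V"
  then have "\<forall>e\<in>E. delta (\<lambda>u. c (Inl u)) e * delta (ind j) e
    = (\<Sum>i\<in>UNIV. delta (\<lambda>u. a (u, i)) e * delta (\<lambda>u. c (Inr (i, j, u))) e)"
    using assms sum_ucols[of _ j c a] by simp
  then show "tang a (\<lambda>e. delta (\<lambda>u. c (Inl u)) e * delta (ind j) e)"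
    unfolding tang_def by (intro exI[of _ "\<lambda>i u. c (Inr (i, j, u))"])
qed

lemma kernel_of_stress_kernel:
  fixes a :: "'v \<times> 'd::finite \<Rightarrow> real"
  assumes "f \<in> stress_kernel a"
  obtains c where "\<And>u. c (Inl u) = f u"
    "\<And>e j. e \<in> E \<Longrightarrow> j \<in> V \<Longrightarrow> (\<Sum>k\<in>ucols. c k * ucol k (e, j) a) = 0"
proof -
  have "\<forall>j. \<exists>h. \<forall>e\<in>E. delta f e * delta (ind j) e = (\<Sum>i\<in>UNIV. delta (\<lambda>u. a (u, i)) e * delta (h i) e)"
    using stress_kernelD[OF assms] unfolding tang_def by blast
  from choice[OF this] obtain h where h: "\<And>e j. e \<in> E \<Longrightarrow>
      delta f e * delta (ind j) e = (\<Sum>i\<in>UNIV. delta (\<lambda>u. a (u, i)) e * delta (h j i) e)" by blast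
  define c where "c k = (case k of Inl u \<Rightarrow> f u | Inr (i, j, u) \<Rightarrow> h j i u)" for k
  show ?thesis
  proof (rule that[of c])
    show "(\<Sum>k\<in>ucols. c k * ucol k (e, j) a) = 0" if "e \<in> E" "j \<in> V" for e j
      unfolding sum_ucols[OF that] using h[OF that(1), of j] by (simp add: c_def)
  qed (simp add: c_def)
qed

text \<open>The infinitesimal form of the linearity of the fibres of the Gauss map.\<close>

theorem stress_kernel_products:
  fixes a :: "'v \<times> 'd::finite \<Rightarrow> real"
  assumes gen: "generic_point (V \<times> UNIV) a" and f: "f \<in> stress_kernel a" and g: "g \<in> stress_kernel a"
  obtains h :: "'d \<Rightarrow> 'v \<Rightarrow> real" where "\<And>i. h i \<in> stress_kernel a"
    "\<And>e. e \<in> E \<Longrightarrow> delta f e * delta g e = (\<Sum>i\<in>UNIV. delta (\<lambda>u. a (u, i)) e * delta (h i) e)"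
proof -
  obtain c where c: "\<And>u. c (Inl u) = f u"
    "\<And>e j. e \<in> E \<Longrightarrow> j \<in> V \<Longrightarrow> (\<Sum>k\<in>ucols. c k * ucol k (e, j) a) = 0"
    using kernel_of_stress_kernel[OF f] by blast
  define h where "h i w = (\<Sum>j\<in>V. g j * c (Inr (i, j, w)))" for i w
  have eq: "delta f e * delta g e = (\<Sum>i\<in>UNIV. delta (\<lambda>u. a (u, i)) e * delta (h i) e)" if e: "e \<in> E" for e
  proof -
    have "delta f e * delta g e = (\<Sum>j\<in>V. g j * (delta f e * delta (ind j) e))"
      unfolding delta_ind[OF e, of g, symmetric] sum_distrib_left by (simp add: mult_ac)
    also have "\<dots> = (\<Sum>j\<in>V. g j * (\<Sum>i\<in>UNIV. delta (\<lambda>u. a (u, i)) e * delta (\<lambda>u. c (Inr (i, j, u))) e))"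
    proof (rule sum.cong)
      fix j assume "j \<in> V"
      then show "g j * (delta f e * delta (ind j) e)
        = g j * (\<Sum>i\<in>UNIV. delta (\<lambda>u. a (u, i)) e * delta (\<lambda>u. c (Inr (i, j, u))) e)"
        using c(2)[OF e \<open>j \<in> V\<close>] sum_ucols[OF e \<open>j \<in> V\<close>, of c a] by (simp add: c(1))
    qed simp
    also have "\<dots> = (\<Sum>i\<in>UNIV. delta (\<lambda>u. a (u, i)) e * delta (h i) e)"
      unfolding h_def delta_sum delta_scale sum_distrib_left by (subst sum.swap) (simp add: mult_ac)
    finally show ?thesis .
  qed
  \<comment> \<open>The kernel vector \<open>c\<close> is fed into the pencil argument in an
    arbitrary direction \<open>b\<close>. After contraction with \<open>g\<close> the result is
    tangent at \<open>a\<close> up to a multiple of \<open>delta g\<close>, which is tangent as well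
    because \<open>g\<close> lies in the kernel.\<close>
  have var: "tang a (\<lambda>e. \<Sum>i\<in>UNIV. delta (\<lambda>u. b (u, i)) e * delta (h i) e)" for b :: "'v \<times> 'd \<Rightarrow> real"
  proof -
    define w' where "w' k ej = (case k of Inl u \<Rightarrow> 0 | Inr z \<Rightarrow> ucol k ej b)" for k ej
    have "comb_on ucols (E \<times> V) (\<lambda>k ej. ucol k ej a) (\<lambda>ej. \<Sum>k\<in>ucols. c k * w' k ej)"
    proof (rule generic_pencil[where w = ucol and b = b, OF finite_ucols ucol_rat_poly gen])
      show "ucol k ej (\<lambda>x. a x + r * b x) = ucol k ej a + r * w' k ej" for k ej r
        by (auto simp: ucol_def w'_def delta_def algebra_simps split: sum.splits prod.splits)
      show "(\<Sum>k\<in>ucols. c k * ucol k ej a) = 0" if "ej \<in> E \<times> V" for ej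
        using c(2) that by auto
    qed
    then obtain d where d: "\<And>e j. e \<in> E \<Longrightarrow> j \<in> V \<Longrightarrow> (\<Sum>k\<in>ucols. c k * w' k (e, j)) = (\<Sum>k\<in>ucols. d k * ucol k (e, j) a)"
      unfolding comb_on_def by blast
    have lhs: "(\<Sum>k\<in>ucols. c k * w' k (e, j)) = - (\<Sum>i\<in>UNIV. delta (\<lambda>u. b (u, i)) e * delta (\<lambda>u. c (Inr (i, j, u))) e)"
      if "e \<in> E" "j \<in> V" for e j
    proof -
      have "(\<Sum>k\<in>ucols. c k * w' k (e, j)) = (\<Sum>k\<in>ucols. (case k of Inl u \<Rightarrow> 0 | Inr z \<Rightarrow> c k) * ucol k (e, j) b)"
        by (rule sum.cong) (auto simp: w'_def split: sum.splits)
      then show ?thesis unfolding sum_ucols[OF that] by (simp add: delta_const)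
    qed
    have key: "(\<Sum>i\<in>UNIV. delta (\<lambda>u. b (u, i)) e * delta (\<lambda>u. c (Inr (i, j, u))) e)
      = (\<Sum>i\<in>UNIV. delta (\<lambda>u. a (u, i)) e * delta (\<lambda>u. d (Inr (i, j, u))) e) - delta (\<lambda>u. d (Inl u)) e * delta (ind j) e"
      if "e \<in> E" "j \<in> V" for e j
      using d[OF that] lhs[OF that] sum_ucols[OF that, of d a] by simp
    define D where "D i w = (\<Sum>j\<in>V. g j * d (Inr (i, j, w)))" for i w
    have "(\<Sum>i\<in>UNIV. delta (\<lambda>u. a (u, i)) e * delta (D i) e) + - 1 * (delta g e * delta (\<lambda>u. d (Inl u)) e)
      = (\<Sum>i\<in>UNIV. delta (\<lambda>u. b (u, i)) e * delta (h i) e)" if e: "e \<in> E" for e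
    proof -
      have "(\<Sum>i\<in>UNIV. delta (\<lambda>u. b (u, i)) e * delta (h i) e)
        = (\<Sum>j\<in>V. g j * (\<Sum>i\<in>UNIV. delta (\<lambda>u. b (u, i)) e * delta (\<lambda>u. c (Inr (i, j, u))) e))"
        unfolding h_def delta_sum delta_scale sum_distrib_left by (subst sum.swap) (simp add: mult_ac)
      also have "\<dots> = (\<Sum>j\<in>V. g j * (\<Sum>i\<in>UNIV. delta (\<lambda>u. a (u, i)) e * delta (\<lambda>u. d (Inr (i, j, u))) e)
          - delta (\<lambda>u. d (Inl u)) e * (g j * delta (ind j) e))"
        by (intro sum.cong) (simp_all add: key[OF e] right_diff_distrib mult_ac)
      also have "\<dots> = (\<Sum>j\<in>V. g j * (\<Sum>i\<in>UNIV. delta (\<lambda>u. a (u, i)) e * delta (\<lambda>u. d (Inr (i, j, u))) e))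
          - delta (\<lambda>u. d (Inl u)) e * delta g e"
        unfolding sum_subtractf delta_ind[OF e, of g, symmetric] sum_distrib_left ..
      also have "(\<Sum>j\<in>V. g j * (\<Sum>i\<in>UNIV. delta (\<lambda>u. a (u, i)) e * delta (\<lambda>u. d (Inr (i, j, u))) e))
        = (\<Sum>i\<in>UNIV. delta (\<lambda>u. a (u, i)) e * delta (D i) e)"
        unfolding D_def delta_sum delta_scale sum_distrib_left by (subst sum.swap) (simp add: mult_ac)
      finally show ?thesis by simp
    qed
    moreover have "tang a (\<lambda>e. (\<Sum>i\<in>UNIV. delta (\<lambda>u. a (u, i)) e * delta (D i) e) + - 1 * (delta g e * delta (\<lambda>u. d (Inl u)) e))"
      by (intro tang_add tang_basic tang_scale stress_kernelD g)
    ultimately show ?thesis by (rule tang_cong)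
  qed
  have "h i \<in> stress_kernel a" for i
    unfolding stress_kernel_def
  proof (intro CollectI allI)
    fix k
    \<comment> \<open>A direction \<open>b\<close> with \<open>k\<close> as its only nonzero
      coordinate function isolates \<open>h i\<close>.\<close>
    have "tang a (\<lambda>e. \<Sum>j\<in>UNIV. delta (\<lambda>u. if j = i then k u else 0) e * delta (h j) e)"
      using var[of "\<lambda>(u, j). if j = i then k u else 0"] by simp
    moreover have "(\<Sum>j\<in>UNIV. delta (\<lambda>u. if j = i then k u else 0) e * delta (h j) e)
      = (\<Sum>j\<in>UNIV. if j = i then delta k e * delta (h j) e else 0)" for e
      by (rule sum.cong) (auto simp: delta_const)
    ultimately show "tang a (\<lambda>e. delta (h i) e * delta k e)" by (simp add: mult.commute)
  qed
  then show ?thesis using that eq by blast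
qed

text \<open>For \<open>d + 1\<close> vertices \<open>B\<close> of a generic framework this says that
  every kernel element is an affine function of the coordinates, since affine functions take
  arbitrary values on \<open>B\<close>. In this form the condition concerns linear relations between
  the columns \<open>ucol\<close>, to which genericity applies.\<close>

definition determined_on :: "'v set \<Rightarrow> ('v \<times> 'd::finite \<Rightarrow> real) \<Rightarrow> bool" where
  "determined_on B a \<longleftrightarrow> (\<forall>f\<in>stress_kernel a. (\<forall>u\<in>B. f u = 0) \<longrightarrow> (\<forall>u\<in>V. f u = 0))"

text \<open>A kernel element that vanishes on \<open>B\<close> but not at \<open>u0\<close>
  expresses column \<open>Inl u0\<close> by columns that avoid \<open>B\<close>. Such relations
  transfer between generic points.\<close>

lemma determined_on_generic:
  fixes a a' :: "'v \<times> 'd::finite \<Rightarrow> real"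
  assumes gen: "generic_point (V \<times> UNIV) a" "generic_point (V \<times> UNIV) a'" and det: "determined_on B a"
  shows "determined_on B a'"
proof (rule ccontr)
  assume "\<not> determined_on B a'"
  then obtain f u0 where f: "f \<in> stress_kernel a'" "\<And>u. u \<in> B \<Longrightarrow> f u = 0" and u0: "u0 \<in> V" "f u0 \<noteq> 0"
    unfolding determined_on_def by blast
  obtain c where c: "\<And>u. c (Inl u) = f u"
    "\<And>e j. e \<in> E \<Longrightarrow> j \<in> V \<Longrightarrow> (\<Sum>k\<in>ucols. c k * ucol k (e, j) a') = 0"
    using kernel_of_stress_kernel[OF f(1)] by blast
  define J where "J = (ucols :: ('v + 'd \<times> 'v \<times> 'v) set) - Inl ` B - {Inl u0}"
  have finJ: "finite J" unfolding J_def by (intro finite_Diff finite_ucols)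
  have "comb_on J (E \<times> V) (\<lambda>k ej. ucol k ej a') (\<lambda>ej. ucol (Inl u0) ej a')"
    unfolding comb_on_def
  proof (intro exI[of _ "\<lambda>k. - c k / f u0"] ballI)
    fix ej assume "ej \<in> E \<times> V"
    then have "(\<Sum>k\<in>ucols. c k * ucol k ej a') = 0" using c by auto
    moreover have "(\<Sum>k\<in>ucols. c k * ucol k ej a') = f u0 * ucol (Inl u0) ej a' + (\<Sum>k\<in>ucols - {Inl u0}. c k * ucol k ej a')"
      using finite_ucols u0 c(1) by (subst sum.remove[of _ "Inl u0"]) auto
    moreover have "(\<Sum>k\<in>ucols - {Inl u0}. c k * ucol k ej a') = (\<Sum>k\<in>J. c k * ucol k ej a')"
      by (rule sum.mono_neutral_right) (use finite_ucols c(1) f(2) in \<open>auto simp: J_def\<close>)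
    ultimately have "f u0 * ucol (Inl u0) ej a' = - (\<Sum>k\<in>J. c k * ucol k ej a')" by linarith
    then have "ucol (Inl u0) ej a' = - (\<Sum>k\<in>J. c k * ucol k ej a') / f u0"
      using u0(2) by (metis nonzero_mult_div_cancel_left)
    then show "ucol (Inl u0) ej a' = (\<Sum>k\<in>J. - c k / f u0 * ucol k ej a')"
      by (simp add: sum_negf sum_divide_distrib)
  qed
  then have "comb_on J (E \<times> V) (\<lambda>k ej. ucol k ej a) (\<lambda>ej. ucol (Inl u0) ej a)"
    by (intro generic_comb_on[where w = ucol and a = a', OF finite_ucols _ _ ucol_rat_poly gen(2,1)])
      (use u0 in \<open>auto simp: J_def\<close>)
  then obtain d where d: "\<And>ej. ej \<in> E \<times> V \<Longrightarrow> ucol (Inl u0) ej a = (\<Sum>k\<in>J. d k * ucol k ej a)"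
    unfolding comb_on_def by blast
  define c' where "c' k = (if k = Inl u0 then 1 else if k \<in> J then - d k else 0)" for k
  have "(\<Sum>k\<in>ucols. c' k * ucol k (e, j) a) = 0" if "e \<in> E" "j \<in> V" for e j
  proof -
    have "(\<Sum>k\<in>ucols. c' k * ucol k (e, j) a) = ucol (Inl u0) (e, j) a + (\<Sum>k\<in>ucols - {Inl u0}. c' k * ucol k (e, j) a)"
      using finite_ucols u0 by (subst sum.remove[of _ "Inl u0"]) (auto simp: c'_def)
    also have "(\<Sum>k\<in>ucols - {Inl u0}. c' k * ucol k (e, j) a) = (\<Sum>k\<in>J. - (d k * ucol k (e, j) a))"
      by (rule sum.mono_neutral_cong_right) (use finite_ucols in \<open>auto simp: J_def c'_def\<close>)
    finally show ?thesis using d[of "(e, j)"] that by (simp add: sum_negf)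
  qed
  then have "(\<lambda>u. c' (Inl u)) \<in> stress_kernel a" by (rule stress_kernel_of_kernel)
  moreover have "\<forall>u\<in>B. c' (Inl u) = 0" using f(2) u0(2) by (auto simp: c'_def J_def)
  ultimately have "c' (Inl u0) = 0"
    using det[unfolded determined_on_def, rule_format, of "\<lambda>u. c' (Inl u)" u0] u0(1) by simp
  then show False by (simp add: c'_def)
qed

end

subsection \<open>Derivations of the reals\<close>

text \<open>\<open>A\<close> is a subring of the reals. The values of \<open>D\<close> range over
  all reals, so that the derivatives of generic coordinates can be prescribed at will.\<close>

definition derivation_on :: "real set \<Rightarrow> (real \<Rightarrow> real) \<Rightarrow> bool" where
  "derivation_on A D \<longleftrightarrow> 1 \<in> A \<and> (\<forall>x\<in>A. \<forall>y\<in>A. x - y \<in> A \<and> x * y \<in> A \<and>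
     D (x + y) = D x + D y \<and> D (x * y) = D x * y + x * D y)"

lemma derivation_onD:
  assumes "derivation_on A D"
  shows "1 \<in> A" "0 \<in> A" "x \<in> A \<Longrightarrow> y \<in> A \<Longrightarrow> x - y \<in> A" "x \<in> A \<Longrightarrow> y \<in> A \<Longrightarrow> x * y \<in> A"
    "x \<in> A \<Longrightarrow> - x \<in> A" "x \<in> A \<Longrightarrow> y \<in> A \<Longrightarrow> x + y \<in> A"
    "x \<in> A \<Longrightarrow> y \<in> A \<Longrightarrow> D (x + y) = D x + D y"
    "x \<in> A \<Longrightarrow> y \<in> A \<Longrightarrow> D (x * y) = D x * y + x * D y" "D 0 = 0" "D 1 = 0"
    "x \<in> A \<Longrightarrow> D (- x) = - D x" "x \<in> A \<Longrightarrow> y \<in> A \<Longrightarrow> D (x - y) = D x - D y"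
proof -
  note d = assms[unfolded derivation_on_def]
  show 1: "1 \<in> A" and sub: "\<And>x y. x \<in> A \<Longrightarrow> y \<in> A \<Longrightarrow> x - y \<in> A"
    and "x \<in> A \<Longrightarrow> y \<in> A \<Longrightarrow> x * y \<in> A"
    and add: "\<And>x y. x \<in> A \<Longrightarrow> y \<in> A \<Longrightarrow> D (x + y) = D x + D y"
    and mult: "\<And>x y. x \<in> A \<Longrightarrow> y \<in> A \<Longrightarrow> D (x * y) = D x * y + x * D y"
    using d by blast+
  show 0: "0 \<in> A" using sub[OF 1 1] by simp
  show neg: "- x \<in> A" if "x \<in> A" for x using sub[OF 0 that] by simp
  show "x + y \<in> A" if "x \<in> A" "y \<in> A" for x y using sub[OF that(1) neg[OF that(2)]] by simp
  show D0: "D 0 = 0" using add[OF 0 0] by simp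
  show "D 1 = 0" using mult[OF 1 1] by simp
  show Dneg: "D (- x) = - D x" if "x \<in> A" for x using add[OF that neg[OF that]] D0 by simp
  show "D (x - y) = D x - D y" if "x \<in> A" "y \<in> A" for x y
    using add[OF that(1) neg[OF that(2)]] Dneg[OF that(2)] by simp
qed

lemma derivation_on_sum:
  assumes "derivation_on A D" "\<And>k. k \<in> K \<Longrightarrow> f k \<in> A"
  shows "(\<Sum>k\<in>K. f k) \<in> A \<and> D (\<Sum>k\<in>K. f k) = (\<Sum>k\<in>K. D (f k))"
  using assms(2) by (induction K rule: infinite_finite_induct) (auto simp: derivation_onD[OF assms(1)])

text \<open>The quotient rule in the form \<open>(D x - z * D y) / y\<close> for
  \<open>z = x / y\<close>. It is independent of the representation by differentiating
  \<open>x * y' = x' * y\<close>.\<close>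

lemma derivation_extend_fractions:
  assumes der: "derivation_on A D"
  obtains F D' where "derivation_on F D'" "A \<subseteq> F" "\<And>x. x \<in> A \<Longrightarrow> D' x = D x"
    "\<And>x. x \<in> F \<Longrightarrow> inverse x \<in> F"
proof -
  note A = derivation_onD[OF der]
  define F where "F = {x / y | x y. x \<in> A \<and> y \<in> A \<and> y \<noteq> 0}"
  define quot where "quot z x y \<longleftrightarrow> x \<in> A \<and> y \<in> A \<and> y \<noteq> 0 \<and> z = x / y" for z x y
  define D' where "D' z = (SOME d. \<exists>x y. quot z x y \<and> d = (D x - z * D y) / y)" for z
  have D'_eq: "D' z = (D x - z * D y) / y" if q: "quot z x y" for z x y
    unfolding D'_def
  proof (rule some_equality)
    fix d assume "\<exists>x y. quot z x y \<and> d = (D x - z * D y) / y"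
    then obtain x' y' where q': "quot z x' y'" "d = (D x' - z * D y') / y'" by blast
    have "x = z * y" using q by (auto simp: quot_def)
    moreover have "x' = z * y'" using q'(1) by (auto simp: quot_def)
    ultimately have eqs: "x = z * y" "x' = z * y'" by blast+
    have mem: "x \<in> A" "y \<in> A" "x' \<in> A" "y' \<in> A" "y \<noteq> 0" "y' \<noteq> 0" using q q'(1) by (auto simp: quot_def)
    have "x * y' = x' * y" using eqs by simp
    then have "D x * y' + x * D y' = D x' * y + x' * D y" using A(8)[OF mem(1,4)] A(8)[OF mem(3,2)] by simp
    then have "(D x - z * D y) * y' = (D x' - z * D y') * y" using eqs by (simp add: algebra_simps)
    then show "d = (D x - z * D y) / y" unfolding q'(2) using mem by (simp add: frac_eq_eq)
  qed (use q in blast)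
  have mult: "x * y \<in> F \<and> D' (x * y) = D' x * y + x * D' y"
    and sub: "x - y \<in> F" and add: "D' (x + y) = D' x + D' y" if "x \<in> F" "y \<in> F" for x y
  proof -
    have "\<exists>a b. quot x a b" "\<exists>c d. quot y c d" using that by (auto simp: F_def quot_def)
    then obtain a b c d where q: "quot x a b" "quot y c d" by blast
    then have m: "a \<in> A" "b \<in> A" "c \<in> A" "d \<in> A" "b \<noteq> 0" "d \<noteq> 0" "a = x * b" "c = y * d"
      by (auto simp: quot_def)
    have q1: "quot (x * y) (a * c) (b * d)" using m by (auto simp: quot_def A)
    have "a * d - c * b \<in> A" "a * d + c * b \<in> A" "b * d \<in> A" using m(1-4) by (auto intro!: A(3,4,6))
    moreover have "x - y = (a * d - c * b) / (b * d)" "x + y = (a * d + c * b) / (b * d)"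
      using m(5-8) by (simp_all add: field_simps)
    ultimately have q2: "quot (x - y) (a * d - c * b) (b * d)" and q3: "quot (x + y) (a * d + c * b) (b * d)"
      using m(5,6) unfolding quot_def by auto
    have Dx: "D' x * b = D a - x * D b" "D' y * d = D c - y * D d" using D'_eq[OF q(1)] D'_eq[OF q(2)] m by auto
    have "D' (x * y) * (b * d) = D (a * c) - x * y * D (b * d)" using D'_eq[OF q1] m by simp
    also have "\<dots> = D a * c + a * D c - x * y * (D b * d + b * D d)" using m(1-4) by (simp add: A(8))
    also have "x * y * (D b * d + b * D d) = x * D b * c + a * (y * D d)" unfolding m(7,8) by (simp add: algebra_simps)
    also have "D a * c + a * D c - (x * D b * c + a * (y * D d)) = (D' x * b) * c + a * (D' y * d)"
      unfolding Dx by (simp add: algebra_simps)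
    also have "\<dots> = (D' x * y + x * D' y) * (b * d)" using m by (simp add: algebra_simps)
    finally have "D' (x * y) = D' x * y + x * D' y" using m by simp
    moreover have F_quot: "z \<in> F" if "quot z e f" for z e f using that unfolding F_def quot_def by blast
    ultimately show "x * y \<in> F \<and> D' (x * y) = D' x * y + x * D' y" using q1 by blast
    show "x - y \<in> F" using F_quot[OF q2] .
    have "D' (x + y) * (b * d) = D (a * d + c * b) - (x + y) * D (b * d)" using D'_eq[OF q3] m by simp
    also have "\<dots> = (D a * d + a * D d) + (D c * b + c * D b) - (x + y) * (D b * d + b * D d)"
      using m(1-4) by (simp add: A(4,7,8))
    also have "(x + y) * (D b * d + b * D d) = x * D b * d + a * D d + c * D b + y * D d * b"
      unfolding m(7,8) by (simp add: algebra_simps)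
    also have "(D a * d + a * D d) + (D c * b + c * D b) - \<dots> = (D' x * b) * d + (D' y * d) * b"
      unfolding Dx by (simp add: algebra_simps)
    also have "\<dots> = (D' x + D' y) * (b * d)" by (simp add: algebra_simps)
    finally show "D' (x + y) = D' x + D' y" using m by simp
  qed
  show ?thesis
  proof (rule that[of F D'])
    have "1 \<in> F" using A(1) by (auto simp: F_def intro!: exI[of _ 1])
    then show "derivation_on F D'" unfolding derivation_on_def using mult sub add by blast
    show "A \<subseteq> F"
    proof
      fix x assume "x \<in> A"
      then show "x \<in> F" using A(1) unfolding F_def by (intro CollectI exI[of _ x] exI[of _ 1]) simp
    qed
    show "D' x = D x" if "x \<in> A" for x using D'_eq[of x x 1] that A by (simp add: quot_def)
    show "inverse x \<in> F" if "x \<in> F" for x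
    proof (cases "x = 0")
      case False
      obtain a b where "a \<in> A" "b \<in> A" "b \<noteq> 0" "x = a / b" using \<open>x \<in> F\<close> by (auto simp: F_def)
      then show ?thesis using False unfolding F_def by (intro CollectI exI[of _ b] exI[of _ a]) auto
    qed (use that in simp)
  qed
qed

text \<open>If \<open>a\<close> is transcendental over the field \<open>F\<close>, its derivative
  can be any number, here 0. If \<open>a\<close> is algebraic, differentiating the equation of its
  minimal polynomial \<open>m\<close> determines the value; the division is possible since
  \<open>pderiv m\<close> is nonzero of smaller degree and so does not vanish at
  \<open>a\<close>.\<close>

lemma derivation_extend_element:
  assumes der: "derivation_on F D" and inv: "\<And>x. x \<in> F \<Longrightarrow> inverse x \<in> F"
  obtains A D' where "derivation_on A D'" "F \<subseteq> A" "a \<in> A" "\<And>x. x \<in> F \<Longrightarrow> D' x = D x"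
proof -
  note F = derivation_onD[OF der]
  define PF where "PF = {p :: real poly. \<forall>i. coeff p i \<in> F}"
  have sumF: "(\<Sum>k\<in>K. f k) \<in> F" "D (\<Sum>k\<in>K. f k) = (\<Sum>k\<in>K. D (f k))"
    if "\<And>k. k \<in> K \<Longrightarrow> f k \<in> F" for K :: "nat set" and f
    using derivation_on_sum[OF der, of K f] that by blast+
  have natF: "of_nat n \<in> F" for n by (induction n) (auto simp: F)
  have PF: "p \<in> PF \<Longrightarrow> q \<in> PF \<Longrightarrow> p + q \<in> PF" "p \<in> PF \<Longrightarrow> q \<in> PF \<Longrightarrow> p - q \<in> PF"
    "p \<in> PF \<Longrightarrow> q \<in> PF \<Longrightarrow> p * q \<in> PF" "p \<in> PF \<Longrightarrow> pderiv p \<in> PF"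
    "c \<in> F \<Longrightarrow> monom c k \<in> PF" for p q c k
    unfolding PF_def by (auto simp: F coeff_mult coeff_pderiv natF[of "Suc _", simplified] natF intro!: sumF)
  have coeff_PF: "coeff p i \<in> F" if "p \<in> PF" for p i using that by (simp add: PF_def)
  define pD where "pD p = map_poly D p" for p
  have coeff_pD: "coeff (pD p) i = D (coeff p i)" for p i unfolding pD_def by (simp add: coeff_map_poly F)
  have pD_add: "pD (p + q) = pD p + pD q" if "p \<in> PF" "q \<in> PF" for p q
    by (rule poly_eqI) (simp add: coeff_pD F coeff_PF that)
  have pD_mult: "pD (p * q) = pD p * q + p * pD q" if "p \<in> PF" "q \<in> PF" for p q
  proof (rule poly_eqI)
    fix n
    have "coeff (pD (p * q)) n = (\<Sum>i\<le>n. D (coeff p i * coeff q (n - i)))"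
      unfolding coeff_pD coeff_mult by (rule sumF(2)) (simp add: F coeff_PF that)
    also have "\<dots> = coeff (pD p * q + p * pD q) n"
      by (simp add: F coeff_PF that coeff_mult coeff_pD sum.distrib)
    finally show "coeff (pD (p * q)) n = coeff (pD p * q + p * pD q) n" .
  qed
  \<comment> \<open>By the chain rule this is the derivative of \<open>poly p a\<close> if that of
    \<open>a\<close> is \<open>b\<close>; \<open>pD\<close> differentiates the coefficients.\<close>
  define T where "T b p = poly (pD p) a + poly (pderiv p) a * b" for b p
  have T_add: "T b (p + q) = T b p + T b q" if "p \<in> PF" "q \<in> PF" for b p q
    by (simp add: T_def pD_add that pderiv_add algebra_simps)
  have T_mult: "T b (p * q) = T b p * poly q a + poly p a * T b q" if "p \<in> PF" "q \<in> PF" for b p q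
    by (simp add: T_def pD_mult that pderiv_mult algebra_simps)
  obtain b where b: "\<And>p. p \<in> PF \<Longrightarrow> poly p a = 0 \<Longrightarrow> T b p = 0"
  proof (cases "\<exists>p\<in>PF. p \<noteq> 0 \<and> poly p a = 0")
    case False
    have "T 0 p = 0" if "p \<in> PF" "poly p a = 0" for p
    proof -
      have "p = 0" using False that by blast
      then show ?thesis by (simp add: T_def pD_def)
    qed
    then show ?thesis using that by blast
  next
    case True
    define ok where "ok p \<longleftrightarrow> p \<in> PF \<and> p \<noteq> 0 \<and> poly p a = 0" for p
    have "\<exists>p. ok p" using True by (auto simp: ok_def)
    from ex_has_least_nat[of ok _ degree] this
    obtain m where m: "ok m" "\<And>p. ok p \<Longrightarrow> degree m \<le> degree p" by blast
    have mF: "m \<in> PF" "m \<noteq> 0" "poly m a = 0" using m(1) by (auto simp: ok_def)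
    have "degree m \<noteq> 0"
    proof
      assume "degree m = 0"
      then obtain c where "m = [:c:]" by (rule degree_eq_zeroE)
      then show False using mF by simp
    qed
    then have "pderiv m \<noteq> 0" "degree (pderiv m) < degree m" by (auto simp: pderiv_eq_0_iff degree_pderiv)
    then have nz: "poly (pderiv m) a \<noteq> 0" using m(2)[of "pderiv m"] PF(4)[OF mF(1)] by (auto simp: ok_def)
    define b where "b = - poly (pD m) a / poly (pderiv m) a"
    have Tm: "T b m = 0" using nz by (simp add: T_def b_def)
    have "T b p = 0" if "p \<in> PF" "poly p a = 0" for p
      using that
    \<comment> \<open>Division by \<open>m\<close>, one leading term at a time. The measure places 0
      below the nonzero constants, which have degree 0 too.\<close>
    proof (induction "if p = 0 then 0 else Suc (degree p)" arbitrary: p rule: less_induct)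
      case less
      show ?case
      proof (cases "p = 0")
        case True then show ?thesis by (simp add: T_def pD_def)
      next
        case False
        then have deg: "degree m \<le> degree p" using m(2)[of p] less.prems by (simp add: ok_def)
        define s where "s = monom (lead_coeff p * inverse (lead_coeff m)) (degree p - degree m)"
        have sF: "s \<in> PF" unfolding s_def using less.prems mF coeff_PF by (intro PF F inv) auto
        define q where "q = p - s * m"
        have "s \<noteq> 0" using False mF by (simp add: s_def monom_eq_0_iff)
        have "degree s = degree p - degree m" unfolding s_def using False mF by (intro degree_monom_eq) simp
        then have degs: "degree (s * m) = degree p"
          using mF \<open>s \<noteq> 0\<close> deg by (simp add: degree_mult_eq)
        have "lead_coeff (s * m) = lead_coeff p"
        proof -
          have "lead_coeff s = lead_coeff p * inverse (lead_coeff m)" unfolding s_def by (rule lead_coeff_monom)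
          then show ?thesis unfolding lead_coeff_mult using mF by simp
        qed
        then have cancel: "coeff q (degree p) = 0" using degs by (simp add: q_def)
        have "degree q \<le> degree p" unfolding q_def using degs by (intro degree_diff_le) auto
        then have less_deg: "(if q = 0 then 0 else Suc (degree q)) < (if p = 0 then 0 else Suc (degree p))"
          using False cancel leading_coeff_0_iff[of q] by (cases "degree q = degree p") (auto simp: le_less)
        have qF: "q \<in> PF" "poly q a = 0" using PF sF mF less.prems by (auto simp: q_def)
        have "T b q = 0" by (rule less.hyps[OF less_deg qF])
        moreover have "T b (s * m) = 0" using T_mult[OF sF mF(1)] Tm mF(3) by simp
        moreover have "p = q + s * m" by (simp add: q_def)
        ultimately show ?thesis using T_add[OF qF(1) PF(3)[OF sF mF(1)]] by simp
      qed
    qed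
    then show ?thesis using that by blast
  qed
  define A where "A = (\<lambda>p. poly p a) ` PF"
  define D' where "D' z = T b (SOME p. p \<in> PF \<and> poly p a = z)" for z
  have D'_eq: "D' (poly p a) = T b p" if p: "p \<in> PF" for p
  proof -
    define q where "q = (SOME q. q \<in> PF \<and> poly q a = poly p a)"
    have "q \<in> PF \<and> poly q a = poly p a" unfolding q_def by (rule someI[of _ p]) (use p in simp)
    then have "T b (p - q) = 0" "p - q \<in> PF" "q \<in> PF" using b PF p by auto
    then show ?thesis unfolding D'_def q_def[symmetric] using T_add[of "p - q" q b] by simp
  qed
  have constF: "[:c:] \<in> PF" if "c \<in> F" for c using PF(5)[OF that, of 0] by (simp add: monom_0)
  show ?thesis
  proof (rule that[of A D'])
    show "derivation_on A D'" unfolding derivation_on_def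
    proof (intro conjI ballI)
      show "1 \<in> A" unfolding A_def using constF[OF F(1)] by (rule image_eqI[rotated]) simp
      fix x y assume "x \<in> A" "y \<in> A"
      then obtain p q where pq: "x = poly p a" "y = poly q a" "p \<in> PF" "q \<in> PF" by (auto simp: A_def)
      show "x - y \<in> A" unfolding A_def pq using PF(2)[OF pq(3,4)] by (rule image_eqI[rotated]) simp
      show "x * y \<in> A" unfolding A_def pq using PF(3)[OF pq(3,4)] by (rule image_eqI[rotated]) simp
      show "D' (x + y) = D' x + D' y" "D' (x * y) = D' x * y + x * D' y"
        using D'_eq[OF PF(1)[OF pq(3,4)]] D'_eq[OF PF(3)[OF pq(3,4)]] D'_eq[OF pq(3)] D'_eq[OF pq(4)]
        by (simp_all add: pq(1,2) T_add T_mult pq(3,4))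
    qed
    show "F \<subseteq> A"
    proof
      fix c assume "c \<in> F"
      then show "c \<in> A" unfolding A_def using constF by (intro image_eqI[of _ _ "[:c:]"]) auto
    qed
    have "[:0, 1:] \<in> PF" using PF(5)[OF F(1), of 1] by (simp add: monom_Suc monom_0 One_nat_def)
    then show "a \<in> A" unfolding A_def by (rule image_eqI[rotated]) simp
    show "D' x = D x" if "x \<in> F" for x
      using D'_eq[OF constF[OF that]] by (simp add: T_def pD_def map_poly_pCons F)
  qed
qed

lemma derivation_extend_finite:
  assumes "finite C" "derivation_on A D"
  obtains A' D' where "derivation_on A' D'" "A \<subseteq> A'" "C \<subseteq> A'" "\<And>x. x \<in> A \<Longrightarrow> D' x = D x"
proof -
  have "\<exists>A' D'. derivation_on A' D' \<and> A \<subseteq> A' \<and> C \<subseteq> A' \<and> (\<forall>x\<in>A. D' x = D x)"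
    using assms
  proof (induction C rule: finite_induct)
    case empty
    then show ?case by blast
  next
    case (insert c C)
    then obtain A1 D1 where 1: "derivation_on A1 D1" "A \<subseteq> A1" "C \<subseteq> A1" "\<forall>x\<in>A. D1 x = D x" by blast
    from derivation_extend_fractions[OF 1(1)] obtain F D2
      where 2: "derivation_on F D2" "A1 \<subseteq> F" "\<And>x. x \<in> A1 \<Longrightarrow> D2 x = D1 x" "\<And>x. x \<in> F \<Longrightarrow> inverse x \<in> F" by blast
    from derivation_extend_element[OF 2(1,4), of c] obtain A3 D3
      where 3: "derivation_on A3 D3" "F \<subseteq> A3" "c \<in> A3" "\<And>x. x \<in> F \<Longrightarrow> D3 x = D2 x" by blast
    show ?case
    proof (intro exI[of _ A3] exI[of _ D3] conjI ballI)
      fix x assume "x \<in> A"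
      then have "x \<in> A1" "x \<in> F" "D1 x = D x" using 1(2,4) 2(2) by blast+
      then show "D3 x = D x" using 2(3) 3(4) by simp
    qed (use 1 2(2) 3 in auto)
  qed
  then show ?thesis using that by blast
qed

lemma rat_poly_on_line:
  assumes "q \<in> rat_poly_on X"
  obtains P where "\<And>t. q (\<lambda>x. a x + t * b x) = poly P t"
proof -
  obtain p where p: "\<And>a. q a = mpoly_eval p a" using assms unfolding rat_poly_on_def by blast
  show ?thesis
    by (rule that[of "\<Sum>m\<in>Poly_Mapping.keys p. smult (of_rat (Poly_Mapping.lookup p m))
        (\<Prod>x\<in>Poly_Mapping.keys m. [:a x, b x:] ^ Poly_Mapping.lookup m x)"])
      (simp add: p mpoly_eval_def poly_sum poly_prod poly_power)
qed

text \<open>The derivation is the directional derivative, well defined since a rational polynomial is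
  determined by its value at a generic point.\<close>

lemma generic_derivation:
  assumes gen: "generic_point X a" and fin: "finite C"
  obtains A D where "derivation_on A D" "C \<subseteq> A" "\<And>x. x \<in> X \<Longrightarrow> a x \<in> A \<and> D (a x) = b x"
proof -
  define A where "A = (\<lambda>q. q a) ` rat_poly_on X"
  define dd where "dd q = deriv (\<lambda>t. q (\<lambda>x. a x + t * b x)) 0" for q :: "('a \<Rightarrow> real) \<Rightarrow> real"
  define D where "D z = dd (SOME q. q \<in> rat_poly_on X \<and> q a = z)" for z
  have differentiable: "(\<lambda>t. q (\<lambda>x. a x + t * b x)) field_differentiable at 0" if q: "q \<in> rat_poly_on X" for q
  proof -
    obtain P where "\<And>t. q (\<lambda>x. a x + t * b x) = poly P t" using rat_poly_on_line[OF q] by blast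
    then have "(\<lambda>t. q (\<lambda>x. a x + t * b x)) = poly P" by blast
    then show ?thesis using poly_DERIV[of P 0] unfolding field_differentiable_def by metis
  qed
  have D_eq: "D (q a) = dd q" if q: "q \<in> rat_poly_on X" for q
  proof -
    define q' where "q' = (SOME q'. q' \<in> rat_poly_on X \<and> q' a = q a)"
    have q': "q' \<in> rat_poly_on X" "q' a = q a" unfolding q'_def
      using someI[of "\<lambda>q'. q' \<in> rat_poly_on X \<and> q' a = q a" q] q by auto
    have "q' a0 = q a0" for a0
    proof (rule ccontr)
      assume "q' a0 \<noteq> q a0"
      then have "q' a - q a \<noteq> 0" using gen rat_poly_on_diff[OF q'(1) q] unfolding generic_point_def by force
      then show False using q'(2) by simp
    qed
    then have "q' = q" by blast
    then show ?thesis unfolding D_def q'_def[symmetric] by simp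
  qed
  have der: "derivation_on A D" unfolding derivation_on_def
  proof (intro conjI ballI)
    show "1 \<in> A" unfolding A_def using rat_poly_on_1 by (rule image_eqI[rotated]) simp
    fix x y assume "x \<in> A" "y \<in> A"
    then obtain p q where pq: "x = p a" "y = q a" "p \<in> rat_poly_on X" "q \<in> rat_poly_on X" by (auto simp: A_def)
    note ops = rat_poly_on_add[OF pq(3,4)] rat_poly_on_diff[OF pq(3,4)] rat_poly_on_mult[OF pq(3,4)]
    show "x - y \<in> A" unfolding A_def pq using ops(2) by (rule image_eqI[rotated]) simp
    show "x * y \<in> A" unfolding A_def pq using ops(3) by (rule image_eqI[rotated]) simp
    note dp = differentiable[OF pq(3)] and dq = differentiable[OF pq(4)]
    show "D (x + y) = D x + D y"
      using D_eq[OF ops(1)] D_eq[OF pq(3)] D_eq[OF pq(4)] deriv_add[OF dp dq] by (simp add: pq dd_def)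
    show "D (x * y) = D x * y + x * D y"
      using D_eq[OF ops(3)] D_eq[OF pq(3)] D_eq[OF pq(4)] deriv_mult[OF dp dq] by (simp add: pq dd_def)
  qed
  have var: "a x \<in> A \<and> D (a x) = b x" if "x \<in> X" for x
  proof
    have v: "(\<lambda>a. a x) \<in> rat_poly_on X" using that by (rule rat_poly_on_var)
    show "a x \<in> A" unfolding A_def using v by (rule image_eqI[rotated]) simp
    have "((\<lambda>t. a x + t * b x) has_real_derivative b x) (at 0)" by (auto intro!: derivative_eq_intros)
    then show "D (a x) = b x" using D_eq[OF v] by (simp add: dd_def DERIV_imp_deriv)
  qed
  obtain A' D' where ext: "derivation_on A' D'" "A \<subseteq> A'" "C \<subseteq> A'" "\<And>x. x \<in> A \<Longrightarrow> D' x = D x"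
    using derivation_extend_finite[OF fin der] by blast
  show ?thesis by (rule that[OF ext(1,3)]) (use var ext in auto)
qed

subsection \<open>Separation, Gram matrices and congruence\<close>

text \<open>Induction on the generators. \<open>\<alpha>\<close> and \<open>\<beta>\<close>
  annihilate \<open>w j\<close> for \<open>j \<in> J\<close>; subtracting a multiple of
  \<open>\<alpha>\<close> from \<open>\<beta>\<close> annihilates \<open>w k\<close> as well, and
  \<open>y'\<close> is corrected such that the value at \<open>y\<close> is then that of
  \<open>\<beta>\<close> at \<open>y'\<close>.\<close>

lemma separating_functional:
  assumes "finite J" "finite S" "\<not> comb_on J S w y"
  obtains \<alpha> where "\<And>j. j \<in> J \<Longrightarrow> (\<Sum>s\<in>S. \<alpha> s * w j s) = 0" "(\<Sum>s\<in>S. \<alpha> s * y s) \<noteq> 0"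
proof -
  have "\<exists>\<alpha>. (\<forall>j\<in>J. (\<Sum>s\<in>S. \<alpha> s * w j s) = 0) \<and> (\<Sum>s\<in>S. \<alpha> s * y s) \<noteq> 0"
    using assms(1,3)
  proof (induction J arbitrary: y rule: finite_induct)
    case empty
    then obtain s0 where s0: "s0 \<in> S" "y s0 \<noteq> 0" by (auto simp: comb_on_def)
    have "(\<Sum>s\<in>S. (if s = s0 then 1 else 0) * y s) = (\<Sum>s\<in>S. if s = s0 then y s else 0)"
      by (rule sum.cong) auto
    also have "\<dots> = y s0" using assms(2) s0 by simp
    finally show ?case using s0 by (intro exI[of _ "\<lambda>s. if s = s0 then 1 else 0"]) simp
  next
    case (insert k J)
    have fin: "finite (insert k J)" using insert by simp
    have "\<not> comb_on J S w y" using insert.prems comb_on_mono[OF _ subset_insertI fin] by blast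
    from insert.IH[OF this] obtain \<alpha> where \<alpha>: "\<forall>j\<in>J. (\<Sum>s\<in>S. \<alpha> s * w j s) = 0" "(\<Sum>s\<in>S. \<alpha> s * y s) \<noteq> 0"
      by blast
    define ak where "ak = (\<Sum>s\<in>S. \<alpha> s * w k s)"
    define ay where "ay = (\<Sum>s\<in>S. \<alpha> s * y s)"
    show ?case
    proof (cases "ak = 0")
      case True then show ?thesis using \<alpha> unfolding ak_def by blast
    next
      case False
      define y' where "y' s = y s - ay / ak * w k s" for s
      have "\<not> comb_on J S w y'"
      proof
        assume "comb_on J S w y'"
        then have "comb_on (insert k J) S w (\<lambda>s. y' s + ay / ak * w k s)"
          by (intro comb_on_add comb_on_scale comb_on_member[OF fin] comb_on_mono[OF _ subset_insertI fin]) auto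
        then show False using insert.prems by (simp add: y'_def)
      qed
      from insert.IH[OF this] obtain \<beta> where \<beta>: "\<forall>j\<in>J. (\<Sum>s\<in>S. \<beta> s * w j s) = 0" "(\<Sum>s\<in>S. \<beta> s * y' s) \<noteq> 0"
        by blast
      define bk where "bk = (\<Sum>s\<in>S. \<beta> s * w k s)"
      have lin: "(\<Sum>s\<in>S. (\<beta> s - bk / ak * \<alpha> s) * f s) = (\<Sum>s\<in>S. \<beta> s * f s) - bk / ak * (\<Sum>s\<in>S. \<alpha> s * f s)" for f
        by (simp add: left_diff_distrib sum_subtractf sum_distrib_left mult.assoc)
      show ?thesis
      proof (intro exI[of _ "\<lambda>s. \<beta> s - bk / ak * \<alpha> s"] conjI ballI)
        fix j assume "j \<in> insert k J"
        then show "(\<Sum>s\<in>S. (\<beta> s - bk / ak * \<alpha> s) * w j s) = 0"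
          unfolding lin using \<alpha>(1) \<beta>(1) False by (auto simp: ak_def[symmetric] bk_def[symmetric])
      next
        have "(\<Sum>s\<in>S. \<beta> s * y' s) = (\<Sum>s\<in>S. \<beta> s * y s) - ay / ak * bk"
          by (simp add: y'_def bk_def right_diff_distrib sum_subtractf sum_distrib_left mult_ac)
        then show "(\<Sum>s\<in>S. (\<beta> s - bk / ak * \<alpha> s) * y s) \<noteq> 0"
          unfolding lin ay_def[symmetric] using \<beta>(2) by (simp add: mult.commute)
      qed
    qed
  qed
  then show ?thesis using that by blast
qed

text \<open>By duality, an unsolvable system is refuted by a linear relation between the
  \<open>w j\<close>.\<close>

lemma indep_on_interpolation:
  assumes "finite J" "finite S" "indep_on J S w"
  obtains z where "\<And>j. j \<in> J \<Longrightarrow> (\<Sum>s\<in>S. z s * w j s) = f j"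
proof (cases "comb_on S J (\<lambda>s j. w j s) f")
  case True
  then show ?thesis using that unfolding comb_on_def by metis
next
  case False
  obtain \<alpha> where \<alpha>: "\<And>s. s \<in> S \<Longrightarrow> (\<Sum>j\<in>J. \<alpha> j * w j s) = 0" "(\<Sum>j\<in>J. \<alpha> j * f j) \<noteq> 0"
    by (rule separating_functional[OF assms(2,1) False]) (rule that)
  then have "\<forall>j\<in>J. \<alpha> j = 0" using assms(3) unfolding indep_on_def by blast
  then show ?thesis using \<alpha>(2) by simp
qed

text \<open>By completing the square (Cholesky factorisation).\<close>

lemma psd_gram:
  fixes A :: "'i \<Rightarrow> 'i \<Rightarrow> real"
  assumes "finite S" "\<And>i j. A i j = A j i"
    "\<And>x. (\<Sum>i\<in>S. \<Sum>j\<in>S. A i j * x i * x j) \<ge> 0"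
  shows "\<exists>r. \<forall>i\<in>S. \<forall>j\<in>S. A i j = (\<Sum>k\<in>S. r k i * r k j)"
  using assms
proof (induction S arbitrary: A rule: finite_induct)
  case (insert s S)
  have expand: "(\<Sum>i\<in>insert s S. \<Sum>j\<in>insert s S. A i j * x i * x j)
    = A s s * x s * x s + 2 * x s * (\<Sum>j\<in>S. A s j * x j) + (\<Sum>i\<in>S. \<Sum>j\<in>S. A i j * x i * x j)" for x
  proof -
    have "(\<Sum>i\<in>insert s S. \<Sum>j\<in>insert s S. A i j * x i * x j)
      = A s s * x s * x s + (\<Sum>j\<in>S. A s j * x s * x j) + ((\<Sum>i\<in>S. A i s * x i * x s) + (\<Sum>i\<in>S. \<Sum>j\<in>S. A i j * x i * x j))"
      using insert.hyps by (simp add: sum.distrib)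
    also have "(\<Sum>i\<in>S. A i s * x i * x s) = x s * (\<Sum>j\<in>S. A s j * x j)"
      unfolding sum_distrib_left by (rule sum.cong) (auto simp: insert.prems(1)[of _ s])
    also have "(\<Sum>j\<in>S. A s j * x s * x j) = x s * (\<Sum>j\<in>S. A s j * x j)"
      unfolding sum_distrib_left by (rule sum.cong) auto
    finally show ?thesis by simp
  qed
  have Ass: "A s s \<ge> 0"
    using insert.prems(2)[of "\<lambda>i. if i = s then 1 else 0"] insert.hyps(2) unfolding expand
    by (simp add: sum.neutral if_distrib cong: if_cong)
  define r where "r i = (if A s s = 0 then 0 else A s i / sqrt (A s s))" for i
  define A' where "A' i j = A i j - r i * r j" for i j
  have "(\<Sum>i\<in>S. \<Sum>j\<in>S. A' i j * x i * x j) \<ge> 0" for x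
  proof (cases "A s s = 0")
    case True
    have "(\<Sum>i\<in>S. \<Sum>j\<in>S. A i j * x i * x j) = (\<Sum>i\<in>insert s S. \<Sum>j\<in>insert s S. A i j * (x(s := 0)) i * (x(s := 0)) j)"
      unfolding expand using insert.hyps(2) by (auto intro!: sum.cong)
    then show ?thesis using insert.prems(2)[of "x(s := 0)"] True by (simp add: A'_def r_def)
  next
    case False
    then have pos: "A s s > 0" using Ass by simp
    have rr: "r i * r j = A s i * A s j / A s s" for i j
      using False pos by (simp add: r_def)
    define B where "B = (\<Sum>j\<in>S. A s j * x j)"
    \<comment> \<open>Coordinate \<open>s\<close> is chosen to minimise the quadratic form; the
      minimum is the form of \<open>A'\<close>.\<close>
    define x' where "x' = x(s := - B / A s s)"
    have "0 \<le> (\<Sum>i\<in>insert s S. \<Sum>j\<in>insert s S. A i j * x' i * x' j)" by (rule insert.prems(2))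
    also have "\<dots> = A s s * x' s * x' s + 2 * x' s * B + (\<Sum>i\<in>S. \<Sum>j\<in>S. A i j * x i * x j)"
    proof -
      have x': "x' j = x j" if "j \<in> S" for j using that insert.hyps(2) by (auto simp: x'_def)
      have "(\<Sum>j\<in>S. A s j * x' j) = B" unfolding B_def by (rule sum.cong) (auto simp: x')
      moreover have "(\<Sum>i\<in>S. \<Sum>j\<in>S. A i j * x' i * x' j) = (\<Sum>i\<in>S. \<Sum>j\<in>S. A i j * x i * x j)"
        by (intro sum.cong) (auto simp: x')
      ultimately show ?thesis unfolding expand by simp
    qed
    also have "A s s * x' s * x' s + 2 * x' s * B = - B * B / A s s" using pos by (simp add: x'_def field_simps)
    finally have "B * B / A s s \<le> (\<Sum>i\<in>S. \<Sum>j\<in>S. A i j * x i * x j)" by simp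
    moreover have "B * B = (\<Sum>i\<in>S. \<Sum>j\<in>S. A s i * A s j * x i * x j)"
      by (simp add: B_def sum_product mult_ac)
    ultimately have "0 \<le> (\<Sum>i\<in>S. \<Sum>j\<in>S. A i j * x i * x j) - (\<Sum>i\<in>S. \<Sum>j\<in>S. A s i * A s j * x i * x j) / A s s"
      by simp
    also have "\<dots> = (\<Sum>i\<in>S. \<Sum>j\<in>S. A' i j * x i * x j)"
      unfolding A'_def rr by (simp add: left_diff_distrib sum_subtractf sum_divide_distrib)
    finally show ?thesis .
  qed
  moreover have "A' i j = A' j i" for i j by (simp add: A'_def insert.prems(1)[of i j])
  ultimately obtain r' where r': "\<forall>i\<in>S. \<forall>j\<in>S. A' i j = (\<Sum>k\<in>S. r' k i * r' k j)"
    using insert.IH[of A'] by blast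
  define q where "q k i = (if k = s then r i else if i = s then 0 else r' k i)" for k i
  have Asj: "A s j = r s * r j" if "j \<in> insert s S" for j
  proof (cases "A s s = 0")
    case False then show ?thesis using Ass by (simp add: r_def)
  next
    case True
    have "A s j = 0"
    proof (rule ccontr)
      assume nz: "A s j \<noteq> 0"
      then have j: "j \<in> S" "j \<noteq> s" using that True by auto
      \<comment> \<open>Since \<open>A s s = 0\<close>, the form is affine in coordinate
        \<open>s\<close>, and this \<open>t\<close> would give it the value -1.\<close>
      define t where "t = - (A j j + 1) / (2 * A s j)"
      define x where "x = (\<lambda>i. if i = s then t else if i = j then 1 else 0 :: real)"
      have S1: "(\<Sum>i\<in>S. A s i * x i) = A s j"
      proof -
        have "(\<Sum>i\<in>S. A s i * x i) = (\<Sum>i\<in>S. if i = j then A s i else 0)"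
          by (rule sum.cong) (use insert.hyps(2) in \<open>auto simp: x_def\<close>)
        then show ?thesis using j insert.hyps(1) by simp
      qed
      have S2: "(\<Sum>i\<in>S. \<Sum>k\<in>S. A i k * x i * x k) = A j j"
      proof -
        have "(\<Sum>i\<in>S. \<Sum>k\<in>S. A i k * x i * x k) = (\<Sum>i\<in>S. if i = j then (\<Sum>k\<in>S. if k = j then A i k else 0) else 0)"
          by (intro sum.cong) (use insert.hyps(2) in \<open>auto simp: x_def intro!: sum.cong sum.neutral\<close>)
        then show ?thesis using j insert.hyps(1) by simp
      qed
      have "0 \<le> 2 * t * A s j + A j j" using insert.prems(2)[of x] unfolding expand S1 S2 True by (simp add: x_def)
      also have "2 * t * A s j = - (A j j + 1)" using nz by (simp add: t_def)
      finally show False by simp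
    qed
    then show ?thesis using True by (simp add: r_def)
  qed
  show ?case
  proof (intro exI[of _ q] ballI)
    fix i j assume ij: "i \<in> insert s S" "j \<in> insert s S"
    have "(\<Sum>k\<in>insert s S. q k i * q k j) = r i * r j + (\<Sum>k\<in>S. q k i * q k j)"
      using insert.hyps by (simp add: q_def)
    also have "(\<Sum>k\<in>S. q k i * q k j) = (if i = s \<or> j = s then 0 else (\<Sum>k\<in>S. r' k i * r' k j))"
      using insert.hyps(2) by (auto simp: q_def intro!: sum.cong sum.neutral)
    finally have sum: "(\<Sum>k\<in>insert s S. q k i * q k j)
      = r i * r j + (if i = s \<or> j = s then 0 else (\<Sum>k\<in>S. r' k i * r' k j))" .
    show "A i j = (\<Sum>k\<in>insert s S. q k i * q k j)"
    proof (cases "i = s \<or> j = s")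
      case True
      then show ?thesis unfolding sum using ij Asj[of i] Asj[of j] insert.prems(1)[of i s] by (auto simp: mult.commute)
    next
      case False
      then have "A' i j = (\<Sum>k\<in>S. r' k i * r' k j)" using r' ij by blast
      then show ?thesis unfolding sum using False by (simp add: A'_def)
    qed
  qed
qed simp

text \<open>Vertices are added one at a time: if \<open>T\<close> is right for the earlier ones but
  not for \<open>w\<close>, it is composed with the reflection that exchanges
  \<open>T (\<rho> w)\<close> and \<open>\<sigma> w\<close>. The earlier \<open>\<sigma> u\<close>
  are equidistant from these two points and hence lie on the mirror.\<close>

lemma congruent_frameworks_iff:
  fixes \<rho> \<sigma> :: "'v \<Rightarrow> real ^ 'd"
  assumes "finite V"
  shows "congruent_frameworks V \<rho> \<sigma> \<longleftrightarrow> (\<forall>u\<in>V. \<forall>w\<in>V. dist (\<sigma> u) (\<sigma> w) = dist (\<rho> u) (\<rho> w))"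
proof
  assume "congruent_frameworks V \<rho> \<sigma>"
  then show "\<forall>u\<in>V. \<forall>w\<in>V. dist (\<sigma> u) (\<sigma> w) = dist (\<rho> u) (\<rho> w)"
    unfolding congruent_frameworks_def using rigid_motion_iff_isometry by metis
next
  assume "\<forall>u\<in>V. \<forall>w\<in>V. dist (\<sigma> u) (\<sigma> w) = dist (\<rho> u) (\<rho> w)"
  with assms show "congruent_frameworks V \<rho> \<sigma>"
  proof (induction V rule: finite_induct)
    case empty
    show ?case unfolding congruent_frameworks_def using translation[of 0] by blast
  next
    case (insert w V)
    then obtain T where T: "rigid_motion T" "\<And>u. u \<in> V \<Longrightarrow> \<sigma> u = T (\<rho> u)" unfolding congruent_frameworks_def by auto
    have iso: "dist (T x) (T y) = dist x y" for x y using T(1) rigid_motion_iff_isometry by blast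
    show ?case
    proof (cases "T (\<rho> w) = \<sigma> w")
      case True
      then show ?thesis using T unfolding congruent_frameworks_def by (intro exI[of _ T]) auto
    next
      case False
      define n c where "n = T (\<rho> w) - \<sigma> w" and "c = (1 / 2) *\<^sub>R (T (\<rho> w) + \<sigma> w)"
      have n: "n \<noteq> 0" "n \<bullet> n \<noteq> 0" using False by (auto simp: n_def)
      define S where "S = (\<lambda>x. x - (2 * ((x - c) \<bullet> n) / (n \<bullet> n)) *\<^sub>R n)"
      have "S (T (\<rho> w)) = \<sigma> w"
      proof -
        have "T (\<rho> w) - c = (1 / 2) *\<^sub>R n"
          by (simp add: n_def c_def scaleR_diff_right scaleR_add_right)
        then have "(T (\<rho> w) - c) \<bullet> n = (1 / 2) * (n \<bullet> n)" by (simp only: inner_scaleR_left)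
        then have "2 * ((T (\<rho> w) - c) \<bullet> n) / (n \<bullet> n) = 1" using n(2) by (simp only:) simp
        then have "S (T (\<rho> w)) = T (\<rho> w) - n" unfolding S_def by (simp only: scaleR_one)
        then show ?thesis by (simp add: n_def)
      qed
      moreover have "S (\<sigma> u) = \<sigma> u" if u: "u \<in> V" for u
      proof -
        have "dist (\<sigma> u) (T (\<rho> w)) = dist (\<rho> u) (\<rho> w)" unfolding T(2)[OF u] by (rule iso)
        also have "\<dots> = dist (\<sigma> u) (\<sigma> w)" using insert.prems u by simp
        finally have "dist (\<sigma> u) (T (\<rho> w)) = dist (\<sigma> u) (\<sigma> w)" .
        then have "(\<sigma> u - T (\<rho> w)) \<bullet> (\<sigma> u - T (\<rho> w)) = (\<sigma> u - \<sigma> w) \<bullet> (\<sigma> u - \<sigma> w)"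
          by (simp add: dist_norm norm_eq)
        then have "(\<sigma> u - c) \<bullet> n = 0"
          by (simp add: n_def c_def inner_diff_left inner_diff_right inner_add_left inner_add_right inner_commute algebra_simps)
        then show ?thesis by (simp add: S_def)
      qed
      moreover have "rigid_motion (S \<circ> T)" unfolding S_def using reflection[OF n(1)] T(1) by (rule composition)
      ultimately show ?thesis unfolding congruent_frameworks_def using T(2) by (intro exI[of _ "S \<circ> T"]) auto
    qed
  qed
qed

subsection \<open>Rigidity of coordinate frameworks\<close>

context edge_ends begin

definition sqdist :: "('v \<times> 'd::finite \<Rightarrow> real) \<Rightarrow> 'v \<Rightarrow> 'v \<Rightarrow> real" where
  "sqdist a u w = (\<Sum>i\<in>UNIV. (a (u, i) - a (w, i))\<^sup>2)"

definition rigid_at :: "('v \<times> 'd::finite \<Rightarrow> real) \<Rightarrow> bool" where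
  "rigid_at a \<longleftrightarrow> (\<forall>b :: 'v \<times> 'd \<Rightarrow> real. (\<forall>e\<in>E. sqdist b (s e) (t e) = sqdist a (s e) (t e)) \<longrightarrow>
     (\<forall>u\<in>V. \<forall>w\<in>V. sqdist b u w = sqdist a u w))"

text \<open>The rigidity matrix, with row \<open>e\<close> and column
  \<open>k = (i, u)\<close>.\<close>

definition tcol :: "'d::finite \<times> 'v \<Rightarrow> 'e \<Rightarrow> ('v \<times> 'd \<Rightarrow> real) \<Rightarrow> real" where
  "tcol k e a = delta (\<lambda>u. a (u, fst k)) e * delta (ind (snd k)) e"

lemma tcol_rat_poly: "e \<in> E \<Longrightarrow> tcol k e \<in> rat_poly_on (V \<times> UNIV)"
proof -
  assume e: "e \<in> E"
  have "delta (ind (snd k)) e \<in> \<rat>" by (auto simp: delta_def ind_def)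
  then obtain c where c: "delta (ind (snd k)) e = of_rat c" by (auto elim: Rats_cases)
  have "tcol k e = (\<lambda>a. (a (s e, fst k) - a (t e, fst k)) * of_rat c)"
    unfolding tcol_def c by (simp add: delta_def)
  then show ?thesis using e ends by (auto intro!: rat_poly_on_intros rat_poly_on_const)
qed

lemma sum_tcol:
  assumes "e \<in> E"
  shows "(\<Sum>k\<in>UNIV \<times> V. c k * tcol k e a) = (\<Sum>i\<in>UNIV. delta (\<lambda>u. a (u, i)) e * delta (\<lambda>u. c (i, u)) e)"
proof -
  have "(\<Sum>k\<in>UNIV \<times> V. c k * tcol k e a) = (\<Sum>i\<in>UNIV. \<Sum>u\<in>V. c (i, u) * (delta (\<lambda>u. a (u, i)) e * delta (ind u) e))"
    by (simp add: sum.cartesian_product tcol_def case_prod_unfold)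
  also have "\<dots> = (\<Sum>i\<in>UNIV. delta (\<lambda>u. a (u, i)) e * (\<Sum>u\<in>V. c (i, u) * delta (ind u) e))"
    by (simp add: sum_distrib_left mult_ac)
  finally show ?thesis by (simp add: delta_ind[OF assms])
qed

lemma tang_iff_comb_on: "tang a y \<longleftrightarrow> comb_on (UNIV \<times> V) E (\<lambda>k e. tcol k e a) y"
proof
  assume "tang a y"
  then obtain h where "\<forall>e\<in>E. y e = (\<Sum>i\<in>UNIV. delta (\<lambda>u. a (u, i)) e * delta (h i) e)" unfolding tang_def by blast
  then show "comb_on (UNIV \<times> V) E (\<lambda>k e. tcol k e a) y"
    unfolding comb_on_def by (intro exI[of _ "\<lambda>(i, u). h i u"]) (simp add: sum_tcol)
next
  assume "comb_on (UNIV \<times> V) E (\<lambda>k e. tcol k e a) y"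
  then obtain c where "\<forall>e\<in>E. y e = (\<Sum>k\<in>UNIV \<times> V. c k * tcol k e a)" unfolding comb_on_def by blast
  then show "tang a y" unfolding tang_def by (intro exI[of _ "\<lambda>i u. c (i, u)"]) (simp add: sum_tcol)
qed

text \<open>Let \<open>y\<close> be the image of the velocity \<open>h\<close>, and choose a
  derivation with \<open>D (a (u, i)) = h i u\<close> that is also defined on the coordinates of
  \<open>b\<close>. Applied to the equal squared lengths it gives \<open>2 * y\<close> on the side
  of \<open>a\<close>, and on the side of \<open>b\<close> twice the image of the velocity
  \<open>D (b (u, i))\<close>.\<close>

lemma tang_subset_of_equal_lengths:
  fixes a b :: "'v \<times> 'd::finite \<Rightarrow> real"
  assumes gen: "generic_point (V \<times> UNIV) a"
    and len: "\<And>e. e \<in> E \<Longrightarrow> sqdist b (s e) (t e) = sqdist a (s e) (t e)" and y: "tang a y"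
  shows "tang b y"
proof -
  obtain h where h: "\<And>e. e \<in> E \<Longrightarrow> y e = (\<Sum>i\<in>UNIV. delta (\<lambda>u. a (u, i)) e * delta (h i) e)"
    using y unfolding tang_def by blast
  obtain A D where der: "derivation_on A D" and bA: "b ` (V \<times> UNIV) \<subseteq> A"
    and aA: "\<And>x. x \<in> V \<times> UNIV \<Longrightarrow> a x \<in> A \<and> D (a x) = (case x of (u, i) \<Rightarrow> h i u)"
    by (rule generic_derivation[OF gen, of "b ` (V \<times> UNIV)" "\<lambda>(u, i). h i u"])
      (use finV in simp, rule that)
  note D = derivation_onD[OF der]
  have Dsq: "D (sqdist c u w) = 2 * (\<Sum>i\<in>UNIV. (c (u, i) - c (w, i)) * (D (c (u, i)) - D (c (w, i))))"
    if c: "\<And>u i. u \<in> V \<Longrightarrow> c (u, i) \<in> A" and uw: "u \<in> V" "w \<in> V" for c :: "'v \<times> 'd \<Rightarrow> real" and u w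
  proof -
    have "D (sqdist c u w) = (\<Sum>i\<in>UNIV. D ((c (u, i) - c (w, i))\<^sup>2))"
      unfolding sqdist_def power2_eq_square using c uw by (intro derivation_on_sum[OF der, THEN conjunct2]) (simp add: D)
    also have "\<dots> = (\<Sum>i\<in>UNIV. 2 * ((c (u, i) - c (w, i)) * (D (c (u, i)) - D (c (w, i)))))"
      using c uw by (intro sum.cong) (simp_all add: power2_eq_square D)
    finally show ?thesis by (simp add: sum_distrib_left)
  qed
  have "y e = (\<Sum>i\<in>UNIV. delta (\<lambda>u. b (u, i)) e * delta (\<lambda>u. D (b (u, i))) e)" if e: "e \<in> E" for e
  proof -
    have st: "s e \<in> V" "t e \<in> V" using ends e by auto
    have Da: "D (a (u, i)) = h i u" if "u \<in> V" for u i using aA[of "(u, i)"] that by simp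
    have "2 * y e = D (sqdist a (s e) (t e))"
      using aA st h[OF e] by (subst Dsq) (simp_all add: delta_def Da)
    also have "\<dots> = D (sqdist b (s e) (t e))" using len[OF e] by simp
    also have "\<dots> = 2 * (\<Sum>i\<in>UNIV. delta (\<lambda>u. b (u, i)) e * delta (\<lambda>u. D (b (u, i))) e)"
      using bA st by (subst Dsq) (auto simp: delta_def)
    finally show ?thesis by simp
  qed
  then show ?thesis unfolding tang_def by (intro exI[of _ "\<lambda>i u. D (b (u, i))"]) blast
qed

text \<open>At a generic framework the tangent space has maximal dimension, so the inclusion of tangent
  spaces is an equality.\<close>

theorem equal_lengths_stress_kernel:
  fixes a b :: "'v \<times> 'd::finite \<Rightarrow> real"
  assumes gen: "generic_point (V \<times> UNIV) a"
    and len: "\<And>e. e \<in> E \<Longrightarrow> sqdist b (s e) (t e) = sqdist a (s e) (t e)"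
  shows "(\<lambda>u. b (u, i)) \<in> stress_kernel a"
proof -
  let ?J = "UNIV \<times> V :: ('d \<times> 'v) set"
  have finJ: "finite ?J" using finV by simp
  have "tang a y" if y: "tang b y" for y
  proof (rule ccontr)
    assume not: "\<not> tang a y"
    obtain J0 where J0: "J0 \<subseteq> ?J" "indep_on J0 E (\<lambda>k e. tcol k e a)"
      "\<And>k. k \<in> ?J \<Longrightarrow> comb_on J0 E (\<lambda>k e. tcol k e a) (\<lambda>e. tcol k e a)"
      by (rule maximal_indep_on[OF finJ, of E "\<lambda>k e. tcol k e a"]) (rule that)
    obtain J1 where J1: "J1 \<subseteq> ?J" "indep_on J1 E (\<lambda>k e. tcol k e b)"
      "\<And>k. k \<in> ?J \<Longrightarrow> comb_on J1 E (\<lambda>k e. tcol k e b) (\<lambda>e. tcol k e b)"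
      by (rule maximal_indep_on[OF finJ, of E "\<lambda>k e. tcol k e b"]) (rule that)
    have fin: "finite J0" "finite J1" using J0(1) J1(1) finJ finite_subset by blast+
    have in_J1: "comb_on J1 E (\<lambda>k e. tcol k e b) z" if "tang b z" for z
      using that unfolding tang_iff_comb_on by (rule comb_on_trans) (rule J1(3))
    \<comment> \<open>A basis of the tangent space at \<open>a\<close> together with
      \<open>y\<close> would be independent inside the tangent space at \<open>b\<close>, whose
      dimension is at most that at \<open>a\<close>.\<close>
    define W where "W k e = (case k of Some j \<Rightarrow> tcol j e a | None \<Rightarrow> y e)" for k e
    have "indep_on (Some ` J0) E W"
      using J0(2) by (subst indep_on_reindex) (auto simp: W_def[abs_def])
    moreover have "\<not> comb_on (Some ` J0) E W (W None)"
    proof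
      assume "comb_on (Some ` J0) E W (W None)"
      then obtain d where "\<forall>e\<in>E. y e = (\<Sum>k\<in>Some ` J0. d k * W k e)" unfolding comb_on_def W_def by auto
      then have "\<forall>e\<in>E. y e = (\<Sum>j\<in>J0. d (Some j) * tcol j e a)" by (simp add: sum.reindex W_def)
      then have "comb_on J0 E (\<lambda>k e. tcol k e a) y" unfolding comb_on_def by (intro exI[of _ "\<lambda>j. d (Some j)"])
      then show False using not comb_on_mono[OF _ J0(1) finJ] unfolding tang_iff_comb_on by blast
    qed
    ultimately have "indep_on (insert None (Some ` J0)) E W" using fin by (intro indep_on_insert) auto
    moreover have "comb_on J1 E (\<lambda>k e. tcol k e b) (W k)" if k: "k \<in> insert None (Some ` J0)" for k
    proof (cases k)
      case None
      then have "W k = y" by (auto simp: W_def)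
      then show ?thesis using in_J1[OF y] by simp
    next
      case (Some j)
      then have "j \<in> ?J" using k J0(1) by auto
      then have "tang a (\<lambda>e. tcol j e a)"
        unfolding tang_iff_comb_on using comb_on_member[OF finJ, of j E "\<lambda>k e. tcol k e a"] by simp
      then have "tang b (\<lambda>e. tcol j e a)" by (intro tang_subset_of_equal_lengths[where a = a and b = b, OF gen len])
      moreover have "W k = (\<lambda>e. tcol j e a)" using Some by (auto simp: W_def)
      ultimately show ?thesis using in_J1 by simp
    qed
    ultimately have "card (insert None (Some ` J0)) \<le> card J1"
      using fin by (intro indep_on_card_le[where w = W and ?w0.0 = "\<lambda>k e. tcol k e b"]) auto
    moreover have "card J1 \<le> card J0"
    proof (rule indep_on_card_le[where w = "\<lambda>k e. tcol k e a" and ?w0.0 = "\<lambda>k e. tcol k e a", OF fin(2,1)])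
      show "indep_on J1 E (\<lambda>k e. tcol k e a)"
        by (rule generic_indep_on[where w = tcol, OF fin(2) tcol_rat_poly gen J1(2)])
    qed (use J0(3) J1(1) in auto)
    ultimately show False using fin by (simp add: card_image)
  qed
  moreover have "tang b (\<lambda>e. delta (\<lambda>u. b (u, i)) e * delta g e)" for g
    by (rule stress_kernelD[OF stress_kernel_coordinate])
  ultimately show ?thesis unfolding stress_kernel_def by blast
qed

text \<open>Homogeneous coordinates, which turn affine independence of vertices into linear
  independence.\<close>

definition acol :: "'v \<Rightarrow> 'd::finite option \<Rightarrow> ('v \<times> 'd \<Rightarrow> real) \<Rightarrow> real" where
  "acol u k a = (case k of None \<Rightarrow> 1 | Some i \<Rightarrow> a (u, i))"

lemma sum_acol: "(\<Sum>k\<in>UNIV. z k * acol u k a) = z None + (\<Sum>i\<in>UNIV. z (Some i) * a (u, i))"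
  by (subst UNIV_option_conv, subst sum.insert) (simp_all add: sum.reindex acol_def)

lemma generic_affinely_independent:
  fixes a :: "'v \<times> 'd::finite \<Rightarrow> real"
  assumes gen: "generic_point (V \<times> UNIV) a" and B: "B \<subseteq> V" "card B \<le> CARD('d) + 1"
  shows "indep_on B UNIV (\<lambda>u k. acol u k a)"
proof -
  have finB: "finite B" using B finV finite_subset by blast
  have "card B \<le> card (UNIV :: 'd option set)" using B by (simp add: card_option)
  then obtain f :: "'v \<Rightarrow> 'd option" where f: "inj_on f B" using card_le_inj[OF finB, of "UNIV :: 'd option set"] by auto
  \<comment> \<open>The vertices of \<open>B\<close> are placed at distinct points among the
    standard basis vectors and the origin, the latter for \<open>f u = None\<close>.\<close>
  define a0 where "a0 = (\<lambda>(u, i). if f u = Some i then 1 else 0 :: real)"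
  have "indep_on B UNIV (\<lambda>u k. acol u k a0)"
    unfolding indep_on_def
  proof (intro allI impI)
    fix c assume c: "\<forall>k\<in>UNIV. (\<Sum>u\<in>B. c u * acol u k a0) = 0"
    have some: "c u = 0" if "u \<in> B" "f u \<noteq> None" for u
    proof -
      from that(2) obtain i where i: "f u = Some i" by blast
      have "(\<Sum>w\<in>B. c w * acol w (Some i) a0) = (\<Sum>w\<in>B. if w = u then c w else 0)"
      proof (rule sum.cong)
        fix w assume "w \<in> B"
        then show "c w * acol w (Some i) a0 = (if w = u then c w else 0)"
        proof (cases "w = u")
          case True
          then show ?thesis using i by (simp add: acol_def a0_def)
        next
          case False
          then have "f w \<noteq> Some i" using inj_onD[OF f] that(1) i \<open>w \<in> B\<close> by metis
          then show ?thesis using False by (simp add: acol_def a0_def)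
        qed
      qed simp
      then show ?thesis using c finB that by simp
    qed
    have "c u = 0" if "u \<in> B" "f u = None" for u
    proof -
      have "(\<Sum>w\<in>B. c w * acol w None a0) = (\<Sum>w\<in>B. if w = u then c w else 0)"
      proof (rule sum.cong)
        fix w assume w: "w \<in> B"
        show "c w * acol w None a0 = (if w = u then c w else 0)"
        proof (cases "w = u")
          case False
          then have "f w \<noteq> None" using inj_onD[OF f, of w u] that w by auto
          then show ?thesis using some[OF w] False by simp
        qed (simp add: acol_def)
      qed simp
      then show ?thesis using c finB that by simp
    qed
    then show "\<forall>u\<in>B. c u = 0" using some by blast
  qed
  moreover have "acol u k \<in> rat_poly_on (V \<times> UNIV)" if "u \<in> B" for u and k :: "'d option"
    using B(1) that by (cases k) (auto simp: acol_def[abs_def] intro!: rat_poly_on_intros)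
  ultimately show ?thesis by (intro generic_indep_on[where w = acol and ?a0.0 = a0, OF finB _ gen])
qed

lemma affine_in_stress_kernel: "(\<lambda>u. \<Sum>k\<in>UNIV. z k * acol u k a) \<in> stress_kernel a"
  unfolding sum_acol by (intro stress_kernel_add stress_kernel_const stress_kernel_sum stress_kernel_scale stress_kernel_coordinate)

lemma affine_of_determined_on:
  fixes a :: "'v \<times> 'd::finite \<Rightarrow> real"
  assumes gen: "generic_point (V \<times> UNIV) a" and B: "B \<subseteq> V" "card B \<le> CARD('d) + 1"
    and det: "determined_on B a" and f: "f \<in> stress_kernel a"
  obtains z where "\<And>u. u \<in> V \<Longrightarrow> f u = (\<Sum>k\<in>UNIV. z k * acol u k a)"
proof -
  have finB: "finite B" using B finV finite_subset by blast
  obtain z where z: "\<And>u. u \<in> B \<Longrightarrow> (\<Sum>k\<in>UNIV. z k * acol u k a) = f u"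
    by (rule indep_on_interpolation[OF finB _ generic_affinely_independent[OF gen B], of f]) (simp, rule that)
  have "(\<lambda>u. f u - (\<Sum>k\<in>UNIV. z k * acol u k a)) \<in> stress_kernel a"
    by (intro stress_kernel_diff f affine_in_stress_kernel)
  from det[unfolded determined_on_def, rule_format, OF this] z
  have "f u - (\<Sum>k\<in>UNIV. z k * acol u k a) = 0" if "u \<in> V" for u using that by simp
  then show ?thesis using that[of z] by simp
qed

text \<open>Quadratic forms evaluate linearly on these products of coordinates of a difference
  vector, so conditions on forms become conditions on spans.\<close>

definition qcol :: "'v \<times> 'v \<Rightarrow> 'd::finite \<times> 'd \<Rightarrow> ('v \<times> 'd \<Rightarrow> real) \<Rightarrow> real" where
  "qcol uw ij a = (a (fst uw, fst ij) - a (snd uw, fst ij)) * (a (fst uw, snd ij) - a (snd uw, snd ij))"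

abbreviation edge_pairs :: "('v \<times> 'v) set" where
  "edge_pairs \<equiv> (\<lambda>e. (s e, t e)) ` E"

text \<open>Every quadratic form vanishing on the edge directions vanishes on all differences of vertices:
  the framework does not lie on a conic at infinity.\<close>

definition no_conic :: "('v \<times> 'd::finite \<Rightarrow> real) \<Rightarrow> bool" where
  "no_conic a \<longleftrightarrow> (\<forall>uw\<in>V \<times> V. comb_on edge_pairs UNIV (\<lambda>k ij. qcol k ij a) (\<lambda>ij. qcol uw ij a))"

lemma qcol_rat_poly: "uw \<in> V \<times> V \<Longrightarrow> qcol uw ij \<in> rat_poly_on (V \<times> UNIV)"
  unfolding qcol_def[abs_def] by (intro rat_poly_on_intros) auto

lemma edge_pairs_subset: "edge_pairs \<subseteq> V \<times> V"
  using ends by auto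

lemma no_conic_generic:
  fixes a b :: "'v \<times> 'd::finite \<Rightarrow> real"
  assumes "generic_point (V \<times> UNIV) a" "generic_point (V \<times> UNIV) b" "no_conic a"
  shows "no_conic b"
  unfolding no_conic_def
proof
  fix uw assume uw: "uw \<in> V \<times> V"
  then have "comb_on edge_pairs UNIV (\<lambda>k ij. qcol k ij a) (\<lambda>ij. qcol uw ij a)"
    using assms(3) unfolding no_conic_def by (rule bspec[rotated])
  then show "comb_on edge_pairs UNIV (\<lambda>k ij. qcol k ij b) (\<lambda>ij. qcol uw ij b)"
    by (intro generic_comb_on[where w = qcol and a = a, OF _ edge_pairs_subset uw qcol_rat_poly assms(1,2)])
      (simp_all add: finV)
qed

lemma sum_qcol: "(\<Sum>ij\<in>UNIV. \<alpha> ij * qcol (u, w) ij a)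
    = (\<Sum>i\<in>UNIV. \<Sum>j\<in>UNIV. \<alpha> (i, j) * (a (u, i) - a (w, i)) * (a (u, j) - a (w, j)))"
  by (simp add: qcol_def UNIV_Times_UNIV[symmetric] sum.cartesian_product case_prod_unfold mult.assoc del: UNIV_Times_UNIV)

lemma sqdist_linear_image:
  assumes "\<And>i. b (u, i) - b (w, i) = (\<Sum>j\<in>UNIV. m i j * (a (u, j) - a (w, j)))"
  shows "sqdist b u w = (\<Sum>jk\<in>UNIV. (\<Sum>i\<in>UNIV. m i (fst jk) * m i (snd jk)) * qcol (u, w) jk a)"
proof -
  have "sqdist b u w = (\<Sum>i\<in>UNIV. \<Sum>j\<in>UNIV. \<Sum>k\<in>UNIV. m i j * m i k * (a (u, j) - a (w, j)) * (a (u, k) - a (w, k)))"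
    unfolding sqdist_def assms power2_eq_square sum_product by (simp add: mult_ac)
  also have "\<dots> = (\<Sum>j\<in>UNIV. \<Sum>i\<in>UNIV. \<Sum>k\<in>UNIV. m i j * m i k * (a (u, j) - a (w, j)) * (a (u, k) - a (w, k)))"
    by (rule sum.swap)
  also have "\<dots> = (\<Sum>j\<in>UNIV. \<Sum>k\<in>UNIV. \<Sum>i\<in>UNIV. m i j * m i k * (a (u, j) - a (w, j)) * (a (u, k) - a (w, k)))"
    by (intro sum.cong refl) (rule sum.swap)
  also have "\<dots> = (\<Sum>jk\<in>UNIV. (\<Sum>i\<in>UNIV. m i (fst jk) * m i (snd jk)) * qcol (u, w) jk a)"
    unfolding sum_qcol by (simp add: sum_distrib_right)
  finally show ?thesis .
qed

lemma sqdist_qcol: "sqdist a u w = (\<Sum>jk\<in>UNIV. (if fst jk = snd jk then 1 else 0) * qcol (u, w) jk a)"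
  unfolding sum_qcol sqdist_def
  by (rule sum.cong) (simp_all add: power2_eq_square if_distrib[of "\<lambda>x. x * _"] cong: if_cong)

theorem rigid_if_determined:
  fixes a :: "'v \<times> 'd::finite \<Rightarrow> real"
  assumes gen: "generic_point (V \<times> UNIV) a" and B: "B \<subseteq> V" "card B \<le> CARD('d) + 1"
    and det: "determined_on B a" and nc: "no_conic a"
  shows "rigid_at a"
  unfolding rigid_at_def
proof (intro allI impI ballI)
  fix b :: "'v \<times> 'd \<Rightarrow> real" and u w
  assume len: "\<forall>e\<in>E. sqdist b (s e) (t e) = sqdist a (s e) (t e)" and u: "u \<in> V" and w: "w \<in> V"
  have "\<forall>i. \<exists>z. \<forall>u\<in>V. b (u, i) = (\<Sum>k\<in>UNIV. z k * acol u k a)"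
  proof
    fix i
    have "(\<lambda>u. b (u, i)) \<in> stress_kernel a" 
      by (rule equal_lengths_stress_kernel[where b = b, OF gen]) (use len in simp)
    then show "\<exists>z. \<forall>u\<in>V. b (u, i) = (\<Sum>k\<in>UNIV. z k * acol u k a)"
      by (rule affine_of_determined_on[OF gen B det]) blast
  qed
  from choice[OF this] obtain z where z: "\<And>i u. u \<in> V \<Longrightarrow> b (u, i) = (\<Sum>k\<in>UNIV. z i k * acol u k a)" by blast
  define m where "m i j = z i (Some j)" for i j
  have diff: "b (u, i) - b (w, i) = (\<Sum>j\<in>UNIV. m i j * (a (u, j) - a (w, j)))" if "u \<in> V" "w \<in> V" for u w i
    using z[OF that(1), of i] z[OF that(2), of i] by (simp add: sum_acol m_def right_diff_distrib sum_subtractf)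
  \<comment> \<open>The form by which the linear part \<open>m\<close> changes squared lengths. It
    vanishes on the edge directions, hence by \<open>no_conic\<close> on all differences.\<close>
  define \<beta> where "\<beta> jk = (\<Sum>i\<in>UNIV. m i (fst jk) * m i (snd jk)) - (if fst jk = snd jk then 1 else 0)" for jk
  have eq: "sqdist b u w - sqdist a u w = (\<Sum>jk\<in>UNIV. \<beta> jk * qcol (u, w) jk a)" if "u \<in> V" "w \<in> V" for u w
    unfolding sqdist_linear_image[of b u w, OF diff[OF that]] sqdist_qcol[of a] \<beta>_def
    by (simp add: left_diff_distrib sum_subtractf)
  obtain c where c: "\<And>jk. qcol (u, w) jk a = (\<Sum>p\<in>edge_pairs. c p * qcol p jk a)"
    using nc u w unfolding no_conic_def comb_on_def by blast
  have edge: "(\<Sum>jk\<in>UNIV. \<beta> jk * qcol p jk a) = 0" if p: "p \<in> edge_pairs" for p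
  proof -
    obtain e where e: "e \<in> E" "p = (s e, t e)" using p by blast
    then show ?thesis using eq[of "s e" "t e"] len ends by simp
  qed
  have "sqdist b u w - sqdist a u w = (\<Sum>jk\<in>UNIV. \<Sum>p\<in>edge_pairs. c p * (\<beta> jk * qcol p jk a))"
    unfolding eq[OF u w] c sum_distrib_left by (simp add: mult_ac)
  also have "\<dots> = (\<Sum>p\<in>edge_pairs. c p * (\<Sum>jk\<in>UNIV. \<beta> jk * qcol p jk a))"
    by (subst sum.swap) (simp add: sum_distrib_left)
  also have "\<dots> = 0" using edge by (intro sum.neutral) simp
  finally show "sqdist b u w = sqdist a u w" by simp
qed

text \<open>A form that vanishes on the edges but not at \<open>uw\<close> is scaled down and added
  to the standard one. The sum is still positive semidefinite, hence the pullback of the standard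
  form under a linear map \<open>r\<close>, which preserves all edge lengths but not the distance of
  the pair \<open>uw\<close>.\<close>

theorem no_conic_if_rigid:
  fixes a :: "'v \<times> 'd::finite \<Rightarrow> real"
  assumes "rigid_at a"
  shows "no_conic a"
  unfolding no_conic_def
proof (rule ballI, rule ccontr)
  fix uw assume uw: "uw \<in> V \<times> V" and not: "\<not> comb_on edge_pairs UNIV (\<lambda>k ij. qcol k ij a) (\<lambda>ij. qcol uw ij a)"
  obtain u w where uw': "uw = (u, w)" "u \<in> V" "w \<in> V" using uw by blast
  obtain \<alpha> where \<alpha>: "\<And>p. p \<in> edge_pairs \<Longrightarrow> (\<Sum>ij\<in>UNIV. \<alpha> ij * qcol p ij a) = 0"
    "(\<Sum>ij\<in>UNIV. \<alpha> ij * qcol uw ij a) \<noteq> 0"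
    by (rule separating_functional[OF _ _ not]) (use finE in simp, simp, rule that)
  define Q where "Q i j = (\<alpha> (i, j) + \<alpha> (j, i)) / 2" for i j
  have Q: "(\<Sum>i\<in>UNIV. \<Sum>j\<in>UNIV. Q i j * x i * x j) = (\<Sum>i\<in>UNIV. \<Sum>j\<in>UNIV. \<alpha> (i, j) * x i * x j)" for x
  proof -
    have "(\<Sum>i\<in>UNIV. \<Sum>j\<in>UNIV. \<alpha> (j, i) * x i * x j) = (\<Sum>i\<in>UNIV. \<Sum>j\<in>UNIV. \<alpha> (i, j) * x i * x j)"
      by (subst sum.swap) (simp add: mult_ac)
    moreover have "(\<Sum>i\<in>UNIV. \<Sum>j\<in>UNIV. Q i j * x i * x j) = ((\<Sum>i\<in>UNIV. \<Sum>j\<in>UNIV. \<alpha> (i, j) * x i * x j)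
      + (\<Sum>i\<in>UNIV. \<Sum>j\<in>UNIV. \<alpha> (j, i) * x i * x j)) / 2"
      unfolding sum.distrib[symmetric] sum_divide_distrib by (intro sum.cong refl) (simp add: Q_def field_simps)
    ultimately show ?thesis by simp
  qed
  \<comment> \<open>A bound for the form on unit vectors; the summand 1 keeps it positive when
    \<open>Q = 0\<close>.\<close>
  define C where "C = (\<Sum>i\<in>UNIV. \<Sum>j\<in>UNIV. \<bar>Q i j\<bar>) + 1"
  have C: "C > 0" unfolding C_def by (intro add_nonneg_pos sum_nonneg) auto
  define G where "G i j = (if i = j then 1 else 0) + Q i j / C" for i j
  have G: "(\<Sum>i\<in>UNIV. \<Sum>j\<in>UNIV. G i j * x i * x j) = (\<Sum>i\<in>UNIV. (x i)\<^sup>2) + (\<Sum>i\<in>UNIV. \<Sum>j\<in>UNIV. \<alpha> (i, j) * x i * x j) / C" for x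
  proof -
    have "(\<Sum>i\<in>UNIV. \<Sum>j\<in>UNIV. G i j * x i * x j) = (\<Sum>i\<in>UNIV. \<Sum>j\<in>UNIV. (if i = j then 1 else 0) * x i * x j)
      + (\<Sum>i\<in>UNIV. \<Sum>j\<in>UNIV. Q i j * x i * x j) / C"
      unfolding sum.distrib[symmetric] sum_divide_distrib by (intro sum.cong refl) (simp add: G_def field_simps)
    also have "(\<Sum>i\<in>UNIV. \<Sum>j\<in>UNIV. (if i = j then 1 else 0) * x i * x j) = (\<Sum>i\<in>UNIV. (x i)\<^sup>2)"
      by (rule sum.cong) (simp_all add: power2_eq_square if_distrib[of "\<lambda>x. x * _"] cong: if_cong)
    finally show ?thesis unfolding Q .
  qed
  have G_psd: "(\<Sum>i\<in>UNIV. \<Sum>j\<in>UNIV. G i j * x i * x j) \<ge> 0" for x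
  proof -
    define X where "X = (\<Sum>i\<in>UNIV. (x i)\<^sup>2)"
    have "\<bar>Q i j * x i * x j\<bar> \<le> \<bar>Q i j\<bar> * X" for i j
    proof -
      have "(x i)\<^sup>2 \<le> X" "(x j)\<^sup>2 \<le> X" unfolding X_def by (auto intro!: member_le_sum)
      moreover have "2 * (\<bar>x i\<bar> * \<bar>x j\<bar>) \<le> (x i)\<^sup>2 + (x j)\<^sup>2"
        using sum_squares_bound[of "\<bar>x i\<bar>" "\<bar>x j\<bar>"] by simp
      ultimately have "\<bar>x i\<bar> * \<bar>x j\<bar> \<le> X" by linarith
      then show ?thesis by (simp add: abs_mult mult.assoc mult_left_mono)
    qed
    then have "\<bar>\<Sum>i\<in>UNIV. \<Sum>j\<in>UNIV. Q i j * x i * x j\<bar> \<le> (\<Sum>i\<in>UNIV. \<Sum>j\<in>UNIV. \<bar>Q i j\<bar> * X)"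
      by (intro order_trans[OF sum_abs] sum_mono)
    also have "\<dots> = (C - 1) * X" by (simp add: C_def sum_distrib_right)
    also have "\<dots> \<le> C * X" by (intro mult_right_mono) (auto simp: X_def intro: sum_nonneg)
    finally have "- (C * X) \<le> (\<Sum>i\<in>UNIV. \<Sum>j\<in>UNIV. \<alpha> (i, j) * x i * x j)" unfolding Q by linarith
    then have "- X \<le> (\<Sum>i\<in>UNIV. \<Sum>j\<in>UNIV. \<alpha> (i, j) * x i * x j) / C" using C by (simp add: field_simps)
    then show ?thesis unfolding G X_def by simp
  qed
  have G_sym: "G i j = G j i" for i j by (simp add: G_def Q_def add.commute)
  obtain r :: "'d \<Rightarrow> 'd \<Rightarrow> real" where "\<forall>i\<in>UNIV. \<forall>j\<in>UNIV. G i j = (\<Sum>k\<in>UNIV. r k i * r k j)"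
    using psd_gram[OF finite G_sym G_psd] by blast
  then have r: "G i j = (\<Sum>k\<in>UNIV. r k i * r k j)" for i j by simp
  define b where "b = (\<lambda>(u, k). \<Sum>j\<in>UNIV. r k j * a (u, j))"
  have sq: "sqdist b u w = sqdist a u w + (\<Sum>ij\<in>UNIV. \<alpha> ij * qcol (u, w) ij a) / C" for u w
  proof -
    have "sqdist b u w = (\<Sum>jk\<in>UNIV. (\<Sum>i\<in>UNIV. r i (fst jk) * r i (snd jk)) * qcol (u, w) jk a)"
      by (rule sqdist_linear_image) (simp add: b_def right_diff_distrib sum_subtractf)
    also have "\<dots> = (\<Sum>i\<in>UNIV. \<Sum>j\<in>UNIV. G i j * (a (u, i) - a (w, i)) * (a (u, j) - a (w, j)))"
      unfolding sum_qcol by (simp add: r)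
    finally show ?thesis unfolding G sum_qcol sqdist_def .
  qed
  have "\<forall>e\<in>E. sqdist b (s e) (t e) = sqdist a (s e) (t e)" using sq \<alpha>(1) by simp
  then have "sqdist b u w = sqdist a u w" using assms uw' unfolding rigid_at_def by blast
  then show False using sq[of u w] \<alpha>(2) C uw'(1) by simp
qed

text \<open>The framework is moved in a fixed direction by multiples of \<open>f\<close>, which preserves the edge lengths.\<close>

theorem connected_if_rigid:
  fixes a :: "'v \<times> 'd::finite \<Rightarrow> real"
  assumes rig: "rigid_at a" and f: "\<And>e. e \<in> E \<Longrightarrow> delta f e = 0" and u: "u \<in> V" "w \<in> V"
  shows "f u = f w"
proof (rule ccontr)
  assume ne: "f u \<noteq> f w"
  define i0 where "i0 = (undefined :: 'd)"
  have "sqdist (\<lambda>(u, i). a (u, i) + (if i = i0 then c * f u else 0)) u w = sqdist a u w" for c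
  proof -
    have "\<forall>e\<in>E. sqdist (\<lambda>(u, i). a (u, i) + (if i = i0 then c * f u else 0)) (s e) (t e) = sqdist a (s e) (t e)"
      using f unfolding sqdist_def delta_def by (auto intro!: sum.cong)
    then show ?thesis using rig u unfolding rigid_at_def by blast
  qed
  moreover have "sqdist (\<lambda>(u, i). a (u, i) + (if i = i0 then c * f u else 0)) u w
    = sqdist a u w + (2 * c * (a (u, i0) - a (w, i0)) * (f u - f w) + (c * (f u - f w))\<^sup>2)" for c
  proof -
    have "sqdist (\<lambda>(u, i). a (u, i) + (if i = i0 then c * f u else 0)) u w
      = (\<Sum>i\<in>UNIV. (a (u, i) - a (w, i))\<^sup>2
          + (if i = i0 then 2 * c * (a (u, i) - a (w, i)) * (f u - f w) + (c * (f u - f w))\<^sup>2 else 0))"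
      unfolding sqdist_def by (rule sum.cong) (auto simp: power2_eq_square algebra_simps)
    then show ?thesis by (simp add: sum.distrib sqdist_def)
  qed
  ultimately have "2 * c * (a (u, i0) - a (w, i0)) * (f u - f w) + (c * (f u - f w))\<^sup>2 = 0" for c by simp
  moreover define X where "X = 2 * (a (u, i0) - a (w, i0)) * (f u - f w)"
  ultimately have *: "c * X + c\<^sup>2 * (f u - f w)\<^sup>2 = 0" for c by (simp add: power_mult_distrib mult_ac)
  have "X + (f u - f w)\<^sup>2 = 0" "- X + (f u - f w)\<^sup>2 = 0" using *[of 1] *[of "-1"] by simp_all
  then have "(f u - f w)\<^sup>2 = 0" by linarith
  then show False using ne by simp
qed

end

section \<open>The noncongruent companion in the case of a large stress kernel\<close>

lemma indep_on_transpose: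
  assumes "finite J" "finite S" "indep_on J S w" "card S \<le> card J"
  shows "indep_on S J (\<lambda>s j. w j s)"
proof -
  obtain S0 where S0: "S0 \<subseteq> S" "indep_on S0 J (\<lambda>s j. w j s)"
    "\<And>s. s \<in> S \<Longrightarrow> comb_on S0 J (\<lambda>s j. w j s) (\<lambda>j. w j s)"
    by (rule maximal_indep_on[OF assms(2), of J "\<lambda>s j. w j s"]) (rule that)
  have fin: "finite S0" using S0(1) assms(2) finite_subset by blast
  have "S0 = S"
  proof (rule ccontr)
    assume "S0 \<noteq> S"
    then have "card S0 < card S" using S0(1) assms(2) by (intro psubset_card_mono) auto
    then have "card S0 < card J" using assms(4) by simp
    then have "\<not> indep_on J S0 w" by (rule homogeneous_system_solution[OF assms(1) fin])
    then obtain c where c: "\<And>s. s \<in> S0 \<Longrightarrow> (\<Sum>j\<in>J. c j * w j s) = 0" "\<exists>j\<in>J. c j \<noteq> 0"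
      unfolding indep_on_def by blast
    have "(\<Sum>j\<in>J. c j * w j s) = 0" if s: "s \<in> S" for s
    proof -
      obtain d where d: "\<And>j. j \<in> J \<Longrightarrow> w j s = (\<Sum>s'\<in>S0. d s' * w j s')"
        using S0(3)[OF s] unfolding comb_on_def by blast
      have "(\<Sum>j\<in>J. c j * w j s) = (\<Sum>j\<in>J. \<Sum>s'\<in>S0. d s' * (c j * w j s'))"
        by (simp add: d sum_distrib_left mult_ac)
      also have "\<dots> = (\<Sum>s'\<in>S0. d s' * (\<Sum>j\<in>J. c j * w j s'))"
        by (subst sum.swap) (simp add: sum_distrib_left)
      also have "\<dots> = 0" using c(1) by simp
      finally show ?thesis .
    qed
    then show False using c(2) indep_onD[OF assms(3)] by blast
  qed
  then show ?thesis using S0(2) by simp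
qed

text \<open>Uniqueness of the Cholesky factor. When the rows above \<open>i\<close> are known,
  column \<open>i\<close> has only its diagonal entry left, so the Gram entries
  \<open>(i, k)\<close> determine row \<open>i\<close>; the nonnegative diagonal excludes its
  negative. This will show that a matrix other than \<open>x0\<close> does not give a framework
  congruent to \<open>a\<close>.\<close>

lemma upper_triangular_orthogonal:
  fixes X :: "nat \<Rightarrow> nat \<Rightarrow> real"
  assumes n: "n \<le> m" and tri: "\<And>i j. j < i \<Longrightarrow> X i j = 0" and pos: "\<And>i. i < n \<Longrightarrow> X i i \<ge> 0"
    and gram: "\<And>j k. j < m \<Longrightarrow> k < m \<Longrightarrow> (\<Sum>i<n. X i j * X i k) = (if j = k \<and> j < n then 1 else 0)"
    and ij: "i < n" "j < m"
  shows "X i j = (if i = j then 1 else 0)"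
  using ij
proof (induction i arbitrary: j rule: less_induct)
  case (less i)
  have sum: "(\<Sum>i'<n. X i' i * X i' k) = X i i * X i k" if "i < k \<or> k = i" "k < m" for k
  proof -
    have "(\<Sum>i'<n. X i' i * X i' k) = (\<Sum>i'<n. if i' = i then X i i * X i k else 0)"
    proof (rule sum.cong)
      fix i' assume "i' \<in> {..<n}"
      consider "i' < i" | "i' = i" | "i < i'" by linarith
      then show "X i' i * X i' k = (if i' = i then X i i * X i k else 0)"
        using less.IH[of i' i] tri[of i i'] less.prems n by cases auto
    qed simp
    then show ?thesis using less.prems by simp
  qed
  have "X i i * X i i = 1" using sum[of i] gram[of i i] less.prems n by simp
  then have ii: "X i i = 1" using pos[OF less.prems(1)] by (metis abs_of_nonneg abs_square_eq_1 power2_eq_square)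
  consider "j < i" | "j = i" | "i < j" by linarith
  then show ?case
  proof cases
    case 3
    then have "X i i * X i j = 0" using sum[of j] gram[of i j] less.prems n by simp
    then show ?thesis using ii 3 by simp
  qed (use tri ii in auto)
qed

context edge_ends begin

text \<open>A longest admissible sequence extending \<open>\<psi>\<close>; independence bounds its
  length by \<open>card V\<close>. The functions vanishing at \<open>v0\<close> represent the kernel
  modulo constants.\<close>

lemma stress_kernel_basis:
  fixes a :: "'v \<times> 'd::finite \<Rightarrow> real" and n :: nat
  assumes v0: "v0 \<in> V" and K: "\<And>i. i < n \<Longrightarrow> \<psi> i \<in> stress_kernel a \<and> \<psi> i v0 = 0" and ind: "indep_on {..<n} V \<psi>"
  obtains m \<phi> where "n \<le> m" "\<And>i. i < n \<Longrightarrow> \<phi> i = \<psi> i" "\<And>i. i < m \<Longrightarrow> \<phi> i \<in> stress_kernel a"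
    "\<And>i. i < m \<Longrightarrow> \<phi> i v0 = 0" "indep_on {..<m} V \<phi>"
    "\<And>f. f \<in> stress_kernel a \<Longrightarrow> f v0 = 0 \<Longrightarrow> comb_on {..<m} V \<phi> f"
proof -
  define good where "good m \<phi> \<longleftrightarrow> n \<le> m \<and> (\<forall>i<n. \<phi> i = \<psi> i) \<and>
    (\<forall>i<m. \<phi> i \<in> stress_kernel a \<and> \<phi> i v0 = 0) \<and> indep_on {..<m} V \<phi>" for m :: nat and \<phi>
  have bound: "m \<le> card V" if "good m \<phi>" for m \<phi>
    using homogeneous_system_solution[of "{..<m}" V \<phi>] finV that unfolding good_def by (simp add: not_less[symmetric]) blast
  have "good n \<psi>" using K ind by (simp add: good_def)
  then have ex: "\<exists>\<phi>. good n \<phi>" by blast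
  define m where "m = (GREATEST m. \<exists>\<phi>. good m \<phi>)"
  have "\<exists>\<phi>. good m \<phi>" unfolding m_def by (rule GreatestI_nat[where P = "\<lambda>m. \<exists>\<phi>. good m \<phi>" and b = "card V", OF ex]) (use bound in blast)
  then obtain \<phi> where \<phi>: "good m \<phi>" by blast
  have max: "m' \<le> m" if "good m' \<phi>'" for m' \<phi>'
    unfolding m_def by (rule Greatest_le_nat[where P = "\<lambda>m. \<exists>\<phi>. good m \<phi>" and b = "card V"]) (use bound that in blast)+
  have "comb_on {..<m} V \<phi> f" if f: "f \<in> stress_kernel a" "f v0 = 0" for f
  proof (rule ccontr)
    assume not: "\<not> comb_on {..<m} V \<phi> f"
    define \<phi>' where "\<phi>' = \<phi>(m := f)"
    have "indep_on {..<m} V \<phi>'" using \<phi> unfolding good_def indep_on_def \<phi>'_def by simp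
    moreover have "\<not> comb_on {..<m} V \<phi>' (\<phi>' m)" using not unfolding comb_on_def \<phi>'_def by simp
    ultimately have "indep_on (insert m {..<m}) V \<phi>'" by (intro indep_on_insert) auto
    then have "good (Suc m) \<phi>'" using \<phi> f unfolding good_def by (auto simp: \<phi>'_def lessThan_Suc less_Suc_eq)
    then show False using max by fastforce
  qed
  then show ?thesis using that[of m \<phi>] \<phi> unfolding good_def by blast
qed

text \<open>In a linear relation the coordinate part is an affine function that vanishes, like
  \<open>f\<close>, on \<open>d + 1\<close> affinely independent vertices. So it is zero, and then
  the coefficient of \<open>f\<close> is zero too.\<close>

lemma stress_kernel_dim_if_not_determined:
  fixes a :: "'v \<times> 'd::finite \<Rightarrow> real"
  assumes gen: "generic_point (V \<times> UNIV) a" and B: "B \<subseteq> V" "card B = CARD('d) + 1" and v0: "v0 \<in> B"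
    and f: "f \<in> stress_kernel a" "\<And>u. u \<in> B \<Longrightarrow> f u = 0" "u0 \<in> V" "f u0 \<noteq> 0"
    and en: "bij_betw en {..<CARD('d)} (UNIV :: 'd set)"
  shows "indep_on {..<Suc CARD('d)} V (\<lambda>i. if i < CARD('d) then (\<lambda>u. a (u, en i) - a (v0, en i)) else f)"
  unfolding indep_on_def
proof (intro allI impI)
  let ?n = "CARD('d)"
  fix c assume "\<forall>u\<in>V. (\<Sum>i<Suc ?n. c i * (if i < ?n then (\<lambda>u. a (u, en i) - a (v0, en i)) else f) u) = 0"
  then have c: "(\<Sum>i<?n. c i * (a (u, en i) - a (v0, en i))) + c ?n * f u = 0" if "u \<in> V" for u
    using that by simp
  define z where "z k = (case k of None \<Rightarrow> - (\<Sum>i<?n. c i * a (v0, en i)) | Some k \<Rightarrow> c (inv_into {..<?n} en k))" for k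
  have zsum: "(\<Sum>k\<in>UNIV. z k * acol u k a) = (\<Sum>i<?n. c i * (a (u, en i) - a (v0, en i)))" for u
  proof -
    have "(\<Sum>k\<in>UNIV. z (Some k) * a (u, k)) = (\<Sum>i<?n. z (Some (en i)) * a (u, en i))"
      using sum.reindex_bij_betw[OF en, of "\<lambda>k. z (Some k) * a (u, k)"] by simp
    also have "\<dots> = (\<Sum>i<?n. c i * a (u, en i))"
      using en by (intro sum.cong) (auto simp: z_def bij_betw_def)
    finally show ?thesis unfolding sum_acol by (simp add: z_def right_diff_distrib sum_subtractf)
  qed
  have finB: "finite B" using B finV finite_subset by blast
  have "indep_on UNIV B (\<lambda>k u. acol u k a)"
    by (rule indep_on_transpose[OF finB _ generic_affinely_independent[OF gen B(1)]])
      (simp_all add: B card_option)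
  moreover have "(\<Sum>k\<in>UNIV. z k * acol u k a) = 0" if "u \<in> B" for u
    unfolding zsum using c[of u] f(2)[OF that] B that by auto
  ultimately have z0: "z k = 0" for k using indep_onD[of UNIV B _ z k] by simp
  have ci: "c i = 0" if "i < ?n" for i using z0[of "Some (en i)"] en that by (simp add: z_def bij_betw_def)
  then have "c ?n = 0" using c[OF f(3)] f(4) by simp
  then show "\<forall>i\<in>{..<Suc ?n}. c i = 0" using ci by (auto simp: less_Suc_eq)
qed

text \<open>Rigidity is used twice: it makes the graph connected, which bounds frameworks by their
  edge lengths, and it turns the equal edge lengths of the second preimage into equal Gram matrices,
  against the uniqueness of the triangular factor.\<close>

theorem determined_if_rigid:
  fixes a :: "'v \<times> 'd::finite \<Rightarrow> real"
  assumes gen: "generic_point (V \<times> UNIV) a" and B: "B \<subseteq> V" "card B = min (card V) (CARD('d) + 1)"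
    and rig: "rigid_at a"
  shows "determined_on B a"
proof (rule ccontr)
  assume "\<not> determined_on B a"
  then obtain f u0 where f: "f \<in> stress_kernel a" "\<And>u. u \<in> B \<Longrightarrow> f u = 0" "u0 \<in> V" "f u0 \<noteq> 0"
    unfolding determined_on_def by blast
  define n where "n = CARD('d)"
  \<comment> \<open>\<open>f\<close> vanishes on \<open>B\<close> but not on \<open>V\<close>, so
    the minimum in \<open>card B\<close> is \<open>d + 1\<close>.\<close>
  have "B \<subset> V" using f B by auto
  then have "card B < card V" using finV psubset_card_mono by blast
  then have cardB: "card B = n + 1" using B(2) by (simp add: n_def)
  then obtain v0 where v0: "v0 \<in> B" by (metis add_is_0 card.empty equals0I one_neq_zero)
  have v0V: "v0 \<in> V" using v0 B by blast
  obtain en :: "nat \<Rightarrow> 'd" where en: "bij_betw en {..<n} UNIV"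
    using ex_bij_betw_nat_finite[OF finite[of "UNIV :: 'd set"]] by (auto simp: n_def atLeast0LessThan)
  define \<psi> where "\<psi> i = (if i < n then (\<lambda>u. a (u, en i) - a (v0, en i)) else f)" for i
  have "indep_on {..<Suc n} V \<psi>"
    using stress_kernel_dim_if_not_determined[OF gen B(1) _ v0 f] cardB en unfolding \<psi>_def n_def by simp
  moreover have "\<psi> i \<in> stress_kernel a \<and> \<psi> i v0 = 0" for i
    using f(1) f(2)[OF v0] by (auto simp: \<psi>_def intro!: stress_kernel_diff stress_kernel_coordinate stress_kernel_const)
  ultimately obtain m \<phi> where m: "Suc n \<le> m" and \<phi>\<psi>: "\<And>i. i < Suc n \<Longrightarrow> \<phi> i = \<psi> i"
    and \<phi>: "\<And>i. i < m \<Longrightarrow> \<phi> i \<in> stress_kernel a" "\<And>i. i < m \<Longrightarrow> \<phi> i v0 = 0" "indep_on {..<m} V \<phi>"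
    and span: "\<And>f. f \<in> stress_kernel a \<Longrightarrow> f v0 = 0 \<Longrightarrow> comb_on {..<m} V \<phi> f"
    using stress_kernel_basis[OF v0V, of "Suc n" \<psi> a] by metis
  have \<phi>n: "\<phi> i u = a (u, en i) - a (v0, en i)" if "i < n" for i u using \<phi>\<psi>[of i] that by (simp add: \<psi>_def)
  have delta_\<phi>: "delta (\<phi> i) e = delta (\<lambda>u. a (u, en i)) e" if "i < n" for i e
    using \<phi>n[OF that] by (simp add: delta_def)
  \<comment> \<open>The positions of an upper trapezoidal matrix with \<open>n\<close> rows and
    \<open>m > n\<close> columns. This shape removes the orthogonal group up to signs, as vanishing
    at \<open>v0\<close> removes the translations.\<close>
  define I where "I = Sigma {..<n} (\<lambda>i. {i..<m})"
  have finI: "finite I" by (simp add: I_def)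
  have sumI: "(\<Sum>q\<in>I. h q) = (\<Sum>i<n. \<Sum>j\<in>{i..<m}. h (i, j))" for h :: "nat \<times> nat \<Rightarrow> real"
    unfolding I_def by (simp add: sum.Sigma)
  define Cp where "Cp p e = delta (\<phi> (fst p)) e * delta (\<phi> (snd p)) e" for p e
  have mem: "comb_on I E Cp (\<lambda>e. delta (\<phi> j) e * delta (\<phi> k) e)" if "j < n \<or> k < n" "j < m" "k < m" for j k
  proof -
    have "(min j k, max j k) \<in> I" using that by (auto simp: I_def)
    then have "comb_on I E Cp (Cp (min j k, max j k))" by (rule comb_on_member[OF finI])
    then show ?thesis by (rule comb_on_cong[rotated]) (auto simp: Cp_def min_def max_def)
  qed
  \<comment> \<open>By \<open>stress_kernel_products\<close> the product is a sum of products of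
    coordinates with kernel elements, which are constants plus combinations of the
    \<open>\<phi> l\<close>.\<close>
  have comb: "comb_on I E Cp (\<lambda>e. delta (\<phi> j) e * delta (\<phi> k) e)" if jk: "j < m" "k < m" for j k
  proof -
    obtain h where h: "\<And>i. h i \<in> stress_kernel a"
      "\<And>e. e \<in> E \<Longrightarrow> delta (\<phi> j) e * delta (\<phi> k) e = (\<Sum>i\<in>UNIV. delta (\<lambda>u. a (u, i)) e * delta (h i) e)"
      by (rule stress_kernel_products[OF gen \<phi>(1)[OF jk(1)] \<phi>(1)[OF jk(2)]]) (rule that)
    have "comb_on I E Cp (\<lambda>e. delta (\<phi> i) e * delta (h (en i)) e)" if i: "i < n" for i
    proof -
      have "comb_on {..<m} V \<phi> (\<lambda>u. h (en i) u - h (en i) v0)"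
        by (intro span stress_kernel_diff h(1) stress_kernel_const) simp
      then obtain \<eta> where \<eta>: "\<And>u. u \<in> V \<Longrightarrow> h (en i) u - h (en i) v0 = (\<Sum>l<m. \<eta> l * \<phi> l u)"
        unfolding comb_on_def by blast
      have d: "delta (h (en i)) e = (\<Sum>l<m. \<eta> l * delta (\<phi> l) e)" if "e \<in> E" for e
      proof -
        have "delta (h (en i)) e = delta (\<lambda>u. h (en i) u - h (en i) v0) e" by (simp add: delta_def)
        also have "\<dots> = delta (\<lambda>u. \<Sum>l<m. \<eta> l * \<phi> l u) e" by (rule delta_cong[OF that \<eta>])
        finally show ?thesis by (simp add: delta_sum delta_scale)
      qed
      have "comb_on I E Cp (\<lambda>e. \<Sum>l<m. \<eta> l * (delta (\<phi> i) e * delta (\<phi> l) e))"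
        using i m by (intro comb_on_sum comb_on_scale mem) auto
      then show ?thesis by (rule comb_on_cong[rotated]) (simp add: d sum_distrib_left mult_ac)
    qed
    then have "comb_on I E Cp (\<lambda>e. \<Sum>i<n. delta (\<phi> i) e * delta (h (en i)) e)" by (intro comb_on_sum) simp
    moreover have "(\<Sum>i<n. delta (\<phi> i) e * delta (h (en i)) e) = delta (\<phi> j) e * delta (\<phi> k) e" if "e \<in> E" for e
      unfolding h(2)[OF that] sum.reindex_bij_betw[OF en, of "\<lambda>i. delta (\<lambda>u. a (u, i)) e * delta (h i) e", symmetric]
      by (rule sum.cong) (simp_all add: delta_\<phi>)
    ultimately show ?thesis by (rule comb_on_cong[rotated])
  qed
  \<comment> \<open>If one factor is a coordinate, the product is one of the \<open>Cp p\<close>,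
    and its coefficients are taken to be the unit vector.\<close>
  have "\<forall>jk. \<exists>g. fst jk < m \<longrightarrow> snd jk < m \<longrightarrow>
      (\<forall>e\<in>E. delta (\<phi> (fst jk)) e * delta (\<phi> (snd jk)) e = (\<Sum>p\<in>I. g p * Cp p e)) \<and>
      (fst jk < n \<or> snd jk < n \<longrightarrow> (\<forall>p. g p = (if p = (min (fst jk) (snd jk), max (fst jk) (snd jk)) then 1 else 0)))"
  proof
    fix jk :: "nat \<times> nat"
    obtain j k where jk: "jk = (j, k)" by (cases jk)
    define p0 where "p0 = (min j k, max j k)"
    show "\<exists>g. fst jk < m \<longrightarrow> snd jk < m \<longrightarrow>
      (\<forall>e\<in>E. delta (\<phi> (fst jk)) e * delta (\<phi> (snd jk)) e = (\<Sum>p\<in>I. g p * Cp p e)) \<and>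
      (fst jk < n \<or> snd jk < n \<longrightarrow> (\<forall>p. g p = (if p = (min (fst jk) (snd jk), max (fst jk) (snd jk)) then 1 else 0)))"
    proof (cases "j < m \<and> k < m \<and> (j < n \<or> k < n)")
      case True
      then have p0: "p0 \<in> I" by (auto simp: I_def p0_def)
      have "(\<Sum>p\<in>I. (if p = p0 then 1 else 0) * Cp p e) = delta (\<phi> j) e * delta (\<phi> k) e" for e
      proof -
        have "(\<Sum>p\<in>I. (if p = p0 then 1 else 0) * Cp p e) = (\<Sum>p\<in>I. if p = p0 then Cp p e else 0)"
          by (rule sum.cong) auto
        also have "\<dots> = Cp p0 e" using p0 finI by simp
        finally show ?thesis by (auto simp: Cp_def p0_def min_def max_def)
      qed
      then show ?thesis unfolding jk by (intro exI[of _ "\<lambda>p. if p = p0 then 1 else 0"]) (simp add: p0_def)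
    next
      case False
      then show ?thesis using comb[of j k] unfolding jk comb_on_def by auto
    qed
  qed
  from choice[OF this] obtain g' where g': "\<And>jk. fst jk < m \<Longrightarrow> snd jk < m \<Longrightarrow>
      (\<forall>e\<in>E. delta (\<phi> (fst jk)) e * delta (\<phi> (snd jk)) e = (\<Sum>p\<in>I. g' jk p * Cp p e)) \<and>
      (fst jk < n \<or> snd jk < n \<longrightarrow> (\<forall>p. g' jk p = (if p = (min (fst jk) (snd jk), max (fst jk) (snd jk)) then 1 else 0)))"
    by blast
  define g where "g j k = g' (j, k)" for j k
  have g: "\<And>e. e \<in> E \<Longrightarrow> delta (\<phi> j) e * delta (\<phi> k) e = (\<Sum>p\<in>I. g j k p * Cp p e)"
    "\<And>p. j < n \<or> k < n \<Longrightarrow> g j k p = (if p = (min j k, max j k) then 1 else 0)" if "j < m" "k < m" for j k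
  proof -
    have "(\<forall>e\<in>E. delta (\<phi> j) e * delta (\<phi> k) e = (\<Sum>p\<in>I. g j k p * Cp p e)) \<and>
      (j < n \<or> k < n \<longrightarrow> (\<forall>p. g j k p = (if p = (min j k, max j k) then 1 else 0)))"
      using g'[of "(j, k)", unfolded fst_conv snd_conv, OF that] unfolding g_def .
    then show "\<And>e. e \<in> E \<Longrightarrow> delta (\<phi> j) e * delta (\<phi> k) e = (\<Sum>p\<in>I. g j k p * Cp p e)"
      "\<And>p. j < n \<or> k < n \<Longrightarrow> g j k p = (if p = (min j k, max j k) then 1 else 0)" by blast+
  qed
  \<comment> \<open>\<open>x\<close> is an upper trapezoidal matrix and \<open>\<tau> x\<close> the framework with these coordinates in the basis \<open>\<phi>\<close>, so \<open>x0\<close>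
    stands for \<open>a\<close>. Up to a factor, \<open>F x\<close> are coefficients of the squared lengths of \<open>\<tau> x\<close> in terms of the \<open>Cp p\<close>. They
    are chosen such that \<open>F\<close> has derivative 1 at \<open>x0\<close> even if the \<open>Cp p\<close> are linearly dependent.\<close>
  define bil where "bil x y p = (\<Sum>q\<in>I. \<Sum>j\<in>{fst q..<m}. x q * y (fst q, j) * g j (snd q) p)"
    for x y :: "nat \<times> nat \<Rightarrow> real" and p
  define F where "F x p = bil x x p / 2" for x p
  define x0 :: "nat \<times> nat \<Rightarrow> real" where "x0 q = (if fst q = snd q then 1 else 0)" for q
  define P where "P = (\<lambda>i. (i, i)) ` {..<n}"
  define R where "R p = {fst p} \<times> {fst p<..<m}" for p :: "nat \<times> nat"
  \<comment> \<open>With these weights the functional of \<open>F x\<close> is half the sum of all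
    squared edge lengths.\<close>
  define l where "l p = (\<Sum>e\<in>E. Cp p e)" for p
  define \<tau> where "\<tau> x i u = (\<Sum>j\<in>{i..<m}. x (i, j) * \<phi> j u)" for x :: "nat \<times> nat \<Rightarrow> real" and i u
  have delta_\<tau>: "delta (\<tau> x i) e = (\<Sum>j\<in>{i..<m}. x (i, j) * delta (\<phi> j) e)" for x i e
    unfolding \<tau>_def[abs_def] by (simp add: delta_sum delta_scale)
  have FC: "(\<Sum>p\<in>I. F x p * Cp p e) = (\<Sum>i<n. (delta (\<tau> x i) e)\<^sup>2) / 2" if e: "e \<in> E" for x e
  proof -
    have "(\<Sum>p\<in>I. bil x x p * Cp p e) = (\<Sum>p\<in>I. \<Sum>q\<in>I. \<Sum>j\<in>{fst q..<m}. x q * x (fst q, j) * (g j (snd q) p * Cp p e))"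
      unfolding bil_def sum_distrib_right by (simp add: mult_ac)
    also have "\<dots> = (\<Sum>q\<in>I. \<Sum>j\<in>{fst q..<m}. \<Sum>p\<in>I. x q * x (fst q, j) * (g j (snd q) p * Cp p e))"
      by (subst sum.swap) (intro sum.cong refl sum.swap)
    also have "\<dots> = (\<Sum>q\<in>I. \<Sum>j\<in>{fst q..<m}. x q * x (fst q, j) * (delta (\<phi> j) e * delta (\<phi> (snd q)) e))"
    proof (intro sum.cong refl)
      fix q j assume "q \<in> I" "j \<in> {fst q..<m}"
      then show "(\<Sum>p\<in>I. x q * x (fst q, j) * (g j (snd q) p * Cp p e))
        = x q * x (fst q, j) * (delta (\<phi> j) e * delta (\<phi> (snd q)) e)"
        using g(1)[of j "snd q" e] e by (auto simp: I_def sum_distrib_left)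
    qed
    also have "\<dots> = (\<Sum>i<n. (delta (\<tau> x i) e)\<^sup>2)"
      unfolding sumI delta_\<tau> power2_eq_square sum_product by (simp add: mult_ac)
    finally show ?thesis unfolding F_def by (simp add: sum_divide_distrib[symmetric])
  qed
  have lF: "(\<Sum>p\<in>I. l p * F x p) = (\<Sum>e\<in>E. \<Sum>i<n. (delta (\<tau> x i) e)\<^sup>2) / 2" for x
  proof -
    have "(\<Sum>p\<in>I. l p * F x p) = (\<Sum>p\<in>I. \<Sum>e\<in>E. F x p * Cp p e)"
      unfolding l_def sum_distrib_right by (simp add: mult.commute)
    also have "\<dots> = (\<Sum>e\<in>E. \<Sum>p\<in>I. F x p * Cp p e)" by (rule sum.swap)
    finally show ?thesis by (simp add: FC sum_divide_distrib)
  qed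
  \<comment> \<open>\<open>x0\<close> is a two-sided unit for \<open>bil\<close>, so the derivative
    of \<open>bil x x / 2\<close> at \<open>x0\<close> is the identity; hence the factor
    1/2.\<close>
  have bil_x0: "bil z x0 p = z p" "bil x0 z p = z p" if "p \<in> I" for z p
  proof -
    have "bil z x0 p = (\<Sum>q\<in>I. if q = p then z q else 0)"
      unfolding bil_def
    proof (rule sum.cong)
      fix q assume q: "q \<in> I"
      have "(\<Sum>j\<in>{fst q..<m}. z q * x0 (fst q, j) * g j (snd q) p) = (\<Sum>j\<in>{fst q..<m}. if j = fst q then z q * g j (snd q) p else 0)"
        by (rule sum.cong) (auto simp: x0_def)
      also have "\<dots> = z q * g (fst q) (snd q) p" using q by (auto simp: I_def)
      also have "\<dots> = (if q = p then z q else 0)" using q g(2)[of "fst q" "snd q" p] m by (auto simp: I_def)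
      finally show "(\<Sum>j\<in>{fst q..<m}. z q * x0 (fst q, j) * g j (snd q) p) = (if q = p then z q else 0)" .
    qed simp
    then show "bil z x0 p = z p" using that finI by simp
    have "bil x0 z p = (\<Sum>i<n. \<Sum>k\<in>{i..<m}. \<Sum>j\<in>{i..<m}. x0 (i, k) * z (i, j) * g j k p)"
      unfolding bil_def sumI by simp
    also have "\<dots> = (\<Sum>i<n. \<Sum>j\<in>{i..<m}. if (i, j) = p then z (i, j) else 0)"
    proof (rule sum.cong)
      fix i assume i: "i \<in> {..<n}"
      have "(\<Sum>k\<in>{i..<m}. \<Sum>j\<in>{i..<m}. x0 (i, k) * z (i, j) * g j k p)
        = (\<Sum>k\<in>{i..<m}. if k = i then (\<Sum>j\<in>{i..<m}. z (i, j) * g j i p) else 0)"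
        by (rule sum.cong) (auto simp: x0_def)
      also have "\<dots> = (\<Sum>j\<in>{i..<m}. z (i, j) * g j i p)" using i m by auto
      also have "\<dots> = (\<Sum>j\<in>{i..<m}. if (i, j) = p then z (i, j) else 0)"
        using i m by (intro sum.cong) (auto simp: g(2) min_def max_def)
      finally show "(\<Sum>k\<in>{i..<m}. \<Sum>j\<in>{i..<m}. x0 (i, k) * z (i, j) * g j k p)
        = (\<Sum>j\<in>{i..<m}. if (i, j) = p then z (i, j) else 0)" .
    qed simp
    also have "\<dots> = (\<Sum>q\<in>I. if q = p then z q else 0)" unfolding sumI ..
    finally show "bil x0 z p = z p" using that finI by simp
  qed
  have taylor: "F x p - F x0 p - (x p - x0 p) = bil (\<lambda>q. x q - x0 q) (\<lambda>q. x q - x0 q) p / 2" if "p \<in> I" for x p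
  proof -
    have "bil (\<lambda>q. x q - x0 q) (\<lambda>q. x q - x0 q) p = bil x x p - bil x x0 p - bil x0 x p + bil x0 x0 p"
      unfolding bil_def sum_subtractf[symmetric] sum.distrib[symmetric]
      by (intro sum.cong refl) (simp add: algebra_simps)
    then show ?thesis unfolding F_def using bil_x0[OF that] by (simp add: field_simps)
  qed
  define G where "G = (\<Sum>q\<in>I. \<Sum>j\<in>{fst q..<m}. \<Sum>p\<in>I. \<bar>g j (snd q) p\<bar>)"
  have G: "G \<ge> 0" unfolding G_def by (intro sum_nonneg) auto
  \<comment> \<open>Makes \<open>G * r\<close> at most 1/2, and is smaller than the diagonal entries
    1 of \<open>x0\<close>.\<close>
  define r where "r = 1 / (2 * G + 2)"
  have r: "r > 0" "r < 1" "G * r \<le> 1 / 2" using G by (simp_all add: r_def field_simps)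
  have remainder: "(\<Sum>p\<in>I. \<bar>bil z z p / 2\<bar>) \<le> G * (dist_on I z (\<lambda>_. 0))\<^sup>2" for z
  proof -
    define \<delta> where "\<delta> = dist_on I z (\<lambda>_. 0)"
    have zq: "\<bar>z q\<bar> \<le> \<delta>" if "q \<in> I" for q
      unfolding \<delta>_def dist_on_def using member_le_sum[OF that, of "\<lambda>q. \<bar>z q - 0\<bar>"] finI by simp
    have "(\<Sum>p\<in>I. \<bar>bil z z p / 2\<bar>) \<le> (\<Sum>p\<in>I. \<Sum>q\<in>I. \<Sum>j\<in>{fst q..<m}. \<delta>\<^sup>2 * \<bar>g j (snd q) p\<bar>)"
    proof (rule sum_mono)
      fix p assume "p \<in> I"
      have "\<bar>bil z z p / 2\<bar> \<le> \<bar>bil z z p\<bar>" by simp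
      also have "\<dots> \<le> (\<Sum>q\<in>I. \<Sum>j\<in>{fst q..<m}. \<bar>z q * z (fst q, j) * g j (snd q) p\<bar>)"
        unfolding bil_def by (intro order_trans[OF sum_abs] sum_mono order_refl)
      also have "\<dots> \<le> (\<Sum>q\<in>I. \<Sum>j\<in>{fst q..<m}. \<delta>\<^sup>2 * \<bar>g j (snd q) p\<bar>)"
      proof (intro sum_mono)
        fix q j assume "q \<in> I" "j \<in> {fst q..<m}"
        then have "(fst q, j) \<in> I" by (auto simp: I_def)
        then have "\<bar>z q\<bar> * \<bar>z (fst q, j)\<bar> \<le> \<delta> * \<delta>" using zq \<open>q \<in> I\<close> by (intro mult_mono) (auto intro: order_trans[OF abs_ge_zero])
        then show "\<bar>z q * z (fst q, j) * g j (snd q) p\<bar> \<le> \<delta>\<^sup>2 * \<bar>g j (snd q) p\<bar>"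
          unfolding abs_mult power2_eq_square by (intro mult_right_mono) auto
      qed
      finally show "\<bar>bil z z p / 2\<bar> \<le> (\<Sum>q\<in>I. \<Sum>j\<in>{fst q..<m}. \<delta>\<^sup>2 * \<bar>g j (snd q) p\<bar>)" .
    qed
    also have "\<dots> = (\<Sum>q\<in>I. \<Sum>j\<in>{fst q..<m}. \<Sum>p\<in>I. \<delta>\<^sup>2 * \<bar>g j (snd q) p\<bar>)"
      by (subst sum.swap) (intro sum.cong refl sum.swap)
    also have "\<dots> = G * \<delta>\<^sup>2" unfolding G_def by (simp add: sum_distrib_left mult.commute)
    finally show ?thesis unfolding \<delta>_def .
  qed
  \<comment> \<open>A combination whose differences vanish on all edges is constant by rigidity, and
    it vanishes at \<open>v0\<close>.\<close>
  have ind: "indep_on {..<m} E (\<lambda>j. delta (\<phi> j))"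
    unfolding indep_on_def
  proof (intro allI impI)
    fix c assume c: "\<forall>e\<in>E. (\<Sum>j<m. c j * delta (\<phi> j) e) = 0"
    define h where "h u = (\<Sum>j<m. c j * \<phi> j u)" for u
    have "delta h e = 0" if "e \<in> E" for e
      using c that unfolding h_def[abs_def] by (simp add: delta_sum delta_scale)
    then have "h u = h v0" if "u \<in> V" for u using connected_if_rigid[OF rig _ that v0V] by blast
    moreover have "h v0 = 0" using \<phi>(2) by (simp add: h_def)
    ultimately have "\<forall>u\<in>V. (\<Sum>j<m. c j * \<phi> j u) = 0" unfolding h_def by simp
    then show "\<forall>j\<in>{..<m}. c j = 0" using \<phi>(3) unfolding indep_on_def by blast
  qed
  \<comment> \<open>Dual vectors on the edges recover the entries of \<open>x\<close> from the edge
    differences of \<open>\<tau> x\<close>, so the energy bounds them.\<close>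
  have "\<forall>j. \<exists>z. \<forall>k<m. (\<Sum>e\<in>E. z e * delta (\<phi> k) e) = (if k = j then 1 else 0)"
  proof (intro allI)
    fix j
    obtain z where "\<And>k. k \<in> {..<m} \<Longrightarrow> (\<Sum>e\<in>E. z e * delta (\<phi> k) e) = (if k = j then 1 else 0)"
      by (rule indep_on_interpolation[OF _ finE ind, of "\<lambda>k. if k = j then 1 else 0"]) (simp, rule that)
    then show "\<exists>z. \<forall>k<m. (\<Sum>e\<in>E. z e * delta (\<phi> k) e) = (if k = j then 1 else 0)"
      by (intro exI[of _ z]) (simp only: lessThan_iff, blast)
  qed
  from choice[OF this] obtain z where
    z: "\<And>j k. k < m \<Longrightarrow> (\<Sum>e\<in>E. z j e * delta (\<phi> k) e) = (if k = j then 1 else 0)" by blast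
  define W where "W = (\<Sum>j<m. \<Sum>e\<in>E. \<bar>z j e\<bar>) + 1"
  have W: "W > 0" unfolding W_def by (intro add_nonneg_pos sum_nonneg) auto
  define energy where "energy x = (\<Sum>e\<in>E. \<Sum>i<n. (delta (\<tau> x i) e)\<^sup>2)" for x
  have coercive: "\<bar>x p\<bar> \<le> W * sqrt (energy x)" if p: "p \<in> I" for x p
  proof -
    obtain i j where ij: "p = (i, j)" "i < n" "i \<le> j" "j < m" using p by (auto simp: I_def)
    have "x p = (\<Sum>k\<in>{i..<m}. x (i, k) * (if k = j then 1 else 0))"
      using ij by (simp add: if_distrib cong: if_cong)
    also have "\<dots> = (\<Sum>k\<in>{i..<m}. x (i, k) * (\<Sum>e\<in>E. z j e * delta (\<phi> k) e))"
      by (intro sum.cong refl) (simp add: z)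
    also have "\<dots> = (\<Sum>e\<in>E. z j e * delta (\<tau> x i) e)"
      unfolding delta_\<tau> sum_distrib_left by (subst sum.swap) (simp add: mult_ac)
    finally have "\<bar>x p\<bar> \<le> (\<Sum>e\<in>E. \<bar>z j e\<bar> * \<bar>delta (\<tau> x i) e\<bar>)"
      using sum_abs[of "\<lambda>e. z j e * delta (\<tau> x i) e" E] by (simp add: abs_mult)
    also have "\<dots> \<le> (\<Sum>e\<in>E. \<bar>z j e\<bar> * sqrt (energy x))"
    proof (intro sum_mono mult_left_mono)
      fix e assume e: "e \<in> E"
      have "(delta (\<tau> x i) e)\<^sup>2 \<le> (\<Sum>i<n. (delta (\<tau> x i) e)\<^sup>2)"
        using ij by (intro member_le_sum[of i "{..<n}" "\<lambda>i. (delta (\<tau> x i) e)\<^sup>2"]) auto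
      also have "\<dots> \<le> energy x" unfolding energy_def
        by (rule member_le_sum[OF e, of "\<lambda>e. \<Sum>i<n. (delta (\<tau> x i) e)\<^sup>2"]) (auto intro: sum_nonneg finE)
      finally show "\<bar>delta (\<tau> x i) e\<bar> \<le> sqrt (energy x)" using real_le_rsqrt by (metis power2_abs)
    qed auto
    also have "\<dots> = (\<Sum>e\<in>E. \<bar>z j e\<bar>) * sqrt (energy x)" by (simp add: sum_distrib_right)
    also have "\<dots> \<le> W * sqrt (energy x)"
    proof (rule mult_right_mono)
      have "(\<Sum>e\<in>E. \<bar>z j e\<bar>) \<le> (\<Sum>j<m. \<Sum>e\<in>E. \<bar>z j e\<bar>)"
        using ij by (intro member_le_sum[of j "{..<m}" "\<lambda>j. \<Sum>e\<in>E. \<bar>z j e\<bar>"]) (auto intro: sum_nonneg)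
      then show "(\<Sum>e\<in>E. \<bar>z j e\<bar>) \<le> W" by (simp add: W_def)
      show "0 \<le> sqrt (energy x)" unfolding energy_def by (intro real_sqrt_ge_zero sum_nonneg) auto
    qed
    finally show ?thesis .
  qed
  \<comment> \<open>An entry of absolute value \<open>M\<close> forces
    \<open>sqrt (energy x) > energy x0 + 3\<close>, hence \<open>energy x > energy x0 + 3\<close>,
    and half of the gain exceeds 1. The summand 2 exceeds \<open>x0 p + r\<close>.\<close>
  define M where "M = W * (energy x0 + 3) + 2"
  have e0: "energy x0 \<ge> 0" unfolding energy_def by (intro sum_nonneg) auto
  have n_pos: "n > 0" by (simp add: n_def)
  interpret folded_map I P R F x0 l r M
  proof
    show "finite I" by (fact finI)
    have "(0, 0) \<in> I" using n_pos m by (simp add: I_def)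
    then show "I \<noteq> {}" by blast
    show "P \<subseteq> I" using m by (auto simp: P_def I_def)
    show "R p \<subseteq> I - P" if "p \<in> P" for p using that m by (auto simp: P_def R_def I_def)
    show "R p \<noteq> {}" if "p \<in> P" for p
    proof -
      from that obtain i where "p = (i, i)" "i < n" unfolding P_def by blast
      then have "(i, Suc i) \<in> R p" using m by (simp add: R_def)
      then show ?thesis by blast
    qed
    show "(\<lambda>k. F (X k) p) \<longlonglongrightarrow> F x p" if "\<And>i. i \<in> I \<Longrightarrow> (\<lambda>k. X k i) \<longlonglongrightarrow> x i" "p \<in> I" for X x p
    proof -
      have "(\<lambda>k. bil (X k) (X k) p) \<longlonglongrightarrow> bil x x p"
        unfolding bil_def by (intro tendsto_sum tendsto_mult tendsto_const that(1)) (auto simp: I_def)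
      then show ?thesis unfolding F_def by (intro tendsto_divide tendsto_const) auto
    qed
    show "F (flip (R p) x) q = F x q" if p: "p \<in> P" "x p = 0" for p x q
    proof -
      obtain i where i: "p = (i, i)" "i < n" using p(1) by (auto simp: P_def)
      have "bil (flip (R p) x) (flip (R p) x) q = bil x x q"
        unfolding bil_def
      proof (intro sum.cong refl)
        fix k j assume k: "k \<in> I" and j: "j \<in> {fst k..<m}"
        \<comment> \<open>As the diagonal entry vanishes, the flip negates the whole row, and
          \<open>bil\<close> multiplies only entries of the same row.\<close>
        have "flip (R p) x k * flip (R p) x (fst k, j) = x k * x (fst k, j)"
          using k j p(2) unfolding i by (cases k) (auto simp: flip_def R_def I_def le_less)
        then show "flip (R p) x k * flip (R p) x (fst k, j) * g j (snd k) q = x k * x (fst k, j) * g j (snd k) q" by simp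
      qed
      then show ?thesis by (simp add: F_def)
    qed
    show "0 < r" by (fact r(1))
    show "r < x0 p" if "p \<in> P" for p using that r by (auto simp: P_def x0_def)
    show "(\<Sum>i\<in>I. \<bar>F x i - F x0 i - (x i - x0 i)\<bar>) \<le> dist_on I x x0 / 2" if "dist_on I x x0 \<le> r" for x
    proof -
      have "(\<Sum>i\<in>I. \<bar>F x i - F x0 i - (x i - x0 i)\<bar>) = (\<Sum>p\<in>I. \<bar>bil (\<lambda>q. x q - x0 q) (\<lambda>q. x q - x0 q) p / 2\<bar>)"
        by (rule sum.cong) (simp_all add: taylor)
      also have "\<dots> \<le> G * (dist_on I (\<lambda>q. x q - x0 q) (\<lambda>_. 0))\<^sup>2" by (rule remainder)
      also have "dist_on I (\<lambda>q. x q - x0 q) (\<lambda>_. 0) = dist_on I x x0" by (simp add: dist_on_def)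
      also have "G * (dist_on I x x0)\<^sup>2 = (G * dist_on I x x0) * dist_on I x x0" by (simp add: power2_eq_square)
      also have "\<dots> \<le> 1 / 2 * dist_on I x x0"
      proof (rule mult_right_mono)
        have "G * dist_on I x x0 \<le> G * r" using that G by (rule mult_left_mono)
        then show "G * dist_on I x x0 \<le> 1 / 2" using r(3) by simp
        show "0 \<le> dist_on I x x0" unfolding dist_on_def by (intro sum_nonneg) auto
      qed
      finally show ?thesis by simp
    qed
    show "\<bar>x0 p\<bar> + r < M" for p
    proof -
      have "W * (energy x0 + 3) \<ge> 0" using W e0 by simp
      then show ?thesis using r unfolding M_def x0_def by (auto split: if_splits)
    qed
    show "(\<Sum>j\<in>I. l j * F x0 j) + 1 < (\<Sum>j\<in>I. l j * F x j)" if "p \<in> I" "\<bar>x p\<bar> = M" for x p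
    proof -
      have "W * (energy x0 + 3) < W * sqrt (energy x)" using coercive[OF that(1), of x] that(2) unfolding M_def by simp
      then have "energy x0 + 3 < sqrt (energy x)" using W by simp
      moreover have "sqrt (energy x) \<le> energy x"
      proof -
        have "sqrt (energy x) \<ge> 1" using \<open>energy x0 + 3 < sqrt (energy x)\<close> e0 by linarith
        then have "energy x \<ge> 1" by simp
        then have "sqrt (energy x) * 1 \<le> sqrt (energy x) * sqrt (energy x)"
          using \<open>sqrt (energy x) \<ge> 1\<close> by (intro mult_left_mono) auto
        then show ?thesis using \<open>energy x \<ge> 1\<close> by simp
      qed
      ultimately show ?thesis unfolding lF energy_def[symmetric] by (simp add: field_simps)
    qed
  qed
  obtain x where x: "\<And>p. p \<in> P \<Longrightarrow> x p \<ge> 0" "\<And>p. p \<in> I \<Longrightarrow> F x p = F x0 p" "\<exists>p\<in>I. x p \<noteq> x0 p"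
    by (rule second_preimage) (rule that)
  define inv_en where "inv_en = inv_into {..<n} en"
  have inv_en: "inv_en (en i) = i" if "i < n" for i using en that unfolding inv_en_def bij_betw_def by (simp add: inv_into_f_f)
  define b where "b y = (\<lambda>(u, k). \<tau> y (inv_en k) u)" for y
  have sqdist_b: "sqdist (b y) u w = (\<Sum>i<n. (\<tau> y i u - \<tau> y i w)\<^sup>2)" for y u w
    unfolding sqdist_def sum.reindex_bij_betw[OF en, symmetric] by (rule sum.cong) (simp_all add: b_def inv_en)
  have \<tau>x0: "\<tau> x0 i u = \<phi> i u" if "i < n" for i u
  proof -
    have "\<tau> x0 i u = (\<Sum>j\<in>{i..<m}. if j = i then \<phi> j u else 0)"
      unfolding \<tau>_def by (rule sum.cong) (auto simp: x0_def)
    then show ?thesis using that m by simp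
  qed
  have sqdist_x0: "sqdist (b x0) u w = sqdist a u w" for u w
    unfolding sqdist_b unfolding sqdist_def sum.reindex_bij_betw[OF en, symmetric]
    by (rule sum.cong) (simp_all add: \<tau>x0 \<phi>n)
  have len: "sqdist (b x) (s e) (t e) = sqdist a (s e) (t e)" if "e \<in> E" for e
  proof -
    have "(\<Sum>p\<in>I. F x p * Cp p e) = (\<Sum>p\<in>I. F x0 p * Cp p e)" using x(2) by simp
    then have "sqdist (b x) (s e) (t e) = sqdist (b x0) (s e) (t e)"
      unfolding FC[OF that] sqdist_b by (simp add: delta_def)
    then show ?thesis using sqdist_x0 by simp
  qed
  have dist_eq: "sqdist (b x) u w = sqdist (b x0) u w" if "u \<in> V" "w \<in> V" for u w
  proof -
    have "(\<forall>e\<in>E. sqdist (b x) (s e) (t e) = sqdist a (s e) (t e)) \<longrightarrow>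
      (\<forall>u\<in>V. \<forall>w\<in>V. sqdist (b x) u w = sqdist a u w)"
      using rig unfolding rigid_at_def by (rule spec)
    then show ?thesis using len that unfolding sqdist_x0 by blast
  qed
  have \<tau>0: "\<tau> y i v0 = 0" for y i unfolding \<tau>_def using \<phi>(2) by simp
  \<comment> \<open>Polarisation with \<open>v0\<close> at the origin.\<close>
  have polar: "2 * (\<Sum>i<n. \<tau> y i u * \<tau> y i w) = sqdist (b y) u v0 + sqdist (b y) w v0 - sqdist (b y) u w" for y u w
    unfolding sqdist_b \<tau>0 sum_distrib_left sum.distrib[symmetric] sum_subtractf[symmetric]
    by (rule sum.cong) (simp_all add: power2_eq_square algebra_simps)
  have gram: "(\<Sum>i<n. \<tau> x i u * \<tau> x i w) = (\<Sum>i<n. \<tau> x0 i u * \<tau> x0 i w)" if "u \<in> V" "w \<in> V" for u w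
    using polar[of x u w] polar[of x0 u w] dist_eq that v0V by simp
  define X where "X y i j = (if i \<le> j then y (i, j) else 0)" for y :: "nat \<times> nat \<Rightarrow> real" and i j
  have \<tau>X: "\<tau> y i u = (\<Sum>j<m. X y i j * \<phi> j u)" for y i u
    unfolding \<tau>_def by (rule sum.mono_neutral_cong_left) (auto simp: X_def)
  have gramX: "(\<Sum>i<n. \<tau> y i u * \<tau> y i w) = (\<Sum>j<m. (\<Sum>k<m. (\<Sum>i<n. X y i j * X y i k) * \<phi> k w) * \<phi> j u)" for y u w
  proof -
    have "(\<Sum>i<n. \<tau> y i u * \<tau> y i w) = (\<Sum>i<n. \<Sum>j<m. \<Sum>k<m. X y i j * X y i k * \<phi> k w * \<phi> j u)"
      unfolding \<tau>X sum_product by (simp add: mult_ac)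
    also have "\<dots> = (\<Sum>j<m. \<Sum>k<m. \<Sum>i<n. X y i j * X y i k * \<phi> k w * \<phi> j u)"
      by (subst sum.swap) (intro sum.cong refl sum.swap)
    finally show ?thesis by (simp add: sum_distrib_right)
  qed
  \<comment> \<open>Independence of the \<open>\<phi> j\<close>, applied to each of the two vertex
    arguments, carries the equality of inner products over to the columns of
    \<open>X\<close>.\<close>
  define H where "H j k = (\<Sum>i<n. X x i j * X x i k) - (\<Sum>i<n. X x0 i j * X x0 i k)" for j k
  have "H j k = 0" if "j < m" "k < m" for j k
  proof -
    have "(\<Sum>k<m. H j k * \<phi> k w) = 0" if w: "w \<in> V" and j: "j < m" for j w
    proof (rule indep_onD[OF \<phi>(3), of "\<lambda>j. \<Sum>k<m. H j k * \<phi> k w"])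
      fix u assume "u \<in> V"
      then have "(\<Sum>j<m. (\<Sum>k<m. (\<Sum>i<n. X x i j * X x i k) * \<phi> k w) * \<phi> j u)
        - (\<Sum>j<m. (\<Sum>k<m. (\<Sum>i<n. X x0 i j * X x0 i k) * \<phi> k w) * \<phi> j u) = 0"
        unfolding gramX[symmetric] using gram w by simp
      then show "(\<Sum>j<m. (\<Sum>k<m. H j k * \<phi> k w) * \<phi> j u) = 0"
        unfolding H_def left_diff_distrib sum_subtractf .
    qed (use j in simp)
    then show ?thesis using indep_onD[OF \<phi>(3), of "H j" k] that by simp
  qed
  moreover have "(\<Sum>i<n. X x0 i j * X x0 i k) = (if j = k \<and> j < n then 1 else 0)" for j k
  proof -
    have "(\<Sum>i<n. X x0 i j * X x0 i k) = (\<Sum>i<n. if i = j then (if j = k then 1 else 0) else 0)"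
      by (rule sum.cong) (auto simp: X_def x0_def)
    then show ?thesis by simp
  qed
  ultimately have gram1: "(\<Sum>i<n. X x i j * X x i k) = (if j = k \<and> j < n then 1 else 0)" if "j < m" "k < m" for j k
    using that unfolding H_def by (metis eq_iff_diff_eq_0)
  have "X x i j = (if i = j then 1 else 0)" if "i < n" "j < m" for i j
  proof (rule upper_triangular_orthogonal[OF _ _ _ gram1 that])
    show "n \<le> m" using m by simp
    show "X x i j = 0" if "j < i" for i j using that by (simp add: X_def)
    show "X x i i \<ge> 0" if "i < n" for i using x(1)[of "(i, i)"] that by (auto simp: X_def P_def)
  qed
  then have "x p = x0 p" if "p \<in> I" for p using that unfolding X_def x0_def I_def by (cases p) (force split: if_splits)
  then show False using x(3) by blast
qed

end

section \<open>From coordinate functions to frameworks of the graph\<close>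

definition coords :: "('v \<Rightarrow> real ^ 'd) \<Rightarrow> 'v \<times> 'd \<Rightarrow> real" where
  "coords \<rho> = (\<lambda>(u, i). \<rho> u $ i)"

context edge_ends begin

lemma sqdist_coords: "sqdist (coords \<rho>) u w = (norm (\<rho> u - \<rho> w))\<^sup>2"
  unfolding power2_norm_eq_inner inner_vec_def sqdist_def coords_def by (simp add: power2_eq_square)

lemma dist_eq_iff_sqdist:
  "dist (\<sigma> u) (\<sigma> w) = dist (\<rho> u) (\<rho> w) \<longleftrightarrow> sqdist (coords \<sigma>) u w = sqdist (coords \<rho>) u w"
  unfolding sqdist_coords dist_norm by (simp add: power2_eq_iff_nonneg)

theorem rigid_at_dichotomy:
  fixes a b :: "'v \<times> 'd::finite \<Rightarrow> real"
  assumes "generic_point (V \<times> UNIV) a" "generic_point (V \<times> UNIV) b" "rigid_at a"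
  shows "rigid_at b"
proof -
  \<comment> \<open>With at most \<open>d + 1\<close> vertices this is \<open>B = V\<close>, and the
    condition \<open>determined_on\<close> is trivial.\<close>
  obtain B where B: "B \<subseteq> V" "card B = min (card V) (CARD('d) + 1)"
    using obtain_subset_with_card_n[of "min (card V) (CARD('d) + 1)" V] by auto
  have "determined_on B b"
    using determined_on_generic[OF assms(1,2) determined_if_rigid[OF assms(1) B assms(3)]] .
  moreover have "no_conic b"
    using no_conic_generic[OF assms(1,2) no_conic_if_rigid[OF assms(3)]] .
  ultimately show ?thesis using rigid_if_determined[OF assms(2) B(1)] B(2) by simp
qed

end

lemma globally_rigid_iff_rigid_at:
  fixes \<rho> :: "'v \<Rightarrow> real ^ 'd" and E :: "'v set set"
  assumes "edge_ends V E s t" and st: "\<And>e. e \<in> E \<Longrightarrow> e = {s e, t e}"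
  shows "globally_rigid V E \<rho> \<longleftrightarrow> edge_ends.rigid_at V E s t (coords \<rho>)"
proof -
  interpret edge_ends V E s t by fact
  have len: "length_squared E \<sigma> = length_squared E \<rho> \<longleftrightarrow>
      (\<forall>e\<in>E. sqdist (coords \<sigma>) (s e) (t e) = sqdist (coords \<rho>) (s e) (t e))" for \<sigma> :: "'v \<Rightarrow> real ^ 'd"
  proof -
    have "length_squared E \<tau> e = sqdist (coords \<tau>) (s e) (t e)" if "e \<in> E" for e and \<tau> :: "'v \<Rightarrow> real ^ 'd"
      using length_squared_edge[of "s e" "t e" E \<tau>] st[OF that] that unfolding sqdist_coords by metis
    moreover have "length_squared E \<tau> e = undefined" if "e \<notin> E" for e and \<tau> :: "'v \<Rightarrow> real ^ 'd"
      using that by (simp add: length_squared_def)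
    ultimately show ?thesis unfolding fun_eq_iff by metis
  qed
  have congruent: "congruent_frameworks V \<rho> \<sigma> \<longleftrightarrow>
      (\<forall>u\<in>V. \<forall>w\<in>V. sqdist (coords \<sigma>) u w = sqdist (coords \<rho>) u w)" for \<sigma>
    unfolding congruent_frameworks_iff[OF finV] dist_eq_iff_sqdist ..
  show ?thesis
  proof
    assume g: "globally_rigid V E \<rho>"
    show "rigid_at (coords \<rho>)"
      unfolding rigid_at_def
    proof (intro allI impI)
      fix b :: "'v \<times> 'd \<Rightarrow> real"
      assume b: "\<forall>e\<in>E. sqdist b (s e) (t e) = sqdist (coords \<rho>) (s e) (t e)"
      define \<sigma> where "\<sigma> = (\<lambda>u\<in>V. \<chi> i. b (u, i))"
      have \<sigma>: "sqdist (coords \<sigma>) u w = sqdist b u w" if "u \<in> V" "w \<in> V" for u w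
        using that by (simp add: sqdist_def coords_def \<sigma>_def)
      have "\<sigma> \<in> frameworks V" by (simp add: frameworks_def \<sigma>_def)
      moreover have "length_squared E \<sigma> = length_squared E \<rho>" unfolding len using b \<sigma> ends by simp
      ultimately have "congruent_frameworks V \<rho> \<sigma>" using g unfolding globally_rigid_def by blast
      then show "\<forall>u\<in>V. \<forall>w\<in>V. sqdist b u w = sqdist (coords \<rho>) u w" unfolding congruent using \<sigma> by simp
    qed
  next
    assume "rigid_at (coords \<rho>)"
    then show "globally_rigid V E \<rho>"
      unfolding globally_rigid_def len congruent rigid_at_def by blast
  qed
qed

theorem corollary1p15:
  fixes V :: "'v set" and E :: "'v set set"
  assumes "finite_graph V E"
  shows "(\<forall>\<rho> \<in> (frameworks V :: ('v \<Rightarrow> real ^ 'd) set). generic V \<rho> \<longrightarrow> globally_rigid V E \<rho>) \<or>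
         (\<forall>\<rho> \<in> (frameworks V :: ('v \<Rightarrow> real ^ 'd) set). generic V \<rho> \<longrightarrow> \<not> globally_rigid V E \<rho>)"
proof -
  have fin: "finite V" "finite E"
    using assms finite_subset[of E "Pow V"] unfolding finite_graph_def by auto
  \<comment> \<open>An arbitrary orientation of the edges.\<close>
  have "\<forall>e\<in>E. \<exists>p. e = {fst p, snd p}"
    using assms unfolding finite_graph_def card_2_iff by (metis fst_conv snd_conv)
  from bchoice[OF this] obtain p where p: "\<And>e. e \<in> E \<Longrightarrow> e = {fst (p e), snd (p e)}" by blast
  have ends: "edge_ends V E (\<lambda>e. fst (p e)) (\<lambda>e. snd (p e))"
  proof
    fix e assume "e \<in> E"
    then have "e \<subseteq> V" using assms by (simp add: finite_graph_def)
    then show "fst (p e) \<in> V" "snd (p e) \<in> V" using p[OF \<open>e \<in> E\<close>] by blast+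
  qed (fact fin)+
  have iff: "globally_rigid V E \<rho> \<longleftrightarrow> edge_ends.rigid_at V E (\<lambda>e. fst (p e)) (\<lambda>e. snd (p e)) (coords \<rho>)"
    for \<rho> :: "'v \<Rightarrow> real ^ 'd"
    by (rule globally_rigid_iff_rigid_at[OF ends p])
  have "globally_rigid V E \<sigma>" if "generic V \<rho>" "globally_rigid V E \<rho>" "generic V \<sigma>" for \<rho> \<sigma> :: "'v \<Rightarrow> real ^ 'd"
    using edge_ends.rigid_at_dichotomy[OF ends generic_imp_generic_point[OF that(1)] generic_imp_generic_point[OF that(3)]] that(2)
    unfolding iff coords_def by blast
  then show ?thesis by blast
qed

end
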